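(* Let $d\ge 1$, $r\ge d+1$, $1\le m\le r$, and $m\le k\le\min\{m+d,r\}$ be integers, and suppose that $m=1$ or $k\ge m+d-1$. Let $V$ be a finite set with $|V|\ge\max\{m+d,r\}$. Let $X$ be a $d$-Leray simplicial complex on vertex set $V$, and let $M$ be a rank-$r$ matroid on vertex set $V$ with rank function $\rho$. Assume that for every $(d+m)$-element set $U=\{u_1,\dots,u_{d+1},v_1,\dots,v_{m-1}\}\subseteq V$ with $\rho(U)\ge k$, either $\{u_1,\dots,u_{d+1}\}\in X$ or there exists $j\in[m-1]$ such that $\sigma\cup\{v_j\}\in X$ for every $\sigma\subsetneq\{u_1,\dots,u_{d+1}\}$. Set $p=1$ if $k=1$ and $p=d+1$ if $k\ge 2$. Then there exist a basis $B$ of $M$ and $p$ pairwise distinct subsets $I_1,\dots,I_p\subseteq B$ with $|I_i|=r-k+1$ for all $i\in[p]$ such that $$\sum_{i=1}^{p}\delta_X\bigl(V\setminus\operatorname{span}_M(B\setminus I_i)\bigr)\ \ge\ 0 .$$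
   Context: $[n]=\{1,\dots,n\}$ (so $[0]=\varnothing$). The assumption is required for every way of labelling the elements of $U$ as $u_1,\dots,u_{d+1},v_1,\dots,v_{m-1}$. A simplicial complex $K$ is a finite nonempty family of finite sets (faces) closed under taking subsets (so $\varnothing\in K$); its vertex set $V(K)$ is the union of its faces. For $W\subseteq V(K)$, $K[W]=\{\sigma\in K:\sigma\subseteq W\}$. For $\tau\in K$, the link is $\operatorname{lk}(K,\tau)=\{\sigma\in K:\sigma\cap\tau=\varnothing,\ \sigma\cup\tau\in K\}$. $\widetilde H_i(K)$, $i\ge -1$, is reduced simplicial homology over $\mathbb Z$, with $\widetilde H_{-1}(\{\varnothing\})\cong\mathbb Z$ and $\widetilde H_{-1}(K)=0$ if $K$ has a vertex. The Leray number is $$L(K)=\min\{j\ge 0:\widetilde H_i(K[W])=0\text{ for all }W\subseteq V(K)\text{ and all }i\ge j\},$$ and $K$ is $d$-Leray if $L(K)\le d$. The *link-Leray dimension* of a set $W\subseteq V(K)$ is $\delta_K(W)=L(\operatorname{lk}(K,W))$ if $W\in K$, and $\delta_K(W)=-1$ otherwise. A matroid $M$ is a simplicial complex (of independent sets) satisfying the exchange axiom: if $A,B\in M$, $|A|<|B|$, then $A\cup\{x\}\in M$ for some $x\in B\setminus A$. Bases are the inclusion-maximal independent sets, the rank is their common size, $\rho(W)=\rho_M(W)$ is the rank of $M[W]$, and $\operatorname{span}_M(A)=\{v\in V:\rho(A\cup\{v\})=\rho(A)\}$. *)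

theory Defs
  imports "HOL-Algebra.Free_Abelian_Groups"
begin

section \<open>Finite simplicial complexes\<close>

definition fin_complex :: "'a set set \<Rightarrow> bool" where
  "fin_complex K \<longleftrightarrow> finite K \<and> K \<noteq> {} \<and> (\<forall>\<sigma>\<in>K. finite \<sigma>) \<and> (\<forall>\<sigma>\<in>K. \<forall>\<tau>. \<tau> \<subseteq> \<sigma> \<longrightarrow> \<tau> \<in> K)"

definition vertex_set :: "'a set set \<Rightarrow> 'a set" where
  "vertex_set K = \<Union>K"

definition induced_complex :: "'a set set \<Rightarrow> 'a set \<Rightarrow> 'a set set" where
  "induced_complex K W = {\<sigma> \<in> K. \<sigma> \<subseteq> W}"

definition complex_link :: "'a set set \<Rightarrow> 'a set \<Rightarrow> 'a set set" where
  "complex_link K \<tau> = {\<sigma> \<in> K. \<sigma> \<inter> \<tau> = {} \<and> \<sigma> \<union> \<tau> \<in> K}"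


section \<open>Reduced simplicial homology over the integers\<close>

text \<open>
  Simplices are oriented by a linear order of the vertices. So that the vertex type need not
  carry an order, one linear order is chosen once and for all on the whole type; different choices
  give isomorphic homology groups.
\<close>

definition vertex_order :: "'a rel" where
  "vertex_order = (SOME r. linear_order r)"

lemma linear_order_vertex_order: "linear_order (vertex_order :: 'a rel)"
proof -
  obtain r :: "'a rel" where r: "well_order_on (Field r) r" "Field r = UNIV"
    using well_ordering by (elim exE conjE)
  have "linear_order r"
    using r(1) unfolding r(2) well_order_on_def by (rule conjunct1)
  then show ?thesis
    unfolding vertex_order_def by (rule someI)
qed

definition face_sign :: "'a set \<Rightarrow> 'a \<Rightarrow> int" where
  "face_sign \<sigma> v = (- 1) ^ card {u \<in> \<sigma>. u \<noteq> v \<and> (u, v) \<in> vertex_order}"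

text \<open>
  An \<open>i\<close>-simplex is a face with \<open>i + 1\<close> elements, so the empty face is the unique
  \<open>(-1)\<close>-simplex and the boundary map in degree 0 is the augmentation. Chain groups of degree
  below \<open>-1\<close> are trivial.
\<close>

definition chain_gp :: "int \<Rightarrow> 'a set set \<Rightarrow> ('a set \<Rightarrow>\<^sub>0 int) monoid" where
  "chain_gp i K = free_Abelian_group {\<sigma> \<in> K. int (card \<sigma>) = i + 1}"

definition bdry :: "('a set \<Rightarrow>\<^sub>0 int) \<Rightarrow> ('a set \<Rightarrow>\<^sub>0 int)" where
  "bdry = frag_extend (\<lambda>\<sigma>. \<Sum>v\<in>\<sigma>. frag_cmul (face_sign \<sigma> v) (frag_of (\<sigma> - {v})))"

definition red_homology :: "int \<Rightarrow> 'a set set \<Rightarrow> ('a set \<Rightarrow>\<^sub>0 int) set monoid" where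
  "red_homology i K =
     subgroup_generated (chain_gp i K) (kernel (chain_gp i K) (chain_gp (i - 1) K) bdry)
       Mod (bdry ` carrier (chain_gp (i + 1) K))"


section \<open>Leray numbers\<close>

definition leray_number :: "'a set set \<Rightarrow> nat" where
  "leray_number K =
     (LEAST j. \<forall>W \<subseteq> vertex_set K. \<forall>i \<ge> int j. trivial_group (red_homology i (induced_complex K W)))"

definition d_leray :: "nat \<Rightarrow> 'a set set \<Rightarrow> bool" where
  "d_leray d K \<longleftrightarrow> leray_number K \<le> d"

definition link_leray_dim :: "'a set set \<Rightarrow> 'a set \<Rightarrow> int" where
  "link_leray_dim K W = (if W \<in> K then int (leray_number (complex_link K W)) else - 1)"


section \<open>Matroids as complexes of independent sets\<close>

definition fin_matroid :: "'a set set \<Rightarrow> bool" where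
  "fin_matroid M \<longleftrightarrow> fin_complex M \<and>
     (\<forall>A\<in>M. \<forall>B\<in>M. card A < card B \<longrightarrow> (\<exists>x \<in> B - A. insert x A \<in> M))"

definition matroid_bases :: "'a set set \<Rightarrow> 'a set set" where
  "matroid_bases M = {B \<in> M. \<forall>A\<in>M. B \<subseteq> A \<longrightarrow> A = B}"

text \<open>
  All bases of a matroid have the same size, so their set of sizes is a singleton.
\<close>

definition matroid_rank :: "'a set set \<Rightarrow> nat" where
  "matroid_rank M = the_elem (card ` matroid_bases M)"

definition rank_of :: "'a set set \<Rightarrow> 'a set \<Rightarrow> nat" where
  "rank_of M W = matroid_rank (induced_complex M W)"

definition matroid_span :: "'a set set \<Rightarrow> 'a set \<Rightarrow> 'a set" where
  "matroid_span M A = {v \<in> vertex_set M. rank_of M (insert v A) = rank_of M A}"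

end

theory Submission
  imports Defs Complex_Main
begin

text \<open>
  Write \<open>\<delta>(\<tau>)\<close> for the Leray number of the link of a face \<open>\<tau>\<close> of \<open>X\<close>. The heart of the proof is the
  following. If a matroid \<open>N\<close> on \<open>V\<close> is a subcomplex of \<open>X\<close> and \<open>V \<notin> X\<close>, then some face \<open>\<tau>\<close> satisfies
  \<open>\<rho>(V - \<tau>) \<le> \<delta>(\<tau>)\<close>. Otherwise the link of every face \<open>V - J\<close> is acyclic in the dimension \<open>\<rho>(J) - 1\<close>,
  while \<open>N[J]\<close> is acyclic below this dimension; so one can choose, by induction on \<open>J\<close>, rational
  chains \<open>f J \<sigma>\<close> of \<open>N[J]\<close> for \<open>\<sigma> \<subseteq> J\<close>, vanishing if \<open>\<sigma> \<union> (V - J) \<in> X\<close>, with \<open>f {} {}\<close> the empty face and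
  \<open>\<partial>(f J \<sigma>) = (\<Sum>v\<in>\<sigma>. \<plusminus> (f J (\<sigma> - v) - f (J - v) (\<sigma> - v)))\<close>. The alternating trace
  \<open>\<Sum>\<sigma>. (-1)^|\<sigma>| (f J \<sigma>)(\<sigma>)\<close> does not depend on \<open>J\<close>. It is 1 for \<open>J = {}\<close>, but 0 for
  \<open>J = V\<close> since no \<open>\<sigma>\<close> lies in \<open>N\<close> and outside \<open>X\<close>.

  Let \<open>k' = k - m + 1\<close>. If all \<open>S\<close> with \<open>|S| = d + 1\<close> and \<open>\<rho>(S) \<ge> k'\<close> are faces, this applies to the sets with at
  most \<open>d + 1\<close> elements and nullity at most \<open>d + 1 - k'\<close>, and flats through a basis of \<open>V - \<tau>\<close> give the claim. If such
  an \<open>S\<close> is not a face, let \<open>T\<close> consist of all \<open>v\<close> such that the cone from \<open>v\<close> over the boundary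
  of \<open>S\<close> lies in \<open>X\<close>. Since \<open>X\<close> is \<open>d\<close>-Leray, the join of \<open>T\<close> with this boundary lies in \<open>X\<close>,
  so \<open>\<delta>(T) = d\<close>. By hypothesis \<open>V - T\<close> has rank less than \<open>k\<close>, unless it is independent of size \<open>k\<close>;
  in that case its subsets obtained by removing one element of \<open>S\<close> span suitable flats.
\<close>

section \<open>Chains of a simplicial complex\<close>

text \<open>The orientation sign is read in an arbitrary ordered domain: the Leray number involves
  integral chains, while the matroid-valued chains further on are rational.\<close>

definition vsign :: "'a set \<Rightarrow> 'a \<Rightarrow> 'r::linordered_idom" where
  "vsign \<sigma> v = of_int (face_sign \<sigma> v)"

lemma vsign_square [simp]: "vsign \<sigma> v * vsign \<sigma> v = 1"
  by (simp add: vsign_def face_sign_def flip: power_add of_int_mult)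

lemma vsign_nonzero [simp]: "vsign \<sigma> v \<noteq> 0"
  by (metis mult_zero_left vsign_square zero_neq_one)

text \<open>The sign of \<open>w\<close> counts the elements of \<open>\<sigma>\<close> before it,
  and removing \<open>v\<close> changes this count exactly when \<open>v\<close> comes
  first.\<close>

lemma vsign_remove:
  assumes "finite \<sigma>" "v \<in> \<sigma>" "w \<noteq> v"
  shows "(vsign \<sigma> w :: 'r::linordered_idom) =
    (if (v, w) \<in> vertex_order then - vsign (\<sigma> - {v}) w else vsign (\<sigma> - {v}) w)"
proof -
  let ?B = "{u \<in> \<sigma> - {v}. u \<noteq> w \<and> (u, w) \<in> vertex_order}"
  have "{u \<in> \<sigma>. u \<noteq> w \<and> (u, w) \<in> vertex_order} =
      (if (v, w) \<in> vertex_order then insert v ?B else ?B)"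
    using assms by auto
  moreover have "finite ?B" "v \<notin> ?B"
    using assms by auto
  ultimately show ?thesis
    by (simp add: vsign_def face_sign_def)
qed

text \<open>Of two vertices exactly one precedes the other, so reversing the order of removal flips
  exactly one of the two signs. The cancellations in double sums below rest on this.\<close>

lemma vsign_swap:
  assumes "finite \<sigma>" "v \<in> \<sigma>" "w \<in> \<sigma>" "v \<noteq> w"
  shows "vsign \<sigma> v * vsign (\<sigma> - {v}) w = - (vsign \<sigma> w * vsign (\<sigma> - {w}) v :: 'r::linordered_idom)"
proof -
  have "linear_order (vertex_order :: 'a rel)"
    by (rule linear_order_vertex_order)
  then have "((v, w) \<in> vertex_order) \<noteq> ((w, v) \<in> vertex_order)"
    using \<open>v \<noteq> w\<close> by (auto simp: order_on_defs total_on_def antisym_def)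
  then show ?thesis
    using vsign_remove[of \<sigma> v w, where 'r = 'r] vsign_remove[of \<sigma> w v, where 'r = 'r] assms by auto
qed

lemma vsign_swap_insert:
  assumes "finite \<beta>" "x \<notin> \<beta>" "y \<notin> \<beta>" "x \<noteq> y"
  shows "vsign (insert x (insert y \<beta>)) x * vsign (insert y \<beta>) y =
    - (vsign (insert x (insert y \<beta>)) y * vsign (insert x \<beta>) x :: 'r::linordered_idom)"
proof -
  have "insert x (insert y \<beta>) - {x} = insert y \<beta>" "insert x (insert y \<beta>) - {y} = insert x \<beta>"
    using assms by auto
  then show ?thesis
    using vsign_swap[of "insert x (insert y \<beta>)" x y, where 'r = 'r] assms by simp
qed

lemma vsign_exchange:
  assumes "finite \<beta>" "x \<notin> \<beta>" "y \<notin> \<beta>" "x \<noteq> y"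
  shows "vsign (insert x \<beta>) x * vsign (insert y \<beta>) y =
    - (vsign (insert x (insert y \<beta>)) x * vsign (insert x (insert y \<beta>)) y :: 'r::linordered_idom)"
proof -
  let ?\<tau> = "insert x (insert y \<beta>)"
  have "vsign (insert x \<beta>) x * vsign (insert y \<beta>) y =
      vsign (insert x \<beta>) x * (vsign ?\<tau> x * (vsign ?\<tau> x * vsign (insert y \<beta>) y) :: 'r)"
    by (simp flip: mult.assoc)
  also have "\<dots> = - (vsign ?\<tau> x * vsign ?\<tau> y * (vsign (insert x \<beta>) x * vsign (insert x \<beta>) x))"
    unfolding vsign_swap_insert[OF assms] by (simp add: algebra_simps)
  finally show ?thesis by simp
qed

text \<open>The simplicial boundary, read off at the coefficient of \<open>\<beta>\<close>: every
  coface of \<open>\<beta>\<close> inside the ambient vertex set \<open>V\<close> contributes.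
  Chains are plain coefficient functions on sets.\<close>

definition bd :: "'a set \<Rightarrow> ('a set \<Rightarrow> 'r) \<Rightarrow> 'a set \<Rightarrow> 'r::linordered_idom" where
  "bd V c \<beta> = (\<Sum>x\<in>V - \<beta>. vsign (insert x \<beta>) x * c (insert x \<beta>))"

lemma bd_add: "bd V (\<lambda>\<sigma>. a \<sigma> + b \<sigma>) = (\<lambda>\<sigma>. bd V a \<sigma> + bd V b \<sigma>)"
  by (simp add: bd_def fun_eq_iff distrib_left sum.distrib)

lemma bd_diff: "bd V (\<lambda>\<sigma>. a \<sigma> - b \<sigma>) = (\<lambda>\<sigma>. bd V a \<sigma> - bd V b \<sigma>)"
  by (simp add: bd_def fun_eq_iff right_diff_distrib sum_subtractf)

lemma bd_mult: "bd V (\<lambda>\<sigma>. k * a \<sigma>) = (\<lambda>\<sigma>. k * bd V a \<sigma>)"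
  by (simp add: bd_def fun_eq_iff sum_distrib_left mult_ac)

lemma bd_minus: "bd V (\<lambda>\<sigma>. - a \<sigma>) = (\<lambda>\<sigma>. - bd V a \<sigma>)"
  by (simp add: bd_def fun_eq_iff sum_negf)

lemma bd_zero [simp]: "bd V (\<lambda>\<sigma>. 0) = (\<lambda>\<sigma>. 0)"
  by (simp add: bd_def fun_eq_iff)

lemma bd_sum: "bd V (\<lambda>\<sigma>. \<Sum>i\<in>I. f i \<sigma>) = (\<lambda>\<sigma>. \<Sum>i\<in>I. bd V (f i) \<sigma>)"
  by (rule ext) (simp add: bd_def sum_distrib_left sum.swap[of _ I])

lemma bd_outside: "\<lbrakk>\<And>\<sigma>. c \<sigma> \<noteq> 0 \<Longrightarrow> \<sigma> \<subseteq> V; \<not> \<beta> \<subseteq> V\<rbrakk> \<Longrightarrow> bd V c \<beta> = 0"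
  unfolding bd_def by (rule sum.neutral) (metis insert_subset mult_zero_right)

lemma bd_nonzeroE:
  assumes "bd V c \<beta> \<noteq> 0"
  obtains x where "x \<in> V - \<beta>" "c (insert x \<beta>) \<noteq> 0"
  using assms unfolding bd_def by (metis (no_types, lifting) mult_eq_0_iff sum.neutral)

lemma bd_bd:
  assumes "finite V" "\<And>\<sigma>. c \<sigma> \<noteq> 0 \<Longrightarrow> \<sigma> \<subseteq> V"
  shows "bd V (bd V c) = (\<lambda>\<sigma>. 0)"
proof
  fix \<beta>
  show "bd V (bd V c) \<beta> = 0"
  proof (cases "\<beta> \<subseteq> V")
    case False
    then show ?thesis
      using bd_outside[of "bd V c" V \<beta>] bd_outside[of c V] assms(2) by blast
  next
    case True
    \<comment> \<open>The diagonal is set to zero so that both summations run over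
      \<open>V - \<beta>\<close>; the double sum of the antisymmetric \<open>g\<close> then equals
      its own negative.\<close>
    define g where "g x y = (if x = y then 0 else
      vsign (insert x \<beta>) x * (vsign (insert x (insert y \<beta>)) y * c (insert x (insert y \<beta>))))" for x y
    have fin: "finite \<beta>"
      using True assms(1) finite_subset by blast
    have "bd V (bd V c) \<beta> = (\<Sum>x\<in>V - \<beta>. \<Sum>y\<in>V - \<beta>. g x y)"
      unfolding bd_def sum_distrib_left
    proof (rule sum.cong[OF refl])
      fix x assume "x \<in> V - \<beta>"
      show "(\<Sum>y\<in>V - insert x \<beta>. vsign (insert x \<beta>) x *
          (vsign (insert y (insert x \<beta>)) y * c (insert y (insert x \<beta>)))) = (\<Sum>y\<in>V - \<beta>. g x y)"
        by (rule sum.mono_neutral_cong_left) (use assms in \<open>auto simp: g_def insert_commute\<close>)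
    qed
    moreover have "(\<Sum>x\<in>V - \<beta>. \<Sum>y\<in>V - \<beta>. g x y) = - (\<Sum>x\<in>V - \<beta>. \<Sum>y\<in>V - \<beta>. g x y)"
    proof -
      have "g x y = - g y x" if "x \<in> V - \<beta>" "y \<in> V - \<beta>" for x y
      proof (cases "x = y")
        case False
        let ?\<tau> = "insert x (insert y \<beta>)"
        have "vsign (insert x \<beta>) x * vsign ?\<tau> y = - (vsign (insert y \<beta>) y * vsign ?\<tau> x :: 'b)"
          using vsign_swap_insert[of \<beta> x y, where 'r = 'b] that fin False by (simp add: mult.commute)
        moreover have "g x y = (vsign (insert x \<beta>) x * vsign ?\<tau> y) * c ?\<tau>"
            "g y x = (vsign (insert y \<beta>) y * vsign ?\<tau> x) * c ?\<tau>"
          using False by (simp_all add: g_def insert_commute mult.assoc)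
        ultimately show ?thesis by simp
      qed (simp add: g_def)
      then have "(\<Sum>x\<in>V - \<beta>. \<Sum>y\<in>V - \<beta>. g x y) = (\<Sum>x\<in>V - \<beta>. \<Sum>y\<in>V - \<beta>. - g y x)"
        by (intro sum.cong refl)
      also have "\<dots> = - (\<Sum>x\<in>V - \<beta>. \<Sum>y\<in>V - \<beta>. g y x)"
        by (simp only: sum_negf)
      also have "(\<Sum>x\<in>V - \<beta>. \<Sum>y\<in>V - \<beta>. g y x) = (\<Sum>x\<in>V - \<beta>. \<Sum>y\<in>V - \<beta>. g x y)"
        by (rule sum.swap)
      finally show ?thesis .
    qed
    ultimately show ?thesis by simp
  qed
qed

section \<open>Coning from a vertex and splitting off a vertex\<close>

definition cone :: "'a \<Rightarrow> ('a set \<Rightarrow> 'r) \<Rightarrow> 'a set \<Rightarrow> 'r::linordered_idom" where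
  "cone v c \<sigma> = (if v \<in> \<sigma> then vsign \<sigma> v * c (\<sigma> - {v}) else 0)"

text \<open>Write a chain as \<open>cone v a\<close> plus a chain avoiding \<open>v\<close>, where
  \<open>a\<close> avoids \<open>v\<close> too; then this is \<open>a\<close>, the part that lives
  in the link of \<open>v\<close>.\<close>

definition star_part :: "'a \<Rightarrow> ('a set \<Rightarrow> 'r) \<Rightarrow> 'a set \<Rightarrow> 'r::linordered_idom" where
  "star_part v c \<sigma> = (if v \<in> \<sigma> then 0 else vsign (insert v \<sigma>) v * c (insert v \<sigma>))"

lemma cone_zero [simp]: "cone v (\<lambda>\<sigma>. 0) = (\<lambda>\<sigma>. 0)"
  by (simp add: cone_def fun_eq_iff)

lemma star_part_zero [simp]: "star_part v (\<lambda>\<sigma>. 0) = (\<lambda>\<sigma>. 0)"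
  by (simp add: star_part_def fun_eq_iff)

text \<open>The contracting homotopy of a full simplex: a cycle is bounded by its cone. Simplices of
  \<open>c\<close> through \<open>v\<close> are dropped by \<open>cone\<close>, and on the right
  they cancel against the cones over their faces opposite \<open>v\<close>.\<close>

lemma bd_cone:
  assumes "finite V" "v \<in> V" "\<And>\<sigma>. c \<sigma> \<noteq> 0 \<Longrightarrow> \<sigma> \<subseteq> V"
  shows "bd V (cone v c) = (\<lambda>\<sigma>. c \<sigma> - cone v (bd V c) \<sigma>)"
proof
  fix \<beta>
  consider "\<not> \<beta> \<subseteq> V" | "\<beta> \<subseteq> V" "v \<notin> \<beta>" | "\<beta> \<subseteq> V" "v \<in> \<beta>" by blast
  then show "bd V (cone v c) \<beta> = c \<beta> - cone v (bd V c) \<beta>"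
  proof cases
    case 1
    then have "bd V (cone v c) \<beta> = 0"
      by (intro bd_outside) (use assms(2,3) in \<open>auto simp: cone_def split: if_splits\<close>)
    moreover have "bd V c (\<beta> - {v}) = 0"
      by (intro bd_outside) (use 1 assms(2,3) in \<open>auto split: if_splits\<close>)
    ultimately show ?thesis
      using 1 assms(3) by (auto simp: cone_def)
  next
    case 2
    have "bd V (cone v c) \<beta> = (\<Sum>x\<in>{v}. vsign (insert x \<beta>) x * cone v c (insert x \<beta>))"
      unfolding bd_def by (rule sum.mono_neutral_right) (use 2 assms in \<open>auto simp: cone_def\<close>)
    then show ?thesis
      using 2 by (simp add: cone_def flip: mult.assoc)
  next
    case 3
    have fin: "finite \<beta>"
      using 3 assms(1) finite_subset by blast
    let ?\<gamma> = "\<beta> - {v}"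
    have \<beta>: "\<beta> = insert v ?\<gamma>" using 3 by auto
    have "bd V c ?\<gamma> = vsign \<beta> v * c \<beta> + (\<Sum>x\<in>V - \<beta>. vsign (insert x ?\<gamma>) x * c (insert x ?\<gamma>))"
    proof -
      have "V - ?\<gamma> = insert v (V - \<beta>)" using 3 assms by auto
      then show ?thesis
        using 3 assms(1) by (simp add: bd_def insert_absorb)
    qed
    then have "cone v (bd V c) \<beta> =
      c \<beta> + (\<Sum>x\<in>V - \<beta>. vsign \<beta> v * (vsign (insert x ?\<gamma>) x * c (insert x ?\<gamma>)))"
      using 3 by (simp add: cone_def distrib_left sum_distrib_left flip: mult.assoc)
    moreover have "bd V (cone v c) \<beta> =
      - (\<Sum>x\<in>V - \<beta>. vsign \<beta> v * (vsign (insert x ?\<gamma>) x * c (insert x ?\<gamma>)))"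
      unfolding bd_def sum_negf[symmetric]
    proof (rule sum.cong[OF refl])
      fix x assume x: "x \<in> V - \<beta>"
      then have "insert x \<beta> - {v} = insert x ?\<gamma>" using 3 by auto
      moreover have "vsign (insert x \<beta>) x * vsign (insert x \<beta>) v = - (vsign \<beta> v * vsign (insert x ?\<gamma>) x :: 'b)"
        using vsign_exchange[of ?\<gamma> x v, where 'r = 'b] \<beta> x 3 fin by (cases "x = v") (auto simp: mult.commute)
      ultimately show "vsign (insert x \<beta>) x * cone v c (insert x \<beta>) =
        - (vsign \<beta> v * (vsign (insert x ?\<gamma>) x * c (insert x ?\<gamma>)))"
        using 3 by (simp add: cone_def flip: mult.assoc)
    qed
    ultimately show ?thesis by simp
  qed
qed

lemma bd_star_part:
  assumes "finite V" "v \<in> V" "\<And>\<sigma>. c \<sigma> \<noteq> 0 \<Longrightarrow> \<sigma> \<subseteq> V"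
  shows "star_part v (bd V c) = (\<lambda>\<sigma>. - bd V (star_part v c) \<sigma>)"
proof
  fix \<beta>
  consider "\<not> \<beta> \<subseteq> V" | "\<beta> \<subseteq> V" "v \<notin> \<beta>" | "v \<in> \<beta>" by blast
  then show "star_part v (bd V c) \<beta> = - bd V (star_part v c) \<beta>"
  proof cases
    case 1
    then have "bd V (star_part v c) \<beta> = 0"
      by (intro bd_outside) (use assms(2,3) in \<open>auto simp: star_part_def split: if_splits\<close>)
    moreover have "bd V c (insert v \<beta>) = 0"
      by (intro bd_outside) (use 1 assms(2,3) in \<open>auto split: if_splits\<close>)
    ultimately show ?thesis
      by (auto simp: star_part_def)
  next
    case 3
    then show ?thesis
      by (simp add: star_part_def bd_def)
  next
    case 2
    have fin: "finite \<beta>"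
      using 2 assms(1) finite_subset by blast
    have "bd V (star_part v c) \<beta> =
      (\<Sum>x\<in>V - insert v \<beta>. vsign (insert x \<beta>) x * star_part v c (insert x \<beta>))"
      unfolding bd_def by (rule sum.mono_neutral_right) (use assms in \<open>auto simp: star_part_def\<close>)
    also have "\<dots> = (\<Sum>x\<in>V - insert v \<beta>. - (vsign (insert v \<beta>) v *
        (vsign (insert x (insert v \<beta>)) x * c (insert x (insert v \<beta>)))))"
    proof (rule sum.cong[OF refl])
      fix x assume x: "x \<in> V - insert v \<beta>"
      have "vsign (insert x \<beta>) x * vsign (insert v (insert x \<beta>)) v =
        - (vsign (insert v \<beta>) v * vsign (insert x (insert v \<beta>)) x :: 'b)"
        using vsign_swap_insert[of \<beta> v x, where 'r = 'b] x 2 fin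
        by (cases "v = x") (auto simp: mult.commute insert_commute)
      then show "vsign (insert x \<beta>) x * star_part v c (insert x \<beta>) = - (vsign (insert v \<beta>) v *
        (vsign (insert x (insert v \<beta>)) x * c (insert x (insert v \<beta>))))"
        using x 2 by (auto simp: star_part_def insert_commute simp flip: mult.assoc minus_mult_left)
    qed
    also have "\<dots> = - star_part v (bd V c) \<beta>"
      using 2 by (simp add: star_part_def bd_def sum_negf sum_distrib_left)
    finally show ?thesis by simp
  qed
qed

lemma star_part_cone: "star_part v (cone v c) = (\<lambda>\<sigma>. if v \<in> \<sigma> then 0 else c \<sigma>)"
  by (auto simp: star_part_def cone_def fun_eq_iff simp flip: mult.assoc)

lemma cone_star_part: "cone v (star_part v c) = (\<lambda>\<sigma>. if v \<in> \<sigma> then c \<sigma> else 0)"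
  by (auto simp: star_part_def cone_def fun_eq_iff insert_absorb simp flip: mult.assoc)

section \<open>Supports of chains and exactness in one degree\<close>

definition chain_on :: "'a set set \<Rightarrow> nat \<Rightarrow> ('a set \<Rightarrow> 'r::zero) \<Rightarrow> bool" where
  "chain_on K n c \<longleftrightarrow> (\<forall>\<sigma>. c \<sigma> \<noteq> 0 \<longrightarrow> \<sigma> \<in> K \<and> card \<sigma> = n)"

lemma chain_onD: "\<lbrakk>chain_on K n c; c \<sigma> \<noteq> 0\<rbrakk> \<Longrightarrow> \<sigma> \<in> K \<and> card \<sigma> = n"
  by (simp add: chain_on_def)

lemma chain_on_mono: "chain_on K n c \<Longrightarrow> K \<subseteq> L \<Longrightarrow> chain_on L n c"
  by (auto simp: chain_on_def)

lemma chain_on_diff: "chain_on K n a \<Longrightarrow> chain_on K n b \<Longrightarrow> chain_on K n (\<lambda>\<sigma>. a \<sigma> - b \<sigma> :: 'r::linordered_idom)"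
  by (auto simp: chain_on_def) (metis diff_zero)+

text \<open>Here \<open>n\<close> counts the vertices of the simplices, so this is the vanishing of
  integral reduced homology in degree \<open>n - 1\<close>; \<open>n = 0\<close> concerns degree
  -1.\<close>

definition acyclic_at :: "'a set \<Rightarrow> 'a set set \<Rightarrow> nat \<Rightarrow> bool" where
  "acyclic_at V K n \<longleftrightarrow> (\<forall>c :: 'a set \<Rightarrow> int. chain_on K n c \<longrightarrow> bd V c = (\<lambda>\<sigma>. 0) \<longrightarrow>
     (\<exists>b. chain_on K (Suc n) b \<and> bd V b = c))"

section \<open>Reduced homology and links\<close>

lemma trivial_group_Mod_iff:
  assumes "comm_group G" "subgroup H G"
  shows "trivial_group (G Mod H) \<longleftrightarrow> carrier G \<subseteq> H"
proof -
  interpret comm_group G by fact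
  interpret N: normal H G
    by (rule subgroup_imp_normal) fact
  have H: "\<one>\<^bsub>G Mod H\<^esub> = H" "carrier (G Mod H) = rcosets\<^bsub>G\<^esub> H"
    by (simp_all add: FactGroup_def)
  have "carrier (G Mod H) = {H} \<longleftrightarrow> carrier G \<subseteq> H"
  proof
    assume "carrier (G Mod H) = {H}"
    then show "carrier G \<subseteq> H"
      using H rcosets_part_G[OF assms(2)] by auto
  next
    assume "carrier G \<subseteq> H"
    then have "carrier G = H"
      using subgroup.subset[OF assms(2)] by blast
    then have "rcosets\<^bsub>G\<^esub> H = {H}"
      using assms(2) subgroup.rcos_const[OF assms(2)] is_group subgroup.one_closed[OF assms(2)]
      by (auto simp: RCOSETS_def)
    then show "carrier (G Mod H) = {H}"
      using H by simp
  qed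
  then show ?thesis
    using N.factorgroup_is_group H by (simp add: trivial_group_def)
qed

lemma keys_subset_iff_chain_on:
  "Poly_Mapping.keys x \<subseteq> {\<sigma> \<in> K. card \<sigma> = n} \<longleftrightarrow> chain_on K n (Poly_Mapping.lookup x)"
  by (auto simp: chain_on_def in_keys_iff)

lemma lookup_bdry:
  assumes "finite V" "Poly_Mapping.keys x \<subseteq> Pow V"
  shows "Poly_Mapping.lookup (bdry x) = bd V (Poly_Mapping.lookup x)"
proof
  fix \<beta>
  let ?l = "Poly_Mapping.lookup"
  have fin: "finite \<sigma>" if "\<sigma> \<in> Pow V" for \<sigma>
    using that assms(1) finite_subset by auto
  have "?l (bdry x) \<beta> = (\<Sum>\<sigma>\<in>Poly_Mapping.keys x. \<Sum>v\<in>\<sigma>. ?l x \<sigma> * (face_sign \<sigma> v * (if \<beta> = \<sigma> - {v} then 1 else 0)))"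
    by (simp add: bdry_def frag_extend_def Poly_Mapping.lookup_sum sum_distrib_left)
  also have "\<dots> = (\<Sum>\<sigma>\<in>Pow V. \<Sum>v\<in>\<sigma>. ?l x \<sigma> * (face_sign \<sigma> v * (if \<beta> = \<sigma> - {v} then 1 else 0)))"
    using assms by (intro sum.mono_neutral_left) (auto simp: in_keys_iff)
  also have "\<dots> = (\<Sum>(\<sigma>, v)\<in>Sigma (Pow V) (\<lambda>\<sigma>. \<sigma>). ?l x \<sigma> * (face_sign \<sigma> v * (if \<beta> = \<sigma> - {v} then 1 else 0)))"
    using assms fin by (subst sum.Sigma) auto
  \<comment> \<open>Only pairs with \<open>\<sigma> - {v} = \<beta>\<close> survive, and these are
    determined by a vertex \<open>v\<close> outside \<open>\<beta>\<close>.\<close>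
  also have "\<dots> = (\<Sum>(\<sigma>, v)\<in>(\<lambda>v. (insert v \<beta>, v)) ` {v \<in> V - \<beta>. \<beta> \<subseteq> V}. ?l x \<sigma> * (face_sign \<sigma> v * (if \<beta> = \<sigma> - {v} then 1 else 0)))"
    using assms fin by (intro sum.mono_neutral_right) (auto simp: image_iff)
  also have "\<dots> = (\<Sum>v\<in>{v \<in> V - \<beta>. \<beta> \<subseteq> V}. face_sign (insert v \<beta>) v * ?l x (insert v \<beta>))"
    by (subst sum.reindex) (auto simp: inj_on_def intro!: sum.cong)
  also have "\<dots> = bd V (?l x) \<beta>"
  proof (cases "\<beta> \<subseteq> V")
    case True
    then show ?thesis by (simp add: bd_def vsign_def set_diff_eq)
  next
    case False
    then have "bd V (?l x) \<beta> = 0"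
      by (intro bd_outside) (use assms in \<open>auto simp: in_keys_iff\<close>)
    then show ?thesis using False by simp
  qed
  finally show "?l (bdry x) \<beta> = bd V (?l x) \<beta>" .
qed

lemma chain_on_bd:
  assumes "finite V" "K \<subseteq> Pow V" "\<forall>\<sigma>\<in>K. Pow \<sigma> \<subseteq> K" "chain_on K (Suc n) c"
  shows "chain_on K n (bd V c)"
  unfolding chain_on_def
proof (intro allI impI)
  fix \<beta> assume "bd V c \<beta> \<noteq> 0"
  then obtain x where x: "x \<in> V - \<beta>" "c (insert x \<beta>) \<noteq> 0"
    by (rule bd_nonzeroE)
  then have "insert x \<beta> \<in> K" "card (insert x \<beta>) = Suc n"
    using assms(4) by (auto simp: chain_on_def)
  moreover from this have "finite \<beta>"
    using assms(1,2) finite_subset by (metis PowD finite_insert subsetD)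
  ultimately show "\<beta> \<in> K \<and> card \<beta> = n"
    using x assms(3) by auto
qed

text \<open>Passes from the quotient group to bounding chains: the quotient of the cycles
  \<open>Z\<close> by the boundaries \<open>B\<close> is trivial iff \<open>Z \<subseteq> B\<close>,
  and finiteness of \<open>V\<close> identifies coefficient functions on faces with finitely
  supported maps.\<close>

lemma trivial_red_homology_iff:
  assumes V: "finite V" "K \<subseteq> Pow V" and down: "\<forall>\<sigma>\<in>K. Pow \<sigma> \<subseteq> K"
  shows "trivial_group (red_homology (int n - 1) K) \<longleftrightarrow> acyclic_at V K n"
proof -
  let ?l = "Poly_Mapping.lookup"
  define S where "S j = {\<sigma> \<in> K. card \<sigma> = j}" for j
  let ?G = "free_Abelian_group (S n)" and ?G' = "free_Abelian_group (S (Suc n))"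
  define Z where "Z = {x. Poly_Mapping.keys x \<subseteq> S n \<and> bdry x = 0}"
  define B where "B = bdry ` carrier ?G'"
  have keys_Pow: "Poly_Mapping.keys x \<subseteq> Pow V" if "Poly_Mapping.keys x \<subseteq> S j" for x :: "'a set \<Rightarrow>\<^sub>0 int" and j
    using that V by (auto simp: S_def)
  have bdry_add: "bdry (x + y) = bdry x + bdry y" for x y :: "'a set \<Rightarrow>\<^sub>0 int"
    by (simp add: bdry_def frag_extend_add)
  have bdry_minus: "bdry (- x) = - bdry x" for x :: "'a set \<Rightarrow>\<^sub>0 int"
    by (simp add: bdry_def frag_extend_minus)
  have G1: "chain_gp (int n - 1) K = ?G" "chain_gp (int n - 1 + 1) K = ?G'"
    by (auto simp: chain_gp_def S_def intro!: arg_cong[where f = free_Abelian_group])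
  have G2: "kernel ?G (chain_gp (int n - 1 - 1) K) bdry = Z"
    by (auto simp: kernel_def chain_gp_def Z_def)
  interpret G: comm_group ?G by (rule abelian_free_Abelian_group)
  have Zsub: "subgroup Z ?G"
  proof (rule G.subgroupI)
    show "Z \<noteq> {}" by (auto simp: Z_def bdry_def intro!: exI[of _ 0])
    show "x \<otimes>\<^bsub>?G\<^esub> y \<in> Z" if "x \<in> Z" "y \<in> Z" for x y
      using that Poly_Mapping.keys_add[of x y] by (auto simp: Z_def bdry_add)
  qed (auto simp: Z_def bdry_minus)
  have BZ: "B \<subseteq> Z"
  proof
    fix y assume "y \<in> B"
    then obtain x where x: "Poly_Mapping.keys x \<subseteq> S (Suc n)" "y = bdry x"
      by (auto simp: B_def)
    have ly: "?l y = bd V (?l x)"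
      using lookup_bdry[OF V(1) keys_Pow[OF x(1)]] x(2) by simp
    have "chain_on K (Suc n) (?l x)"
      using x(1) unfolding S_def by (simp add: keys_subset_iff_chain_on)
    then have "chain_on K n (?l y)"
      unfolding ly by (rule chain_on_bd[OF V down])
    then have ky: "Poly_Mapping.keys y \<subseteq> S n"
      unfolding S_def by (simp add: keys_subset_iff_chain_on)
    have "\<sigma> \<subseteq> V" if "?l x \<sigma> \<noteq> 0" for \<sigma>
      using that keys_Pow[OF x(1)] by (metis PowD in_keys_iff subsetD)
    then have "?l (bdry y) = (\<lambda>\<sigma>. 0)"
      using lookup_bdry[OF V(1) keys_Pow[OF ky]] ly bd_bd[OF V(1), of "?l x"] by simp
    then have "bdry y = 0"
      by (intro poly_mapping_eqI) simp
    with ky show "y \<in> Z" by (simp add: Z_def)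
  qed
  have Bsub: "subgroup B ?G"
  proof (rule G.subgroupI)
    show "B \<subseteq> carrier ?G" using BZ Zsub subgroup.subset by blast
    have "bdry 0 \<in> B" by (auto simp: B_def)
    then show "B \<noteq> {}" by blast
    show "inv\<^bsub>?G\<^esub> a \<in> B" if a: "a \<in> B" for a
    proof -
      have "inv\<^bsub>?G\<^esub> a = - a" using a BZ by (auto simp: Z_def)
      moreover obtain x where "a = bdry x" "Poly_Mapping.keys x \<subseteq> S (Suc n)"
        using a by (auto simp: B_def)
      ultimately show ?thesis
        by (auto simp: B_def bdry_minus intro!: image_eqI[of _ _ "- x"])
    qed
    show "a \<otimes>\<^bsub>?G\<^esub> b \<in> B" if ab: "a \<in> B" "b \<in> B" for a b
    proof -
      obtain x y where "a = bdry x" "Poly_Mapping.keys x \<subseteq> S (Suc n)" "b = bdry y" "Poly_Mapping.keys y \<subseteq> S (Suc n)"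
        using ab by (auto simp: B_def)
      moreover from this have "Poly_Mapping.keys (x + y) \<subseteq> S (Suc n)"
        using Poly_Mapping.keys_add[of x y] by blast
      ultimately show ?thesis
        by (auto simp: B_def bdry_add intro!: image_eqI[of _ _ "x + y"])
    qed
  qed
  have "red_homology (int n - 1) K = subgroup_generated ?G Z Mod B"
    unfolding red_homology_def G1 G2 by (simp add: B_def)
  moreover have "carrier (subgroup_generated ?G Z) = Z"
    by (rule subgroup.carrier_subgroup_generated_subgroup[OF Zsub])
  moreover have "subgroup B (subgroup_generated ?G Z)"
    using BZ Bsub by (rule G.subgroup_of_subgroup_generated)
  moreover have "comm_group (subgroup_generated ?G Z)"
    by (intro G.abelian_subgroup_generated abelian_free_Abelian_group)
  ultimately have "trivial_group (red_homology (int n - 1) K) \<longleftrightarrow> Z \<subseteq> B"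
    using trivial_group_Mod_iff by metis
  also have "\<dots> \<longleftrightarrow> acyclic_at V K n"
  proof
    assume ZB: "Z \<subseteq> B"
    show "acyclic_at V K n"
      unfolding acyclic_at_def
    proof (intro allI impI)
      fix c :: "'a set \<Rightarrow> int" assume c: "chain_on K n c" "bd V c = (\<lambda>\<sigma>. 0)"
      define x where "x = Abs_poly_mapping c"
      have "{\<sigma>. c \<sigma> \<noteq> 0} \<subseteq> Pow V"
        using c V by (auto simp: chain_on_def)
      then have "finite {\<sigma>. c \<sigma> \<noteq> 0}"
        using V(1) finite_subset by (metis finite_Pow_iff)
      then have lx: "?l x = c"
        by (simp add: x_def)
      then have "Poly_Mapping.keys x \<subseteq> S n"
        using c unfolding S_def by (simp add: keys_subset_iff_chain_on)
      moreover from this have "?l (bdry x) = (\<lambda>\<sigma>. 0)"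
        using lookup_bdry[OF V(1) keys_Pow] lx c by metis
      ultimately have "x \<in> Z"
        unfolding Z_def by (auto intro: poly_mapping_eqI)
      then obtain y where y: "Poly_Mapping.keys y \<subseteq> S (Suc n)" "x = bdry y"
        using ZB by (auto simp: B_def)
      then have "chain_on K (Suc n) (?l y)" "bd V (?l y) = c"
        using lookup_bdry[OF V(1) keys_Pow[OF y(1)]] lx unfolding S_def
        by (simp_all add: keys_subset_iff_chain_on)
      then show "\<exists>b. chain_on K (Suc n) b \<and> bd V b = c" by blast
    qed
  next
    assume ac: "acyclic_at V K n"
    show "Z \<subseteq> B"
    proof
      fix x assume "x \<in> Z"
      then have x: "Poly_Mapping.keys x \<subseteq> S n" "bdry x = 0"
        by (auto simp: Z_def)
      then have "chain_on K n (?l x)" "bd V (?l x) = (\<lambda>\<sigma>. 0)"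
        using lookup_bdry[OF V(1) keys_Pow[OF x(1)]] unfolding S_def
        by (auto simp: keys_subset_iff_chain_on fun_eq_iff)
      then obtain b where b: "chain_on K (Suc n) b" "bd V b = ?l x"
        using ac by (auto simp: acyclic_at_def)
      define y where "y = Abs_poly_mapping b"
      have "{\<sigma>. b \<sigma> \<noteq> 0} \<subseteq> Pow V"
        using b V by (auto simp: chain_on_def)
      then have "finite {\<sigma>. b \<sigma> \<noteq> 0}"
        using V(1) finite_subset by (metis finite_Pow_iff)
      then have ly: "?l y = b"
        by (simp add: y_def)
      then have ky: "Poly_Mapping.keys y \<subseteq> S (Suc n)"
        using b unfolding S_def by (simp add: keys_subset_iff_chain_on)
      then have "?l (bdry y) = ?l x"
        using lookup_bdry[OF V(1) keys_Pow[OF ky]] ly b by simp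
      then have "x = bdry y"
        by (intro poly_mapping_eqI) simp
      with ky show "x \<in> B" by (auto simp: B_def)
    qed
  qed
  finally show ?thesis .
qed

lemma fin_complex_downD: "\<lbrakk>fin_complex K; \<sigma> \<in> K; \<tau> \<subseteq> \<sigma>\<rbrakk> \<Longrightarrow> \<tau> \<in> K"
  by (auto simp: fin_complex_def)

lemma induced_complex_down:
  "fin_complex K \<Longrightarrow> \<forall>\<sigma>\<in>induced_complex K W. Pow \<sigma> \<subseteq> induced_complex K W"
  by (auto simp: induced_complex_def dest: fin_complex_downD)

text \<open>The admissible bounds are upward closed, and they exist because no face has more than
  \<open>card V\<close> elements; hence the \<open>LEAST\<close> is attained. \<open>W\<close> may
  be any set, as only its vertices in \<open>K\<close> matter.\<close>

lemma leray_number_le_iff: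
  assumes V: "finite V" "K \<subseteq> Pow V" and K: "fin_complex K"
  shows "leray_number K \<le> j \<longleftrightarrow> (\<forall>W. \<forall>n>j. acyclic_at V (induced_complex K W) n)"
proof -
  define P where "P j \<longleftrightarrow> (\<forall>W \<subseteq> vertex_set K. \<forall>i \<ge> int j. trivial_group (red_homology i (induced_complex K W)))" for j
  have sub: "induced_complex K W \<subseteq> Pow V" for W
    using V by (auto simp: induced_complex_def)
  have P_iff: "P j \<longleftrightarrow> (\<forall>W. \<forall>n>j. acyclic_at V (induced_complex K W) n)" for j
  proof
    assume P: "P j"
    show "\<forall>W. \<forall>n>j. acyclic_at V (induced_complex K W) n"
    proof (intro allI impI)
      fix W n assume "j < n"
      have "induced_complex K W = induced_complex K (W \<inter> vertex_set K)"
        by (auto simp: induced_complex_def vertex_set_def)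
      moreover have "trivial_group (red_homology (int n - 1) (induced_complex K (W \<inter> vertex_set K)))"
        using P \<open>j < n\<close> by (simp add: P_def)
      ultimately show "acyclic_at V (induced_complex K W) n"
        using trivial_red_homology_iff[OF V(1) sub induced_complex_down[OF K]] by metis
    qed
  next
    assume A: "\<forall>W. \<forall>n>j. acyclic_at V (induced_complex K W) n"
    show "P j"
      unfolding P_def
    proof (intro allI impI)
      fix W and i :: int assume "int j \<le> i"
      then have "i = int (Suc (nat i)) - 1" "j < Suc (nat i)" by auto
      then show "trivial_group (red_homology i (induced_complex K W))"
        using A trivial_red_homology_iff[OF V(1) sub induced_complex_down[OF K]] by metis
    qed
  qed
  have "P (card V)"
    unfolding P_iff acyclic_at_def
  proof (intro allI impI)
    fix W n and c :: "'a set \<Rightarrow> int"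
    assume "card V < n" "chain_on (induced_complex K W) n c"
    have "c \<sigma> = 0" for \<sigma>
    proof (rule ccontr)
      assume "c \<sigma> \<noteq> 0"
      then have "\<sigma> \<subseteq> V" "card \<sigma> = n"
        using chain_onD[OF \<open>chain_on (induced_complex K W) n c\<close>] sub by auto
      then show False
        using card_mono[OF V(1), of \<sigma>] \<open>card V < n\<close> by simp
    qed
    then have "c = (\<lambda>\<sigma>. 0)" by auto
    then show "\<exists>b. chain_on (induced_complex K W) (Suc n) b \<and> bd V b = c"
      by (intro exI[of _ "\<lambda>\<sigma>. 0"]) (simp add: chain_on_def)
  qed
  then have "P (leray_number K)"
    unfolding leray_number_def P_def by (rule LeastI)
  moreover have "leray_number K \<le> j" if "P j"
    using that unfolding leray_number_def P_def by (rule Least_le)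
  moreover have "P j" if "P i" "i \<le> j" for i
    using that unfolding P_iff by auto
  ultimately show ?thesis
    using P_iff by blast
qed

section \<open>Links of faces and their Leray numbers\<close>

lemma mem_complex_link_iff:
  "fin_complex K \<Longrightarrow> \<sigma> \<in> complex_link K \<tau> \<longleftrightarrow> \<sigma> \<inter> \<tau> = {} \<and> \<sigma> \<union> \<tau> \<in> K"
  unfolding complex_link_def using fin_complex_downD[of K "\<sigma> \<union> \<tau>" \<sigma>] by auto

lemma fin_complex_link:
  assumes K: "fin_complex K" and "\<tau> \<in> K"
  shows "fin_complex (complex_link K \<tau>)"
proof -
  have "\<rho> \<in> complex_link K \<tau>" if "\<sigma> \<in> complex_link K \<tau>" "\<rho> \<subseteq> \<sigma>" for \<sigma> \<rho>
    using that fin_complex_downD[OF K, of "\<sigma> \<union> \<tau>" "\<rho> \<union> \<tau>"]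
    unfolding mem_complex_link_iff[OF K] by blast
  moreover have "{} \<in> complex_link K \<tau>"
    using assms by (simp add: mem_complex_link_iff)
  moreover have "complex_link K \<tau> \<subseteq> K"
    by (auto simp: complex_link_def)
  ultimately show ?thesis
    using K finite_subset[of "complex_link K \<tau>" K] unfolding fin_complex_def by blast
qed

lemma link_link:
  assumes K: "fin_complex K" and "\<tau> \<inter> \<tau>' = {}"
  shows "complex_link (complex_link K \<tau>) \<tau>' = complex_link K (\<tau> \<union> \<tau>')"
proof (rule Set.set_eqI)
  fix \<sigma>
  have "\<sigma> \<in> complex_link (complex_link K \<tau>) \<tau>' \<longleftrightarrow>
    \<sigma> \<in> complex_link K \<tau> \<and> \<sigma> \<inter> \<tau>' = {} \<and> \<sigma> \<union> \<tau>' \<in> complex_link K \<tau>"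
    by (simp add: complex_link_def[of "complex_link K \<tau>"])
  also have "\<dots> \<longleftrightarrow> \<sigma> \<in> complex_link K (\<tau> \<union> \<tau>')"
    using assms(2) fin_complex_downD[OF K, of "\<sigma> \<union> \<tau>' \<union> \<tau>" "\<sigma> \<union> \<tau>"]
    unfolding mem_complex_link_iff[OF K] by (auto simp: Un_ac Int_Un_distrib Int_Un_distrib2)
  finally show "\<sigma> \<in> complex_link (complex_link K \<tau>) \<tau>' \<longleftrightarrow> \<sigma> \<in> complex_link K (\<tau> \<union> \<tau>')" .
qed

text \<open>A cycle \<open>z\<close> of the link of \<open>v\<close> that bounds \<open>c\<close> in the complex yields the cycle
  \<open>v * z - c\<close>; if this bounds \<open>b\<close>, then the link of \<open>v\<close> in \<open>b\<close> bounds \<open>z\<close>.\<close>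

lemma leray_number_link_vertex:
  assumes V: "finite V" "K \<subseteq> Pow V" and K: "fin_complex K" and v: "{v} \<in> K"
  shows "leray_number (complex_link K {v}) \<le> leray_number K"
proof -
  let ?L = "complex_link K {v}"
  have LV: "?L \<subseteq> Pow V" using V by (auto simp: complex_link_def)
  have L: "fin_complex ?L" by (rule fin_complex_link[OF K v])
  have vV: "v \<in> V" using V v by auto
  have "acyclic_at V (induced_complex ?L W) n" if n: "leray_number K < n" for W n
    unfolding acyclic_at_def
  proof (intro allI impI)
    fix z :: "'a set \<Rightarrow> int"
    assume z: "chain_on (induced_complex ?L W) n z" "bd V z = (\<lambda>\<sigma>. 0)"
    \<comment> \<open>Filling \<open>z\<close> away from \<open>v\<close> ensures that
      \<open>c\<close> contributes nothing to the part of \<open>y\<close> at \<open>v\<close>,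
      which is therefore \<open>z\<close> itself.\<close>
    define U where "U = W - {v}"
    have zL: "\<sigma> \<in> K \<and> v \<notin> \<sigma> \<and> insert v \<sigma> \<in> K \<and> \<sigma> \<subseteq> U \<and> card \<sigma> = n" if "z \<sigma> \<noteq> 0" for \<sigma>
      using chain_onD[OF z(1) that] by (auto simp: induced_complex_def complex_link_def U_def)
    have acyc: "acyclic_at V (induced_complex K W) m" if "leray_number K < m" for W m
      using leray_number_le_iff[OF V K, of "leray_number K"] that by simp
    have "chain_on (induced_complex K U) n z"
      using zL by (auto simp: chain_on_def induced_complex_def)
    then obtain c where c: "chain_on (induced_complex K U) (Suc n) c" "bd V c = z"
      using acyc[OF n, of U] z(2) unfolding acyclic_at_def by blast
    define y where "y = (\<lambda>\<sigma>. cone v z \<sigma> - c \<sigma>)"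
    have zV: "\<sigma> \<subseteq> V" if "z \<sigma> \<noteq> 0" for \<sigma> using zL[OF that] V by auto
    have "bd V (cone v z) = z"
      using bd_cone[of V v z] V(1) vV zV z(2) by simp
    then have "bd V y = (\<lambda>\<sigma>. 0)"
      unfolding y_def bd_diff by (simp add: c(2))
    moreover have "chain_on (induced_complex K (insert v U)) (Suc n) y"
      unfolding y_def
    proof (rule chain_on_diff)
      show "chain_on (induced_complex K (insert v U)) (Suc n) c"
        by (rule chain_on_mono[OF c(1)]) (auto simp: induced_complex_def)
      show "chain_on (induced_complex K (insert v U)) (Suc n) (cone v z)"
        unfolding chain_on_def
      proof (intro allI impI)
        fix \<sigma> assume "cone v z \<sigma> \<noteq> 0"
        then have *: "v \<in> \<sigma>" "z (\<sigma> - {v}) \<noteq> 0" by (auto simp: cone_def split: if_splits)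
        from zL[OF *(2)] *(1) have "\<sigma> \<in> K" "\<sigma> \<subseteq> insert v U" "card (\<sigma> - {v}) = n"
          by (auto simp: insert_absorb)
        moreover have "finite \<sigma>" using \<open>\<sigma> \<in> K\<close> K by (auto simp: fin_complex_def)
        ultimately show "\<sigma> \<in> induced_complex K (insert v U) \<and> card \<sigma> = Suc n"
          using *(1) card_Suc_Diff1[of \<sigma> v] by (simp add: induced_complex_def)
      qed
    qed
    ultimately obtain b where b: "chain_on (induced_complex K (insert v U)) (Suc (Suc n)) b" "bd V b = y"
      using acyc[of "Suc n" "insert v U"] n unfolding acyclic_at_def by (metis less_SucI)
    have bV: "\<sigma> \<subseteq> V" if "b \<sigma> \<noteq> 0" for \<sigma>
      using chain_onD[OF b(1) that] V by (auto simp: induced_complex_def)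
    have "star_part v y = z"
    proof
      fix \<sigma>
      have "c (insert v \<sigma>) = 0"
        using chain_onD[OF c(1), of "insert v \<sigma>"] by (auto simp: induced_complex_def U_def)
      then have "star_part v y \<sigma> = star_part v (cone v z) \<sigma>"
        by (auto simp: star_part_def y_def)
      also have "\<dots> = z \<sigma>" using zL[of \<sigma>] by (auto simp: star_part_cone)
      finally show "star_part v y \<sigma> = z \<sigma>" .
    qed
    then have "bd V (\<lambda>\<sigma>. - star_part v b \<sigma>) = z"
      using bd_star_part[of V v b] V(1) vV bV b(2) by (simp add: bd_minus)
    moreover have "chain_on (induced_complex ?L W) (Suc n) (\<lambda>\<sigma>. - star_part v b \<sigma>)"
      unfolding chain_on_def
    proof (intro allI impI)
      fix \<sigma> assume "- star_part v b \<sigma> \<noteq> 0"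
      then have *: "v \<notin> \<sigma>" "b (insert v \<sigma>) \<noteq> 0" by (auto simp: star_part_def split: if_splits)
      from chain_onD[OF b(1) *(2)] have **: "insert v \<sigma> \<in> K" "insert v \<sigma> \<subseteq> insert v U" "card (insert v \<sigma>) = Suc (Suc n)"
        by (auto simp: induced_complex_def)
      moreover have "finite \<sigma>" using **(1) K by (auto simp: fin_complex_def)
      ultimately show "\<sigma> \<in> induced_complex ?L W \<and> card \<sigma> = Suc n"
        using *(1) fin_complex_downD[OF K **(1), of \<sigma>]
        by (auto simp: induced_complex_def complex_link_def U_def)
    qed
    ultimately show "\<exists>b. chain_on (induced_complex ?L W) (Suc n) b \<and> bd V b = z" by blast
  qed
  then show ?thesis
    using leray_number_le_iff[OF V(1) LV L] by blast
qed

text \<open>The link of a larger face is reached by taking links of single vertices successively, so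
  the vertex case applies one element at a time.\<close>

lemma leray_number_link_antimono:
  assumes V: "finite V" "K \<subseteq> Pow V" and K: "fin_complex K" and "\<tau> \<in> K" "\<sigma> \<subseteq> \<tau>"
  shows "leray_number (complex_link K \<tau>) \<le> leray_number (complex_link K \<sigma>)"
proof -
  have "finite \<tau>" using assms(4) K by (auto simp: fin_complex_def)
  then have fin: "finite (\<tau> - \<sigma>)" by simp
  have "leray_number (complex_link K (\<sigma> \<union> \<rho>)) \<le> leray_number (complex_link K \<sigma>)"
    if "\<rho> \<subseteq> \<tau> - \<sigma>" "finite \<rho>" for \<rho>
    using that(2,1)
  proof (induction \<rho> rule: finite_induct)
    case (insert v \<rho>)
    let ?L = "complex_link K (\<sigma> \<union> \<rho>)"
    have K': "\<sigma> \<union> \<rho> \<in> K" "insert v (\<sigma> \<union> \<rho>) \<in> K" "{v} \<in> K"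
      by (rule fin_complex_downD[OF K assms(4)], use insert assms(5) in auto)+
    have "leray_number (complex_link ?L {v}) \<le> leray_number ?L"
    proof (rule leray_number_link_vertex[OF V(1)])
      show "?L \<subseteq> Pow V" using V by (auto simp: complex_link_def)
      show "fin_complex ?L" by (rule fin_complex_link[OF K K'(1)])
      show "{v} \<in> ?L" using K' insert by (auto simp: complex_link_def)
    qed
    moreover have "complex_link ?L {v} = complex_link K (\<sigma> \<union> insert v \<rho>)"
      using link_link[OF K, of "\<sigma> \<union> \<rho>" "{v}"] insert by auto
    ultimately show ?case using insert by simp
  qed simp
  from this[OF order_refl fin] show ?thesis
    using assms(5) by (simp add: Un_absorb1)
qed

lemma link_empty: "fin_complex K \<Longrightarrow> complex_link K {} = K"
  by (simp add: complex_link_def)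

section \<open>Matroids\<close>

text \<open>Exchange makes every basis of the restriction as large as \<open>A\<close>, so
  \<open>the_elem\<close> is applied to a genuine singleton. Ranks are computed below by exhibiting
  such an \<open>A\<close>.\<close>

lemma rank_of_eq:
  assumes M: "fin_matroid M" and A: "A \<in> M" "A \<subseteq> W" and max: "\<And>x. \<lbrakk>x \<in> W - A; insert x A \<in> M\<rbrakk> \<Longrightarrow> False"
  shows "rank_of M W = card A"
proof -
  have exch: "\<And>A B. \<lbrakk>A \<in> M; B \<in> M; card A < card B\<rbrakk> \<Longrightarrow> \<exists>x\<in>B - A. insert x A \<in> M"
    and C: "fin_complex M"
    using M by (auto simp: fin_matroid_def)
  have fin: "\<And>B. B \<in> M \<Longrightarrow> finite B"
    using C by (auto simp: fin_complex_def)
  let ?I = "induced_complex M W"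
  have A_max: "A \<in> matroid_bases ?I"
    unfolding matroid_bases_def
  proof (intro CollectI conjI ballI impI)
    show "A \<in> ?I" using A by (simp add: induced_complex_def)
    fix B assume B: "B \<in> ?I" "A \<subseteq> B"
    show "B = A"
    proof (rule ccontr)
      assume "B \<noteq> A"
      then obtain x where x: "x \<in> B - A" using B by blast
      then have "insert x A \<in> M"
        using B fin_complex_downD[OF C, of B "insert x A"] by (auto simp: induced_complex_def)
      then show False using x B max by (auto simp: induced_complex_def)
    qed
  qed
  have "card B = card A" if "B \<in> matroid_bases ?I" for B
  proof -
    have B: "B \<in> M" "B \<subseteq> W"
      using that by (auto simp: matroid_bases_def induced_complex_def)
    have "\<not> card A < card B"
      using exch[OF A(1) B(1)] max B(2) by blast
    moreover have "\<not> card B < card A"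
    proof
      assume "card B < card A"
      then obtain x where x: "x \<in> A - B" "insert x B \<in> M"
        using exch[OF B(1) A(1)] by blast
      then have "insert x B \<in> ?I"
        using A B by (auto simp: induced_complex_def)
      then show False
        using that x(1) unfolding matroid_bases_def by blast
    qed
    ultimately show ?thesis by simp
  qed
  then have "card ` matroid_bases ?I = {card A}"
    using A_max by blast
  then show ?thesis
    by (simp add: rank_of_def matroid_rank_def)
qed

lemma matroid_extend:
  assumes M: "fin_matroid M" and A: "A \<in> M" "A \<subseteq> W" and B: "B \<in> M" "B \<subseteq> W" "card A \<le> card B"
  obtains C where "C \<in> M" "A \<subseteq> C" "C \<subseteq> A \<union> B" "card C = card B"
proof -
  have "\<exists>C. C \<in> M \<and> A \<subseteq> C \<and> C \<subseteq> A \<union> B \<and> card C = card B"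
    using A(1) B(3)
  proof (induction "card B - card A" arbitrary: A)
    case 0
    then show ?case by (intro exI[of _ A]) auto
  next
    case (Suc n)
    then have "card A < card B" by simp
    then obtain x where x: "x \<in> B - A" "insert x A \<in> M"
      using M Suc.prems(1) B(1) unfolding fin_matroid_def by blast
    have "finite A"
      using M Suc.prems(1) by (auto simp: fin_matroid_def fin_complex_def)
    then have "card (insert x A) = Suc (card A)"
      using x by simp
    then have "n = card B - card (insert x A)" "card (insert x A) \<le> card B"
      using Suc.hyps(2) by linarith+
    then obtain C where "C \<in> M" "insert x A \<subseteq> C" "C \<subseteq> insert x A \<union> B" "card C = card B"
      using Suc.hyps(1)[of "insert x A"] x(2) by blast
    then show ?case
      using x(1) by (intro exI[of _ C]) auto
  qed
  then show thesis using that by blast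
qed

locale matroid =
  fixes M :: "'a set set"
  assumes M: "fin_matroid M"
begin

abbreviation "\<rho> \<equiv> rank_of M"

lemma complex: "fin_complex M"
  using M by (simp add: fin_matroid_def)

lemma down: "\<lbrakk>A \<in> M; B \<subseteq> A\<rbrakk> \<Longrightarrow> B \<in> M"
  by (rule fin_complex_downD[OF complex])

lemma fin: "A \<in> M \<Longrightarrow> finite A"
  using complex by (auto simp: fin_complex_def)

lemma empty_indep: "{} \<in> M"
proof -
  obtain A where "A \<in> M" using complex by (auto simp: fin_complex_def)
  then show ?thesis using down by blast
qed

lemma extend_to_rank:
  assumes "A \<in> M" "A \<subseteq> W"
  obtains C where "C \<in> M" "A \<subseteq> C" "C \<subseteq> W" "card C = \<rho> W"
proof -
  define F where "F = {C \<in> M. A \<subseteq> C \<and> C \<subseteq> W}"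
  have "finite F" "F \<noteq> {}"
    using complex assms by (auto simp: F_def fin_complex_def)
  then obtain C where C: "C \<in> F" "\<And>D. D \<in> F \<Longrightarrow> C \<subseteq> D \<Longrightarrow> C = D"
    using finite_has_maximal by (metis (no_types, lifting))
  have "\<rho> W = card C"
  proof (rule rank_of_eq[OF M])
    show False if "x \<in> W - C" "insert x C \<in> M" for x
      using C(2)[of "insert x C"] C(1) that by (auto simp: F_def)
  qed (use C in \<open>auto simp: F_def\<close>)
  with C(1) show thesis by (intro that[of C]) (auto simp: F_def)
qed

lemma card_le_rank: "\<lbrakk>A \<in> M; A \<subseteq> W\<rbrakk> \<Longrightarrow> card A \<le> \<rho> W"
  by (metis card_mono extend_to_rank fin)

lemma rank_indep: "A \<in> M \<Longrightarrow> \<rho> A = card A"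
  by (rule rank_of_eq[OF M]) auto

lemma indep_of_rank:
  obtains A where "A \<in> M" "A \<subseteq> W" "card A = \<rho> W"
  by (rule extend_to_rank[OF empty_indep, of W]) auto

lemma rank_mono: "A \<subseteq> W \<Longrightarrow> \<rho> A \<le> \<rho> W"
  by (metis card_le_rank indep_of_rank order_trans)

lemma rank_insert_le: "\<rho> (insert x W) \<le> Suc (\<rho> W)"
proof -
  obtain A where A: "A \<in> M" "A \<subseteq> insert x W" "card A = \<rho> (insert x W)"
    by (rule indep_of_rank)
  then have "card (A - {x}) \<le> \<rho> W"
    using down[OF A(1), of "A - {x}"] by (intro card_le_rank) auto
  moreover have "card A \<le> Suc (card (A - {x}))"
    by (cases "x \<in> A") (simp_all add: card_Diff_singleton)
  ultimately show ?thesis using A by simp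
qed

text \<open>A basis of \<open>F\<close> stays maximal in \<open>F \<union> G\<close>: an element of
  \<open>G\<close> extending it would raise the rank of \<open>F\<close> on its own.\<close>

lemma rank_Un_eqI:
  assumes "\<And>x. x \<in> G \<Longrightarrow> \<rho> (insert x F) = \<rho> F"
  shows "\<rho> (F \<union> G) = \<rho> F"
proof -
  obtain A where A: "A \<in> M" "A \<subseteq> F" "card A = \<rho> F"
    by (rule indep_of_rank)
  have "\<rho> (F \<union> G) = card A"
  proof (rule rank_of_eq[OF M A(1)])
    fix x assume x: "x \<in> F \<union> G - A" "insert x A \<in> M"
    then have "card (insert x A) \<le> \<rho> (insert x F)"
      using A by (intro card_le_rank) auto
    moreover have "\<rho> (insert x F) = \<rho> F"
      using x assms by (cases "x \<in> F") (auto simp: insert_absorb)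
    ultimately show False
      using x(1) A fin[OF A(1)] by simp
  qed (use A in auto)
  with A show ?thesis by simp
qed

text \<open>Closure is monotone. A basis of \<open>F\<close> extends to one of \<open>G\<close>, and
  if \<open>x\<close> could be added to the larger set, it could be added to the smaller
  one.\<close>

lemma rank_insert_eq_mono:
  assumes "\<rho> (insert x F) = \<rho> F" "F \<subseteq> G"
  shows "\<rho> (insert x G) = \<rho> G"
proof -
  obtain A where A: "A \<in> M" "A \<subseteq> F" "card A = \<rho> F"
    by (rule indep_of_rank)
  have "A \<subseteq> G" using A assms by blast
  then obtain B where B: "B \<in> M" "A \<subseteq> B" "B \<subseteq> G" "card B = \<rho> G"
    by (rule extend_to_rank[OF A(1)])
  have "\<rho> (insert x G) = card B"
  proof (rule rank_of_eq[OF M B(1)])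
    fix y assume y: "y \<in> insert x G - B" "insert y B \<in> M"
    show False
    proof (cases "y \<in> G")
      case True
      then have "card (insert y B) \<le> \<rho> G"
        using y B by (intro card_le_rank) auto
      then show False using y B fin[OF B(1)] by simp
    next
      case False
      then have "y = x" using y by simp
      moreover have "insert y A \<in> M" using B y by (intro down[OF y(2)]) auto
      moreover have "card (insert y A) \<le> \<rho> (insert x F)"
        using A calculation by (intro card_le_rank) auto
      moreover have "y \<notin> A" using y B by auto
      ultimately show False using A fin[OF A(1)] assms by simp
    qed
  qed (use B in auto)
  with B show ?thesis by simp
qed

end

text \<open>This is the contraction of \<open>v\<close>; exchange is inherited by adding
  \<open>v\<close> to both sets.\<close>

lemma fin_matroid_link:
  assumes M: "fin_matroid M" and "{v} \<in> M"
  shows "fin_matroid (complex_link M {v})"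
  unfolding fin_matroid_def
proof (intro conjI ballI impI)
  interpret matroid M by standard fact
  show "fin_complex (complex_link M {v})"
    by (rule fin_complex_link[OF complex assms(2)])
  fix A B assume AB: "A \<in> complex_link M {v}" "B \<in> complex_link M {v}" "card A < card B"
  then have *: "insert v A \<in> M" "insert v B \<in> M" "v \<notin> A" "v \<notin> B"
    by (auto simp: complex_link_def)
  then have "card (insert v A) < card (insert v B)"
    using AB(3) fin[OF *(1)] fin[OF *(2)] by simp
  then obtain x where "x \<in> insert v B - insert v A" "insert x (insert v A) \<in> M"
    using M *(1,2) unfolding fin_matroid_def by blast
  then show "\<exists>x\<in>B - A. insert x A \<in> complex_link M {v}"
    using * by (intro bexI[of _ x]) (auto simp: mem_complex_link_iff[OF complex] insert_commute)
qed

lemma fin_matroid_induced: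
  assumes M: "fin_matroid M"
  shows "fin_matroid (induced_complex M W)"
proof -
  interpret matroid M by standard fact
  have "finite (induced_complex M W)" "induced_complex M W \<noteq> {}"
    using complex empty_indep by (auto simp: induced_complex_def fin_complex_def)
  then have "fin_complex (induced_complex M W)"
    unfolding fin_complex_def by (auto simp: induced_complex_def fin intro: down)
  moreover have "\<exists>x\<in>B - A. insert x A \<in> induced_complex M W"
    if AB: "A \<in> induced_complex M W" "B \<in> induced_complex M W" "card A < card B" for A B
  proof -
    have "A \<in> M" "B \<in> M" "A \<subseteq> W" "B \<subseteq> W"
      using AB by (auto simp: induced_complex_def)
    moreover obtain x where "x \<in> B - A" "insert x A \<in> M"
      using M AB(3) calculation(1,2) unfolding fin_matroid_def by blast
    ultimately show ?thesis by (auto simp: induced_complex_def)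
  qed
  ultimately show ?thesis by (simp add: fin_matroid_def)
qed

text \<open>Induction on the ground set. The part of a cycle \<open>z\<close> at a vertex \<open>v\<close> bounds in the contraction,
  which moves \<open>z\<close> into the deletion of \<open>v\<close>. If the deletion has too small a rank, then every
  face of the deletion with \<open>n\<close> elements can be coned off with apex \<open>v\<close>.\<close>

lemma matroid_acyclic:
  fixes z :: "'a set \<Rightarrow> 'r::linordered_idom"
  assumes "finite V" "finite W" "W \<subseteq> V" "fin_matroid M" "M \<subseteq> Pow W" "B \<in> M" "n < card B"
    and "chain_on M n z" "bd V z = (\<lambda>\<sigma>. 0)"
  shows "\<exists>b. chain_on M (Suc n) b \<and> bd V b = z"
  using assms(2-9)
proof (induction W arbitrary: M B n z rule: finite_induct)
  case empty
  then show ?case by auto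
next
  case (insert v W)
  interpret matroid M by standard fact
  note exch = \<open>fin_matroid M\<close>[unfolded fin_matroid_def, THEN conjunct2, rule_format]
  have vV: "v \<in> V" and WV: "W \<subseteq> V" using insert.prems(1) by auto
  have MV: "\<sigma> \<subseteq> V" if "\<sigma> \<in> M" for \<sigma> using that insert.prems by blast
  have zM: "\<sigma> \<in> M" "card \<sigma> = n" if "z \<sigma> \<noteq> 0" for \<sigma>
    using chain_onD[OF insert.prems(6) that] by auto
  have cone_chain: "chain_on M (Suc k) (cone v c)"
    if "\<And>\<sigma>. c \<sigma> \<noteq> 0 \<Longrightarrow> v \<notin> \<sigma> \<and> card \<sigma> = k \<and> insert v \<sigma> \<in> M" for k and c :: "'a set \<Rightarrow> 'r"
    unfolding chain_on_def
  proof (intro allI impI)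
    fix \<sigma> assume "cone v c \<sigma> \<noteq> 0"
    then have *: "v \<in> \<sigma>" "c (\<sigma> - {v}) \<noteq> 0" by (auto simp: cone_def split: if_splits)
    from that[OF *(2)] *(1) have "\<sigma> \<in> M" "card (\<sigma> - {v}) = k" by (auto simp: insert_absorb)
    with *(1) show "\<sigma> \<in> M \<and> card \<sigma> = Suc k" using fin card_Suc_Diff1 by metis
  qed
  show ?case
  proof (cases "{v} \<in> M")
    case False
    have "M \<subseteq> Pow W"
    proof
      fix \<sigma> assume "\<sigma> \<in> M"
      moreover from this have "v \<notin> \<sigma>" using down[of \<sigma> "{v}"] False by auto
      ultimately show "\<sigma> \<in> Pow W" using insert.prems(3) by blast
    qed
    then show ?thesis
      using insert.IH[OF WV \<open>fin_matroid M\<close> _ insert.prems(4-7)] by blast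
  next
    case v: True
    \<comment> \<open>The part of \<open>z\<close> at \<open>v\<close> is a cycle of the
      contraction, one dimension lower. For \<open>n = 0\<close> it is zero, as the empty face has
      no vertex; otherwise an independent set through \<open>v\<close> of size \<open>card B\<close>
      gives the contraction a face large enough for the induction hypothesis.\<close>
    have "\<exists>a. chain_on (complex_link M {v}) n a \<and> bd V a = star_part v z"
    proof (cases n)
      case 0
      have "star_part v z = (\<lambda>\<sigma>. 0)"
      proof
        fix \<sigma> show "star_part v z \<sigma> = 0"
          using zM[of "insert v \<sigma>"] fin[of "insert v \<sigma>"] 0 by (auto simp: star_part_def)
      qed
      then show ?thesis by (intro exI[of _ "\<lambda>\<sigma>. 0"]) (simp add: chain_on_def)
    next
      case (Suc k)
      have "card {v} \<le> card B" using insert.prems(5) by simp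
      then obtain C where C: "C \<in> M" "{v} \<subseteq> C" "C \<subseteq> {v} \<union> B" "card C = card B"
        by (rule matroid_extend[OF M v subset_UNIV \<open>B \<in> M\<close> subset_UNIV])
      let ?L = "complex_link M {v}"
      have "C - {v} \<in> ?L"
        using C by (auto simp: mem_complex_link_iff[OF complex] insert_absorb)
      moreover have "k < card (C - {v})"
        using C insert.prems(5) Suc fin[OF C(1)] by (simp add: card_Diff_singleton)
      moreover have "?L \<subseteq> Pow W"
        using insert.prems(3) by (auto simp: complex_link_def)
      moreover have "chain_on ?L k (star_part v z)"
        unfolding chain_on_def
      proof (intro allI impI)
        fix \<sigma> assume "star_part v z \<sigma> \<noteq> 0"
        then have *: "v \<notin> \<sigma>" "z (insert v \<sigma>) \<noteq> 0" by (auto simp: star_part_def split: if_splits)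
        show "\<sigma> \<in> ?L \<and> card \<sigma> = k"
          using zM[OF *(2)] * Suc fin[of "insert v \<sigma>"] by (auto simp: mem_complex_link_iff[OF complex])
      qed
      moreover have "bd V (star_part v z) = (\<lambda>\<sigma>. 0)"
      proof -
        have "(\<lambda>\<sigma>. - bd V (star_part v z) \<sigma>) = (\<lambda>\<sigma>. 0)"
          using bd_star_part[of V v z] assms(1) vV zM MV insert.prems(7) by simp
        then show ?thesis by (simp add: fun_eq_iff)
      qed
      ultimately show ?thesis
        using insert.IH[OF WV fin_matroid_link[OF M v]] Suc by blast
    qed
    then obtain a where a: "chain_on (complex_link M {v}) n a" "bd V a = star_part v z"
      by blast
    have aL: "v \<notin> \<sigma> \<and> card \<sigma> = n \<and> insert v \<sigma> \<in> M" if "a \<sigma> \<noteq> 0" for \<sigma>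
      using chain_onD[OF a(1) that] by (auto simp: mem_complex_link_iff[OF complex])
    have ca: "chain_on M (Suc n) (cone v a)"
      using aL by (rule cone_chain)
    \<comment> \<open>The simplices through \<open>v\<close> in \<open>bd V (cone v a)\<close> are
      those of \<open>z\<close> with opposite sign, so \<open>z'\<close> is homologous to
      \<open>z\<close> and avoids \<open>v\<close>.\<close>
    define z' where "z' = (\<lambda>\<sigma>. z \<sigma> + bd V (cone v a) \<sigma>)"
    have "bd V (cone v a) = (\<lambda>\<sigma>. a \<sigma> - (if v \<in> \<sigma> then z \<sigma> else 0))"
      using bd_cone[of V v a] assms(1) vV aL MV unfolding a(2) cone_star_part by blast
    then have z'_eq: "z' \<sigma> = (if v \<in> \<sigma> then 0 else z \<sigma> + a \<sigma>)" for \<sigma>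
      using aL[of \<sigma>] by (auto simp: z'_def)
    have cyc: "bd V z' = (\<lambda>\<sigma>. 0)"
      unfolding z'_def bd_add using bd_bd[of V "cone v a"] chain_onD[OF ca] MV assms(1) insert.prems(7) by auto
    let ?D = "induced_complex M W"
    have z'D: "chain_on ?D n z'"
      unfolding chain_on_def
    proof (intro allI impI)
      fix \<sigma> assume "z' \<sigma> \<noteq> 0"
      then have "v \<notin> \<sigma>" "z \<sigma> \<noteq> 0 \<or> a \<sigma> \<noteq> 0" by (auto simp: z'_eq split: if_splits)
      then have "\<sigma> \<in> M" "card \<sigma> = n" using zM aL down[of "insert v \<sigma>" \<sigma>] by auto
      then show "\<sigma> \<in> ?D \<and> card \<sigma> = n"
        using insert.prems(3) \<open>v \<notin> \<sigma>\<close> by (auto simp: induced_complex_def)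
    qed
    have "\<exists>b. chain_on M (Suc n) b \<and> bd V b = z'"
    proof (cases "\<exists>C\<in>M. v \<notin> C \<and> n < card C")
      case True
      then obtain C where C: "C \<in> M" "v \<notin> C" "n < card C" by blast
      then have "C \<in> ?D" using insert.prems(3) by (auto simp: induced_complex_def)
      moreover have "?D \<subseteq> Pow W" by (auto simp: induced_complex_def)
      ultimately obtain b where "chain_on ?D (Suc n) b" "bd V b = z'"
        using insert.IH[OF WV fin_matroid_induced[OF M] _ _ C(3) z'D cyc] by blast
      then show ?thesis
        using chain_on_mono[of ?D "Suc n" b M] by (auto simp: induced_complex_def)
    next
      case False
      have "v \<notin> \<sigma> \<and> card \<sigma> = n \<and> insert v \<sigma> \<in> M" if "z' \<sigma> \<noteq> 0" for \<sigma>
      proof -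
        have \<sigma>: "\<sigma> \<in> M" "card \<sigma> = n" "v \<notin> \<sigma>"
          using chain_onD[OF z'D that] insert.hyps by (auto simp: induced_complex_def)
        then obtain x where x: "x \<in> B - \<sigma>" "insert x \<sigma> \<in> M"
          using exch[of \<sigma> B] insert.prems(4,5) by auto
        have "n < card (insert x \<sigma>)"
          using x(1) \<sigma> fin by simp
        \<comment> \<open>No independent set with more than \<open>n\<close> elements avoids
          \<open>v\<close>, so the element supplied by exchange can only be
          \<open>v\<close>.\<close>
        then have "v \<in> insert x \<sigma>" using False x(2) by blast
        then have "x = v" using \<sigma>(3) by blast
        then show ?thesis using x(2) \<sigma>(2,3) by blast
      qed
      then have "chain_on M (Suc n) (cone v z')" by (rule cone_chain)
      moreover have "\<sigma> \<subseteq> V" if "z' \<sigma> \<noteq> 0" for \<sigma>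
        using chain_onD[OF z'D that] WV by (auto simp: induced_complex_def)
      then have "bd V (cone v z') = z'"
        using bd_cone[of V v z'] assms(1) vV cyc by simp
      ultimately show ?thesis by blast
    qed
    then obtain b where b: "chain_on M (Suc n) b" "bd V b = z'" by blast
    have "bd V (\<lambda>\<sigma>. b \<sigma> - cone v a \<sigma>) = z"
      unfolding bd_diff b(2) by (simp add: z'_def)
    then show ?thesis
      using chain_on_diff[OF b(1) ca] by blast
  qed
qed

section \<open>Coboundaries and linear algebra\<close>

lemma sum_Pow_swap:
  assumes "finite L"
  shows "(\<Sum>\<rho>\<in>Pow L. \<Sum>x\<in>L - \<rho>. G \<rho> x) = (\<Sum>\<sigma>\<in>Pow L. \<Sum>u\<in>\<sigma>. G (\<sigma> - {u}) u)"
proof -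
  have fin: "finite (\<sigma> :: 'a set)" if "\<sigma> \<in> Pow L" for \<sigma>
    using that assms finite_subset by auto
  have "(\<Sum>\<rho>\<in>Pow L. \<Sum>x\<in>L - \<rho>. G \<rho> x) = (\<Sum>(\<rho>, x)\<in>Sigma (Pow L) (\<lambda>\<rho>. L - \<rho>). G \<rho> x)"
    using assms by (subst sum.Sigma) auto
  also have "\<dots> = (\<Sum>(\<sigma>, u)\<in>Sigma (Pow L) (\<lambda>\<sigma>. \<sigma>). G (\<sigma> - {u}) u)"
    by (rule sum.reindex_bij_witness[where i = "\<lambda>(\<sigma>, u). (\<sigma> - {u}, u)" and j = "\<lambda>(\<rho>, x). (insert x \<rho>, x)"]) auto
  also have "\<dots> = (\<Sum>\<sigma>\<in>Pow L. \<Sum>u\<in>\<sigma>. G (\<sigma> - {u}) u)"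
    using assms fin by (subst sum.Sigma) auto
  finally show ?thesis .
qed

text \<open>The function \<open>F\<close> on simplices, extended linearly, is evaluated at the
  boundary of \<open>\<sigma>\<close>: this is the coboundary of \<open>F\<close>.\<close>

definition cobd :: "('a set \<Rightarrow> 'r) \<Rightarrow> 'a set \<Rightarrow> 'r::linordered_idom" where
  "cobd F \<sigma> = (\<Sum>v\<in>\<sigma>. vsign \<sigma> v * F (\<sigma> - {v}))"

lemma cobd_add: "cobd (\<lambda>\<tau>. F \<tau> + G \<tau>) \<sigma> = cobd F \<sigma> + cobd G \<sigma>"
  by (simp add: cobd_def distrib_left sum.distrib)

lemma cobd_diff: "cobd (\<lambda>\<tau>. F \<tau> - G \<tau>) \<sigma> = cobd F \<sigma> - cobd G \<sigma>"
  by (simp add: cobd_def right_diff_distrib sum_subtractf)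

lemma cobd_cong: "(\<And>v. v \<in> \<sigma> \<Longrightarrow> F (\<sigma> - {v}) = G (\<sigma> - {v})) \<Longrightarrow> cobd F \<sigma> = cobd G \<sigma>"
  by (simp add: cobd_def)

lemma cobd_eq_0: "(\<And>v. v \<in> \<sigma> \<Longrightarrow> F (\<sigma> - {v}) = 0) \<Longrightarrow> cobd F \<sigma> = 0"
  by (simp add: cobd_def)

text \<open>For a family of chains indexed by simplices, \<open>bd\<close> acts on the chains and
  \<open>cobd\<close> on the index, so the two commute.\<close>

lemma bd_cobd: "bd V (\<lambda>\<beta>. cobd (\<lambda>\<tau>. F \<tau> \<beta>) \<sigma>) = (\<lambda>\<beta>. cobd (\<lambda>\<tau>. bd V (F \<tau>) \<beta>) \<sigma>)"
  unfolding cobd_def bd_sum bd_mult by simp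

lemma pairing_cobd:
  assumes "finite V"
  shows "(\<Sum>\<sigma>\<in>Pow V. c \<sigma> * cobd F \<sigma>) = (\<Sum>\<beta>\<in>Pow V. bd V c \<beta> * F \<beta>)"
proof -
  have "(\<Sum>\<beta>\<in>Pow V. bd V c \<beta> * F \<beta>) =
      (\<Sum>\<beta>\<in>Pow V. \<Sum>x\<in>V - \<beta>. vsign (insert x \<beta>) x * c (insert x \<beta>) * F \<beta>)"
    by (simp add: bd_def sum_distrib_right)
  also have "\<dots> = (\<Sum>\<sigma>\<in>Pow V. \<Sum>u\<in>\<sigma>. vsign (insert u (\<sigma> - {u})) u * c (insert u (\<sigma> - {u})) * F (\<sigma> - {u}))"
    by (rule sum_Pow_swap[OF assms])
  also have "\<dots> = (\<Sum>\<sigma>\<in>Pow V. c \<sigma> * cobd F \<sigma>)"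
    by (intro sum.cong refl) (auto simp: cobd_def sum_distrib_left insert_absorb mult_ac intro!: sum.cong)
  finally show ?thesis by simp
qed

text \<open>Exchanging the roles of the two removed vertices costs a sign; in particular the sum
  vanishes for symmetric \<open>H\<close>.\<close>

lemma vsign_sum_swap:
  fixes H :: "'a \<Rightarrow> 'a \<Rightarrow> 'r::linordered_idom"
  assumes "finite \<sigma>"
  shows "(\<Sum>v\<in>\<sigma>. vsign \<sigma> v * (\<Sum>u\<in>\<sigma> - {v}. vsign (\<sigma> - {v}) u * H v u)) =
    - (\<Sum>v\<in>\<sigma>. vsign \<sigma> v * (\<Sum>u\<in>\<sigma> - {v}. vsign (\<sigma> - {v}) u * H u v))"
proof -
  have S: "(\<Sum>v\<in>\<sigma>. vsign \<sigma> v * (\<Sum>u\<in>\<sigma> - {v}. vsign (\<sigma> - {v}) u * H' v u)) =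
    (\<Sum>(v, u)\<in>Sigma \<sigma> (\<lambda>v. \<sigma> - {v}). vsign \<sigma> v * vsign (\<sigma> - {v}) u * H' v u)"
    for H' :: "'a \<Rightarrow> 'a \<Rightarrow> 'r"
    using assms by (simp add: sum_distrib_left sum.Sigma mult.assoc)
  have "(\<Sum>(v, u)\<in>Sigma \<sigma> (\<lambda>v. \<sigma> - {v}). vsign \<sigma> v * vsign (\<sigma> - {v}) u * H v u) =
    (\<Sum>(v, u)\<in>Sigma \<sigma> (\<lambda>v. \<sigma> - {v}). - (vsign \<sigma> v * vsign (\<sigma> - {v}) u * H u v))"
  proof (rule sum.reindex_bij_witness[where i = prod.swap and j = prod.swap], goal_cases)
    case (5 a)
    then obtain v u where "a = (v, u)" "v \<in> \<sigma>" "u \<in> \<sigma>" "u \<noteq> v" by (cases a) auto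
    then show ?case
      using vsign_swap[OF assms, of u v, where 'r = 'r] by simp
  qed auto
  then show ?thesis
    unfolding S by (simp add: sum_negf case_prod_unfold)
qed

lemma cobd_cobd: "finite \<sigma> \<Longrightarrow> cobd (cobd F) \<sigma> = 0"
proof -
  assume fin: "finite \<sigma>"
  have "(\<Sum>v\<in>\<sigma>. vsign \<sigma> v * (\<Sum>u\<in>\<sigma> - {v}. vsign (\<sigma> - {v}) u * F (\<sigma> - {v} - {u}))) =
    - (\<Sum>v\<in>\<sigma>. vsign \<sigma> v * (\<Sum>u\<in>\<sigma> - {v}. vsign (\<sigma> - {v}) u * F (\<sigma> - {u} - {v})))"
    by (rule vsign_sum_swap[OF fin])
  moreover have "\<sigma> - {u} - {v} = \<sigma> - {v} - {u}" for u v by auto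
  ultimately show ?thesis
    unfolding cobd_def by simp
qed

section \<open>Linear systems with unknowns in a subspace\<close>

lemma sum_in_subspace:
  fixes W :: "('b \<Rightarrow> 'k::field) set"
  assumes "finite S" "(\<lambda>_. 0) \<in> W" "\<And>f g c. \<lbrakk>f \<in> W; g \<in> W\<rbrakk> \<Longrightarrow> (\<lambda>b. f b + c * g b) \<in> W"
    and "\<And>s. s \<in> S \<Longrightarrow> e s \<in> W"
  shows "(\<lambda>b. \<Sum>s\<in>S. k s * e s b) \<in> W"
  using assms(1,4)
proof (induction S rule: finite_induct)
  case (insert s S)
  then have "(\<lambda>b. (\<Sum>s\<in>S. k s * e s b) + k s * e s b) \<in> W"
    using assms(3) by blast
  then show ?case using insert by (simp add: add.commute)
qed (use assms(2) in simp)

text \<open>The last hypothesis says that each linear relation between the rows of \<open>a\<close>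
  also holds between the right-hand sides \<open>w q\<close>. Gaussian elimination, by induction on
  the columns \<open>P\<close>, then yields a solution whose unknowns stay in
  \<open>W\<close>.\<close>

lemma solve_in_subspace:
  fixes a :: "'q \<Rightarrow> 'p \<Rightarrow> 'k::field" and w :: "'q \<Rightarrow> 'b \<Rightarrow> 'k"
  assumes "finite P" "finite Q"
    and W0: "(\<lambda>_. 0) \<in> W" and W: "\<And>f g c. \<lbrakk>f \<in> W; g \<in> W\<rbrakk> \<Longrightarrow> (\<lambda>b. f b + c * g b) \<in> W"
    and "\<And>q. q \<in> Q \<Longrightarrow> w q \<in> W"
    and "\<And>x b. (\<And>p. p \<in> P \<Longrightarrow> (\<Sum>q\<in>Q. x q * a q p) = 0) \<Longrightarrow> (\<Sum>q\<in>Q. x q * w q b) = 0"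
  shows "\<exists>e. (\<forall>p\<in>P. e p \<in> W) \<and> (\<forall>q\<in>Q. \<forall>b. (\<Sum>p\<in>P. a q p * e p b) = w q b)"
  using assms(1,2,5,6)
proof (induction P arbitrary: Q a w rule: finite_induct)
  case empty
  \<comment> \<open>Without columns every \<open>x\<close> is a relation; the unit vector at
    \<open>q\<close> gives \<open>w q = 0\<close>.\<close>
  have "w q b = 0" if "q \<in> Q" for q b
  proof -
    have "(\<Sum>q'\<in>Q. (if q' = q then 1 else 0) * w q' b) = 0"
      by (rule empty(3)) simp
    then show ?thesis using that empty(1) by (simp add: if_distrib[of "\<lambda>x. x * _"] cong: if_cong)
  qed
  then show ?case by simp
next
  case (insert p P)
  show ?case
  proof (cases "\<forall>q\<in>Q. a q p = 0")
    case True
    \<comment> \<open>A zero column leaves the unknown at \<open>p\<close> free, and it is set to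
      zero.\<close>
    have "\<exists>e. (\<forall>p\<in>P. e p \<in> W) \<and> (\<forall>q\<in>Q. \<forall>b. (\<Sum>p\<in>P. a q p * e p b) = w q b)"
    proof (rule insert.IH[OF insert.prems(1,2)])
      show "(\<Sum>q\<in>Q. x q * w q b) = 0" if "\<And>p. p \<in> P \<Longrightarrow> (\<Sum>q\<in>Q. x q * a q p) = 0" for x b
      proof (rule insert.prems(3))
        fix p' assume "p' \<in> insert p P"
        then show "(\<Sum>q\<in>Q. x q * a q p') = 0" using that True by (cases "p' = p") auto
      qed
    qed
    then obtain e where e: "\<forall>p\<in>P. e p \<in> W" "\<forall>q\<in>Q. \<forall>b. (\<Sum>p\<in>P. a q p * e p b) = w q b"
      by blast
    have "(\<Sum>s\<in>P. a q s * (e(p := \<lambda>_. 0)) s b) = (\<Sum>s\<in>P. a q s * e s b)" for q b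
      using insert.hyps(2) by (intro sum.cong) auto
    then show ?thesis
      using e insert.hyps W0 by (intro exI[of _ "e(p := \<lambda>_. 0)"]) auto
  next
    case False
    then obtain q0 where q0: "q0 \<in> Q" "a q0 p \<noteq> 0" by blast
    define Q' where "Q' = Q - {q0}"
    \<comment> \<open>Row \<open>q0\<close> is the pivot; subtracting \<open>r q\<close> times it
      from row \<open>q\<close> clears column \<open>p\<close>.\<close>
    define r where "r q = a q p / a q0 p" for q
    have Q: "finite Q'" "q0 \<notin> Q'" "Q = insert q0 Q'"
      using insert.prems(1) q0 by (auto simp: Q'_def)
    have "\<exists>e. (\<forall>s\<in>P. e s \<in> W) \<and>
      (\<forall>q\<in>Q'. \<forall>b. (\<Sum>s\<in>P. (a q s - r q * a q0 s) * e s b) = w q b + (- r q) * w q0 b)"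
    proof (rule insert.IH[OF Q(1)])
      show "(\<lambda>b. w q b + - r q * w q0 b) \<in> W" if "q \<in> Q'" for q
        using that Q insert.prems(2) by (intro W) auto
      fix x b assume x: "\<And>s. s \<in> P \<Longrightarrow> (\<Sum>q\<in>Q'. x q * (a q s - r q * a q0 s)) = 0"
      \<comment> \<open>A relation between the reduced rows becomes one between the original rows
        when the pivot row receives the balancing coefficient.\<close>
      define y where "y q = (if q = q0 then - (\<Sum>q\<in>Q'. x q * r q) else x q)" for q
      have y: "(\<Sum>q\<in>Q. y q * h q) = (\<Sum>q\<in>Q'. x q * (h q - r q * h q0))" for h
      proof -
        have "(\<Sum>q\<in>Q'. y q * h q) = (\<Sum>q\<in>Q'. x q * h q)"
          using Q(2) by (intro sum.cong) (auto simp: y_def)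
        then show ?thesis
          using Q by (simp add: y_def algebra_simps sum.distrib sum_subtractf sum_distrib_left)
      qed
      have "(\<Sum>q\<in>Q. y q * w q b) = 0"
      proof (rule insert.prems(3))
        fix s assume "s \<in> insert p P"
        then show "(\<Sum>q\<in>Q. y q * a q s) = 0"
          unfolding y using x q0 by (auto simp: r_def)
      qed
      then show "(\<Sum>q\<in>Q'. x q * (w q b + - r q * w q0 b)) = 0"
        unfolding y by simp
    qed
    then obtain e where e: "\<forall>s\<in>P. e s \<in> W"
      "\<And>q b. q \<in> Q' \<Longrightarrow> (\<Sum>s\<in>P. (a q s - r q * a q0 s) * e s b) = w q b + (- r q) * w q0 b"
      by blast
    define E where "E = (\<lambda>b. \<Sum>s\<in>P. a q0 s * e s b)"
    \<comment> \<open>Back substitution into the pivot row. The shape \<open>0 + c * h\<close>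
      matches the closure property assumed of \<open>W\<close>.\<close>
    define ep where "ep = (\<lambda>b. 0 + (1 / a q0 p) * (w q0 b + (- 1) * E b))"
    have "E \<in> W"
      unfolding E_def using insert.hyps(1) W0 W e(1) by (intro sum_in_subspace) auto
    then have "ep \<in> W"
      unfolding ep_def using W0 q0 insert.prems(2) by (intro W) auto
    moreover have "a q p * ep b + (\<Sum>s\<in>P. a q s * e s b) = w q b" if "q \<in> Q" for q b
    proof (cases "q = q0")
      case True
      then show ?thesis using q0 by (simp add: ep_def E_def)
    next
      case False
      then have "q \<in> Q'" using that Q by auto
      have A: "(\<Sum>s\<in>P. a q s * e s b) = w q b - r q * w q0 b + r q * E b"
        using e(2)[OF \<open>q \<in> Q'\<close>, of b]
        by (simp add: E_def algebra_simps sum_subtractf sum_distrib_left)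
      have B: "a q p * ep b = r q * (w q0 b - E b)"
        by (simp add: ep_def r_def)
      show ?thesis unfolding A B by (simp add: right_diff_distrib)
    qed
    moreover have "(\<Sum>s\<in>P. a q s * (e(p := ep)) s b) = (\<Sum>s\<in>P. a q s * e s b)" for q b
      using insert.hyps(2) by (intro sum.cong) auto
    ultimately show ?thesis
      using e(1) insert.hyps by (intro exI[of _ "e(p := ep)"]) auto
  qed
qed

text \<open>Acyclicity is an integral statement but will be applied to rational chains, whose
  denominators have to be cleared first.\<close>

lemma common_denominator:
  fixes x :: "'b \<Rightarrow> rat"
  assumes "finite S"
  shows "\<exists>N>0. \<forall>s\<in>S. \<exists>k. of_int k = of_int N * x s"
  using assms
proof (induction S rule: finite_induct)
  case empty
  then show ?case by (intro exI[of _ 1]) simp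
next
  case (insert s S)
  then obtain N where N: "N > 0" "\<forall>s\<in>S. \<exists>k. of_int k = of_int N * x s" by blast
  obtain p q where pq: "q > 0" "x s = of_int p / of_int q"
    by (metis quotient_of_div quotient_of_denom_pos surj_pair)
  show ?case
  proof (rule exI[of _ "N * q"], intro conjI ballI)
    fix t assume "t \<in> insert s S"
    then consider "t = s" | "t \<in> S" by blast
    then show "\<exists>k. of_int k = of_int (N * q) * x t"
    proof cases
      case 1
      then show ?thesis using pq by (intro exI[of _ "N * p"]) simp
    next
      case 2
      then obtain k where "of_int k = of_int N * x t" using N by blast
      then show ?thesis by (intro exI[of _ "q * k"]) simp
    qed
  qed (use N pq in simp)
qed

lemma of_int_bd: "of_int (bd V c \<beta>) = bd V (\<lambda>\<sigma>. of_int (c \<sigma>)) \<beta>"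
  by (simp add: bd_def vsign_def)

text \<open>Here \<open>x\<close> represents a chain of the full simplex on \<open>J\<close> modulo the link of \<open>V - J\<close>, by its
  coefficients outside the link.\<close>

lemma relative_acyclic:
  fixes x :: "'a set \<Rightarrow> rat"
  assumes V: "finite V" and X: "fin_complex X" "X \<subseteq> Pow V" and J: "J \<subseteq> V" "j \<in> J"
    and acyc: "acyclic_at V (complex_link X (V - J)) n"
    and x: "\<And>\<sigma>. x \<sigma> \<noteq> 0 \<Longrightarrow> \<sigma> \<subseteq> J \<and> card \<sigma> = Suc n \<and> \<sigma> \<union> (V - J) \<notin> X"
    and cyc: "\<And>\<beta>. \<lbrakk>\<beta> \<subseteq> J; \<beta> \<union> (V - J) \<notin> X\<rbrakk> \<Longrightarrow> bd V x \<beta> = 0"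
  shows "\<exists>y. (\<forall>\<sigma>. y \<sigma> \<noteq> 0 \<longrightarrow> \<sigma> \<subseteq> J \<and> card \<sigma> = Suc (Suc n)) \<and>
    (\<forall>\<sigma>. \<sigma> \<subseteq> J \<longrightarrow> \<sigma> \<union> (V - J) \<notin> X \<longrightarrow> bd V y \<sigma> = x \<sigma>)"
proof -
  let ?L = "complex_link X (V - J)"
  have finJ: "finite J" using J V finite_subset by blast
  obtain N where N: "N > 0" "\<forall>\<sigma>\<in>Pow V. \<exists>k. of_int k = of_int N * x \<sigma>"
    using common_denominator[of "Pow V" x] V by auto
  define c where "c \<sigma> = (if \<sigma> \<subseteq> J then \<lfloor>of_int N * x \<sigma>\<rfloor> else 0)" for \<sigma>
  have c: "of_int (c \<sigma>) = of_int N * x \<sigma>" for \<sigma>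
  proof (cases "\<sigma> \<subseteq> J")
    case True
    then obtain k where "of_int k = of_int N * x \<sigma>" using N J by blast
    then have "\<lfloor>of_int N * x \<sigma>\<rfloor> = k" by (metis floor_of_int)
    with True \<open>of_int k = _\<close> show ?thesis by (simp add: c_def)
  next
    case False
    then show ?thesis using x[of \<sigma>] by (auto simp: c_def)
  qed
  have c_iff: "c \<sigma> \<noteq> 0 \<longleftrightarrow> x \<sigma> \<noteq> 0" for \<sigma>
    using c[of \<sigma>] N(1) by (metis mult_eq_0_iff of_int_eq_0_iff less_irrefl)
  have cJ: "\<sigma> \<subseteq> J" "card \<sigma> = Suc n" if "c \<sigma> \<noteq> 0" for \<sigma>
    using that c_iff x by auto
  \<comment> \<open>The hypothesis \<open>cyc\<close> places the boundary of \<open>c\<close> in the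
    link; being a cycle there, it bounds some \<open>u\<close> of the link.\<close>
  have "chain_on ?L n (bd V c)"
    unfolding chain_on_def
  proof (intro allI impI)
    fix \<beta> assume nz: "bd V c \<beta> \<noteq> 0"
    then obtain u where u: "u \<in> V - \<beta>" "c (insert u \<beta>) \<noteq> 0" by (rule bd_nonzeroE)
    then have \<beta>: "\<beta> \<subseteq> J" "card \<beta> = n"
      using cJ[OF u(2)] finite_subset[OF _ finJ, of \<beta>] by auto
    have "of_int (bd V c \<beta>) = of_int N * bd V x \<beta>"
      by (simp add: of_int_bd c bd_mult)
    then have "bd V x \<beta> \<noteq> 0" using nz by auto
    then have "\<beta> \<union> (V - J) \<in> X" using cyc \<beta> by blast
    then show "\<beta> \<in> ?L \<and> card \<beta> = n"
      using \<beta> by (auto simp: mem_complex_link_iff[OF X(1)])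
  qed
  moreover have "bd V (bd V c) = (\<lambda>\<sigma>. 0)"
    using bd_bd[of V c] V cJ(1) J(1) by blast
  ultimately obtain u where u: "chain_on ?L (Suc n) u" "bd V u = bd V c"
    using acyc unfolding acyclic_at_def by blast
  \<comment> \<open>This is an absolute cycle of the full simplex on \<open>J\<close>, hence bounded
    by its cone from \<open>j\<close>. Outside the link \<open>u\<close> vanishes, so there the
    boundary of that cone is \<open>c\<close>.\<close>
  define t where "t = (\<lambda>\<sigma>. c \<sigma> - u \<sigma>)"
  have tJ: "\<sigma> \<subseteq> J \<and> card \<sigma> = Suc n" if "t \<sigma> \<noteq> 0" for \<sigma>
  proof (cases "c \<sigma> = 0")
    case True
    then have "u \<sigma> \<noteq> 0" using that by (simp add: t_def)
    then have "\<sigma> \<in> ?L" "card \<sigma> = Suc n" using chain_onD[OF u(1)] by auto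
    then show ?thesis using X(2) by (auto simp: complex_link_def)
  qed (use cJ in auto)
  have bt: "bd V t = (\<lambda>\<sigma>. 0)"
    unfolding t_def bd_diff u(2) by simp
  have cone: "bd V (cone j t) = t"
    using bd_cone[of V j t] V J tJ bt by (simp add: subset_iff)
  define y where "y = (\<lambda>\<sigma>. (1 / of_int N) * of_int (cone j t \<sigma>) :: rat)"
  show ?thesis
  proof (intro exI[of _ y] conjI allI impI)
    fix \<sigma> assume "y \<sigma> \<noteq> 0"
    then have *: "j \<in> \<sigma>" "t (\<sigma> - {j}) \<noteq> 0" by (auto simp: y_def cone_def split: if_splits)
    from tJ[OF *(2)] show "\<sigma> \<subseteq> J" using J(2) by auto
    then have "finite \<sigma>" using finJ finite_subset by blast
    then show "card \<sigma> = Suc (Suc n)"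
      using tJ[OF *(2)] card_Suc_Diff1[OF _ *(1)] by simp
  next
    fix \<sigma> assume \<sigma>: "\<sigma> \<subseteq> J" "\<sigma> \<union> (V - J) \<notin> X"
    then have "u \<sigma> = 0"
      using chain_onD[OF u(1), of \<sigma>] by (auto simp: mem_complex_link_iff[OF X(1)])
    have "bd V y \<sigma> = (1 / of_int N) * of_int (bd V (cone j t) \<sigma>)"
      unfolding y_def bd_mult of_int_bd ..
    also have "\<dots> = x \<sigma>"
      unfolding cone using c[of \<sigma>] N(1) \<open>u \<sigma> = 0\<close> by (simp add: t_def)
    finally show "bd V y \<sigma> = x \<sigma>" .
  qed
qed

section \<open>Matroid-valued chains\<close>

text \<open>\<open>M\<close> plays the part of \<open>N\<close> in the opening remarks, and
  \<open>link_acyclic\<close> is what failure of the inequality for all faces provides. Acyclicity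
  at \<open>\<rho> J\<close> concerns degree \<open>\<rho> J - 1\<close>, the first one in which
  \<open>M\<close> restricted to \<open>J\<close> may have homology.\<close>

locale matroid_with_links = matroid M for M :: "'a set set" +
  fixes V :: "'a set" and X :: "'a set set"
  assumes V: "finite V" and MV: "M \<subseteq> Pow V" and X: "fin_complex X" and XV: "X \<subseteq> Pow V"
    and link_acyclic: "\<And>J. \<lbrakk>J \<subseteq> V; J \<noteq> {}\<rbrakk> \<Longrightarrow> acyclic_at V (complex_link X (V - J)) (\<rho> J)"
begin

text \<open>\<open>F\<close> encodes, by its values on simplices, a degree-preserving linear map
  from chains of the full simplex on \<open>J\<close> modulo the link of \<open>V - J\<close> to
  chains of \<open>M\<close> restricted to \<open>J\<close>.\<close>

definition valid :: "'a set \<Rightarrow> ('a set \<Rightarrow> 'a set \<Rightarrow> rat) \<Rightarrow> bool" where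
  "valid J F \<longleftrightarrow> (\<forall>\<sigma> \<beta>. F \<sigma> \<beta> \<noteq> 0 \<longrightarrow>
     \<sigma> \<subseteq> J \<and> \<sigma> \<union> (V - J) \<notin> X \<and> \<beta> \<in> M \<and> \<beta> \<subseteq> J \<and> card \<beta> = card \<sigma>)"

lemma validD:
  assumes "valid J F" "F \<sigma> \<beta> \<noteq> 0"
  shows "\<sigma> \<subseteq> J" "\<sigma> \<union> (V - J) \<notin> X" "\<beta> \<in> M" "\<beta> \<subseteq> J" "card \<beta> = card \<sigma>"
  using assms unfolding valid_def by blast+

lemma valid_zero:
  assumes "valid J F" "\<sigma> \<union> (V - J) \<in> X"
  shows "F \<sigma> \<beta> = 0" "F (\<sigma> - {v}) \<beta> = 0"
proof -
  have "\<sigma> - {v} \<union> (V - J) \<in> X"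
    by (rule fin_complex_downD[OF X assms(2)]) auto
  then show "F \<sigma> \<beta> = 0" "F (\<sigma> - {v}) \<beta> = 0"
    using assms unfolding valid_def by blast+
qed

text \<open>One step of the induction on \<open>J\<close>. The map \<open>g\<close> gathers the
  chains already chosen for the sets \<open>J - {v}\<close>; it lowers sizes by one and, by
  \<open>g_cycle\<close>, anticommutes with boundaries. Sought is a valid \<open>F\<close> whose
  failure to commute with boundaries is \<open>g\<close>.\<close>

context
  fixes J :: "'a set" and g :: "'a set \<Rightarrow> 'a set \<Rightarrow> rat"
  assumes J: "J \<subseteq> V" "J \<noteq> {}"
    and g: "\<And>\<sigma> \<beta>. g \<sigma> \<beta> \<noteq> 0 \<Longrightarrow>
      \<sigma> \<subseteq> J \<and> \<sigma> \<union> (V - J) \<notin> X \<and> \<beta> \<in> M \<and> \<beta> \<subseteq> J \<and> Suc (card \<beta>) = card \<sigma>"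
    and g_cycle: "\<And>\<sigma> \<beta>. \<sigma> \<subseteq> J \<Longrightarrow> bd V (g \<sigma>) \<beta> = - cobd (\<lambda>\<tau>. g \<tau> \<beta>) \<sigma>"
begin

lemma finJ: "finite J"
  using J(1) V finite_subset by blast

text \<open>The boundary that \<open>F \<sigma>\<close> is required to have; it involves
  \<open>F\<close> only at the facets of \<open>\<sigma>\<close>.\<close>

definition obstr :: "('a set \<Rightarrow> 'a set \<Rightarrow> rat) \<Rightarrow> 'a set \<Rightarrow> 'a set \<Rightarrow> rat" where
  "obstr F \<sigma> \<beta> = cobd (\<lambda>\<tau>. F \<tau> \<beta>) \<sigma> - g \<sigma> \<beta>"

lemma obstr_chain:
  assumes "valid J F" "\<sigma> \<subseteq> J" "card \<sigma> = Suc c"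
  shows "chain_on (induced_complex M J) c (obstr F \<sigma>)"
  unfolding chain_on_def
proof (intro allI impI)
  fix \<beta> assume "obstr F \<sigma> \<beta> \<noteq> 0"
  then consider "g \<sigma> \<beta> \<noteq> 0" | "cobd (\<lambda>\<tau>. F \<tau> \<beta>) \<sigma> \<noteq> 0" by (fastforce simp: obstr_def)
  then show "\<beta> \<in> induced_complex M J \<and> card \<beta> = c"
  proof cases
    case 1
    then show ?thesis using g[of \<sigma> \<beta>] assms(3) by (auto simp: induced_complex_def)
  next
    case 2
    then obtain v where v: "v \<in> \<sigma>" "F (\<sigma> - {v}) \<beta> \<noteq> 0"
      using cobd_eq_0[of \<sigma> "\<lambda>\<tau>. F \<tau> \<beta>"] by blast
    have "card (\<sigma> - {v}) = c"
      using v(1) assms(3) finite_subset[OF assms(2) finJ] by (simp add: card_Diff_singleton)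
    then show ?thesis using validD[OF assms(1) v(2)] by (auto simp: induced_complex_def)
  qed
qed

text \<open>The contribution of \<open>g_cycle\<close> cancels the one that \<open>g\<close> makes
  through the equations at the facets; what remains is a double coboundary.\<close>

lemma obstr_cycle:
  assumes "\<sigma> \<subseteq> J" "card \<sigma> = Suc c"
    and eq: "\<And>\<tau> \<beta>. \<lbrakk>\<tau> \<subseteq> J; card \<tau> \<le> c\<rbrakk> \<Longrightarrow> bd V (F \<tau>) \<beta> = obstr F \<tau> \<beta>"
  shows "bd V (obstr F \<sigma>) = (\<lambda>\<beta>. 0)"
proof
  fix \<beta>
  have fin: "finite \<sigma>" using assms(1) finJ finite_subset by blast
  have "bd V (obstr F \<sigma>) \<beta> = bd V (\<lambda>\<beta>. cobd (\<lambda>\<tau>. F \<tau> \<beta>) \<sigma>) \<beta> - bd V (g \<sigma>) \<beta>"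
    unfolding obstr_def[abs_def] bd_diff ..
  also have "\<dots> = cobd (\<lambda>\<tau>. bd V (F \<tau>) \<beta>) \<sigma> + cobd (\<lambda>\<tau>. g \<tau> \<beta>) \<sigma>"
    unfolding bd_cobd using g_cycle[OF assms(1)] by simp
  also have "cobd (\<lambda>\<tau>. bd V (F \<tau>) \<beta>) \<sigma> = cobd (\<lambda>\<tau>. obstr F \<tau> \<beta>) \<sigma>"
  proof (rule cobd_cong, rule eq)
    fix v assume "v \<in> \<sigma>"
    then show "\<sigma> - {v} \<subseteq> J" "card (\<sigma> - {v}) \<le> c"
      using assms(1,2) fin by (auto simp: card_Diff_singleton)
  qed
  also have "\<dots> + cobd (\<lambda>\<tau>. g \<tau> \<beta>) \<sigma> = 0"
    unfolding obstr_def cobd_diff cobd_cobd[OF fin] by simp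
  finally show "bd V (obstr F \<sigma>) \<beta> = 0" .
qed

lemma obstr_zero:
  assumes "valid J F" "\<sigma> \<union> (V - J) \<in> X"
  shows "obstr F \<sigma> \<beta> = 0"
  using valid_zero(2)[OF assms] g[of \<sigma> \<beta>] assms(2) unfolding obstr_def
  by (metis (no_types, lifting) cobd_eq_0 diff_zero)

text \<open>Values are chosen size by size. The obstruction at a set of \<open>Suc c\<close>
  elements is a cycle on independent sets of \<open>c\<close> elements, which
  \<open>matroid_acyclic\<close> bounds as long as \<open>c < \<rho> J\<close>. On simplices of the
  link the value must be 0, and there the obstruction is 0 as well.\<close>

lemma fill_below_rank:
  assumes "c \<le> \<rho> J"
  shows "\<exists>F. valid J F \<and> (\<forall>\<sigma> \<beta>. F \<sigma> \<beta> \<noteq> 0 \<longrightarrow> card \<sigma> \<le> c) \<and>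
    (\<forall>\<sigma> \<beta>. \<sigma> \<subseteq> J \<longrightarrow> card \<sigma> \<le> c \<longrightarrow> bd V (F \<sigma>) \<beta> = obstr F \<sigma> \<beta>)"
  using assms
proof (induction c)
  case 0
  have "obstr (\<lambda>_ _. 0) \<sigma> \<beta> = 0" if "card \<sigma> = 0" for \<sigma> \<beta>
    using that g[of \<sigma> \<beta>] by (auto simp: obstr_def cobd_def)
  then show ?case
    by (intro exI[of _ "\<lambda>_ _. 0"]) (auto simp: valid_def)
next
  case (Suc c)
  then obtain F where F: "valid J F" "\<And>\<sigma> \<beta>. F \<sigma> \<beta> \<noteq> 0 \<Longrightarrow> card \<sigma> \<le> c"
    "\<And>\<sigma> \<beta>. \<lbrakk>\<sigma> \<subseteq> J; card \<sigma> \<le> c\<rbrakk> \<Longrightarrow> bd V (F \<sigma>) \<beta> = obstr F \<sigma> \<beta>"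
    by (metis Suc_leD)
  define S where "S = {\<sigma>. \<sigma> \<subseteq> J \<and> card \<sigma> = Suc c \<and> \<sigma> \<union> (V - J) \<notin> X}"
  let ?MJ = "induced_complex M J"
  obtain B where B: "B \<in> M" "B \<subseteq> J" "card B = \<rho> J" by (rule indep_of_rank)
  have "\<exists>b. chain_on ?MJ (Suc c) b \<and> bd V b = obstr F \<sigma>" if "\<sigma> \<in> S" for \<sigma>
  proof (rule matroid_acyclic[OF V finJ J(1) fin_matroid_induced[OF M]])
    show "B \<in> ?MJ" using B by (simp add: induced_complex_def)
    show "c < card B" using B Suc.prems by simp
    show "chain_on ?MJ c (obstr F \<sigma>)"
      using that by (intro obstr_chain F(1)) (auto simp: S_def)
    show "bd V (obstr F \<sigma>) = (\<lambda>\<beta>. 0)"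
      using that by (intro obstr_cycle[of \<sigma> c] F(3)) (auto simp: S_def)
  qed (auto simp: induced_complex_def)
  then obtain b where b: "\<And>\<sigma>. \<sigma> \<in> S \<Longrightarrow> chain_on ?MJ (Suc c) (b \<sigma>)" "\<And>\<sigma>. \<sigma> \<in> S \<Longrightarrow> bd V (b \<sigma>) = obstr F \<sigma>"
    by metis
  define F' where "F' \<sigma> = (if \<sigma> \<in> S then b \<sigma> else F \<sigma>)" for \<sigma>
  have F'_low: "F' \<sigma> = F \<sigma>" if "card \<sigma> \<le> c" for \<sigma>
    using that by (simp add: F'_def S_def)
  have valid': "valid J F'"
    unfolding valid_def
  proof (intro allI impI)
    fix \<sigma> \<beta> assume nz: "F' \<sigma> \<beta> \<noteq> 0"
    show "\<sigma> \<subseteq> J \<and> \<sigma> \<union> (V - J) \<notin> X \<and> \<beta> \<in> M \<and> \<beta> \<subseteq> J \<and> card \<beta> = card \<sigma>"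
    proof (cases "\<sigma> \<in> S")
      case True
      then show ?thesis
        using chain_onD[OF b(1)[OF True], of \<beta>] nz by (auto simp: F'_def S_def induced_complex_def)
    next
      case False
      then show ?thesis using validD[OF F(1), of \<sigma> \<beta>] nz by (simp add: F'_def)
    qed
  qed
  have obstr': "obstr F' \<sigma> \<beta> = obstr F \<sigma> \<beta>" if "\<sigma> \<subseteq> J" "card \<sigma> \<le> Suc c" for \<sigma> \<beta>
  proof -
    have "cobd (\<lambda>\<tau>. F' \<tau> \<beta>) \<sigma> = cobd (\<lambda>\<tau>. F \<tau> \<beta>) \<sigma>"
    proof (rule cobd_cong)
      fix v assume "v \<in> \<sigma>"
      then have "card (\<sigma> - {v}) \<le> c"
        using that finite_subset[OF that(1) finJ] by (simp add: card_Diff_singleton)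
      then show "F' (\<sigma> - {v}) \<beta> = F (\<sigma> - {v}) \<beta>" by (simp add: F'_low)
    qed
    then show ?thesis by (simp add: obstr_def)
  qed
  show ?case
  proof (rule exI[of _ F'], intro conjI allI impI)
    show "card \<sigma> \<le> Suc c" if "F' \<sigma> \<beta> \<noteq> 0" for \<sigma> \<beta>
      using that F(2)[of \<sigma> \<beta>] by (auto simp: F'_def S_def split: if_splits)
    fix \<sigma> \<beta> assume \<sigma>: "\<sigma> \<subseteq> J" "card \<sigma> \<le> Suc c"
    show "bd V (F' \<sigma>) \<beta> = obstr F' \<sigma> \<beta>"
      unfolding obstr'[OF \<sigma>]
    proof (cases "\<sigma> \<in> S")
      case True
      then show "bd V (F' \<sigma>) \<beta> = obstr F \<sigma> \<beta>" using b by (simp add: F'_def)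
    next
      case False
      then consider "card \<sigma> \<le> c" | "\<sigma> \<union> (V - J) \<in> X" using \<sigma> by (force simp: S_def)
      then show "bd V (F' \<sigma>) \<beta> = obstr F \<sigma> \<beta>"
      proof cases
        case 1
        then show ?thesis using F(3) \<sigma> by (simp add: F'_low)
      next
        case 2
        then have "F' \<sigma> = (\<lambda>_. 0)" using valid_zero(1)[OF valid'] by auto
        then show ?thesis using obstr_zero[OF F(1) 2] by simp
      qed
    qed
  qed (use valid' in simp)
qed

text \<open>At the level of the rank, the chains found so far are corrected by cycles of the matroid. The
  correction is prescribed on boundaries modulo the link; it is well defined there because
  the relative chains are exact, and it extends linearly.\<close>

lemma fill:
  "\<exists>F. valid J F \<and> (\<forall>\<sigma> \<beta>. \<sigma> \<subseteq> J \<longrightarrow> bd V (F \<sigma>) \<beta> = obstr F \<sigma> \<beta>)"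
proof -
  define n where "n = \<rho> J"
  obtain F where F: "valid J F" "\<And>\<sigma> \<beta>. F \<sigma> \<beta> \<noteq> 0 \<Longrightarrow> card \<sigma> \<le> n"
    "\<And>\<sigma> \<beta>. \<lbrakk>\<sigma> \<subseteq> J; card \<sigma> \<le> n\<rbrakk> \<Longrightarrow> bd V (F \<sigma>) \<beta> = obstr F \<sigma> \<beta>"
    using fill_below_rank[of n] unfolding n_def by blast
  \<comment> \<open>\<open>P\<close> indexes the values of size \<open>n\<close> that may be changed
    by cycles from \<open>W\<close>, and each \<open>q\<close> in \<open>Q\<close> gives one
    equation with incidence coefficients \<open>a q p\<close>. Since \<open>F\<close> is 0 at
    \<open>q\<close>, the equations ask that the corrected obstruction vanish there.\<close>
  define P where "P = {\<sigma>. \<sigma> \<subseteq> J \<and> card \<sigma> = n \<and> \<sigma> \<union> (V - J) \<notin> X}"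
  define Q where "Q = {\<sigma>. \<sigma> \<subseteq> J \<and> card \<sigma> = Suc n \<and> \<sigma> \<union> (V - J) \<notin> X}"
  define a :: "'a set \<Rightarrow> 'a set \<Rightarrow> rat" where "a q p = cobd (\<lambda>\<tau>. if \<tau> = p then 1 else 0) q" for q p
  define w where "w q = (\<lambda>\<beta>. 0 + (- 1) * obstr F q \<beta>)" for q
  let ?MJ = "induced_complex M J"
  define W where "W = {h :: 'a set \<Rightarrow> rat. chain_on ?MJ n h \<and> bd V h = (\<lambda>\<beta>. 0)}"
  have PQ: "finite P" "finite Q" "P \<subseteq> Pow V" "Q \<subseteq> Pow V"
    using finJ J finite_subset[of _ "Pow J"] by (auto simp: P_def Q_def)
  have W0: "(\<lambda>_. 0) \<in> W" by (simp add: W_def chain_on_def)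
  have W_lin: "(\<lambda>b. f b + k * h b) \<in> W" if "f \<in> W" "h \<in> W" for f h k
    using that unfolding W_def mem_Collect_eq bd_add bd_mult
    by (auto simp: chain_on_def) (metis add_0 mult_zero_right)+
  have too_big: "\<beta> \<notin> M \<or> \<not> \<beta> \<subseteq> J" if "card \<beta> > n" for \<beta>
    using that card_le_rank[of \<beta> J] by (auto simp: n_def)
  have g_top: "g \<sigma> \<beta> = 0" if "card \<sigma> > Suc n" for \<sigma> \<beta>
    using g[of \<sigma> \<beta>] too_big[of \<beta>] that by (cases "g \<sigma> \<beta> = 0") auto
  have "\<exists>e. (\<forall>p\<in>P. e p \<in> W) \<and> (\<forall>q\<in>Q. \<forall>\<beta>. (\<Sum>p\<in>P. a q p * e p \<beta>) = w q \<beta>)"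
  proof (rule solve_in_subspace[OF PQ(1,2) W0 W_lin])
    show "w q \<in> W" if "q \<in> Q" for q
    proof -
      have "chain_on ?MJ n (obstr F q)"
        using that by (intro obstr_chain F(1)) (auto simp: Q_def)
      moreover have "bd V (obstr F q) = (\<lambda>\<beta>. 0)"
        using that by (intro obstr_cycle[of q n] F(3)) (auto simp: Q_def)
      ultimately have "obstr F q \<in> W" by (simp add: W_def)
      then show ?thesis unfolding w_def by (rule W_lin[OF W0])
    qed
  next
    fix x :: "'a set \<Rightarrow> rat" and \<beta>
    assume x: "\<And>p. p \<in> P \<Longrightarrow> (\<Sum>q\<in>Q. x q * a q p) = 0"
    \<comment> \<open>A relation between the equations is a chain whose boundary vanishes outside
      the link, so \<open>relative_acyclic\<close> makes it a boundary modulo the link.\<close>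
    define x' where "x' \<sigma> = (if \<sigma> \<in> Q then x \<sigma> else 0)" for \<sigma>
    have sumQ: "(\<Sum>q\<in>Q. x q * h q) = (\<Sum>\<sigma>\<in>Pow V. x' \<sigma> * h \<sigma>)" for h
      using PQ V by (intro sum.mono_neutral_cong_left) (auto simp: x'_def)
    have bdx': "bd V x' p = (\<Sum>q\<in>Q. x q * a q p)" if "p \<in> Pow V" for p
    proof -
      have "(\<Sum>q\<in>Q. x q * a q p) = (\<Sum>\<tau>\<in>Pow V. bd V x' \<tau> * (if \<tau> = p then 1 else 0))"
        unfolding sumQ a_def by (rule pairing_cobd[OF V])
      then show ?thesis using that V by (simp add: if_distrib[of "\<lambda>t. _ * t"] cong: if_cong)
    qed
    have bdx'_zero: "bd V x' p = 0" if p: "p \<subseteq> J" "p \<union> (V - J) \<notin> X" for p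
    proof (rule ccontr)
      assume nz: "bd V x' p \<noteq> 0"
      then obtain u where u: "u \<in> V - p" "x' (insert u p) \<noteq> 0" by (rule bd_nonzeroE)
      then have "insert u p \<in> Q" unfolding x'_def by metis
      then have "card p = n"
        using finite_subset[OF p(1) finJ] u(1) by (simp add: Q_def)
      then have "p \<in> P" using p by (simp add: P_def)
      then show False using nz bdx'[of p] x PQ(3) by auto
    qed
    obtain j where "j \<in> J" using J(2) by blast
    have "\<exists>y. (\<forall>\<sigma>. y \<sigma> \<noteq> 0 \<longrightarrow> \<sigma> \<subseteq> J \<and> card \<sigma> = Suc (Suc n)) \<and>
      (\<forall>\<sigma>. \<sigma> \<subseteq> J \<longrightarrow> \<sigma> \<union> (V - J) \<notin> X \<longrightarrow> bd V y \<sigma> = x' \<sigma>)"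
    proof (rule relative_acyclic[OF V X XV J(1) \<open>j \<in> J\<close>])
      show "acyclic_at V (complex_link X (V - J)) n"
        using link_acyclic[OF J] by (simp add: n_def)
      show "\<sigma> \<subseteq> J \<and> card \<sigma> = Suc n \<and> \<sigma> \<union> (V - J) \<notin> X" if "x' \<sigma> \<noteq> 0" for \<sigma>
        using that unfolding x'_def Q_def by (metis (mono_tags, lifting) mem_Collect_eq)
    qed (rule bdx'_zero)
    then obtain y where y: "\<And>\<sigma>. y \<sigma> \<noteq> 0 \<Longrightarrow> \<sigma> \<subseteq> J \<and> card \<sigma> = Suc (Suc n)"
      "\<And>\<sigma>. \<sigma> \<subseteq> J \<Longrightarrow> \<sigma> \<union> (V - J) \<notin> X \<Longrightarrow> bd V y \<sigma> = x' \<sigma>"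
      by blast
    \<comment> \<open>The pairing of \<open>x'\<close> with \<open>g\<close> passes through
      \<open>y\<close> to the coboundary of \<open>g\<close> at sets of \<open>n + 2\<close>
      elements. By \<open>g_cycle\<close> this is a boundary of \<open>g \<sigma>\<close>, which is
      0 because \<open>J\<close> has no independent set of \<open>n + 1\<close> elements.\<close>
    have "(\<Sum>\<sigma>\<in>Pow V. x' \<sigma> * g \<sigma> \<beta>) = (\<Sum>\<sigma>\<in>Pow V. bd V y \<sigma> * g \<sigma> \<beta>)"
      using g y(2) by (intro sum.cong refl) (metis mult_zero_right)
    also have "\<dots> = (\<Sum>\<sigma>\<in>Pow V. y \<sigma> * cobd (\<lambda>\<tau>. g \<tau> \<beta>) \<sigma>)"
      by (rule pairing_cobd[OF V, symmetric])
    also have "\<dots> = 0"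
    proof (rule sum.neutral, rule ballI)
      fix \<sigma>
      show "y \<sigma> * cobd (\<lambda>\<tau>. g \<tau> \<beta>) \<sigma> = 0"
      proof (cases "y \<sigma> = 0")
        case False
        then have \<sigma>: "\<sigma> \<subseteq> J" "card \<sigma> = Suc (Suc n)" using y(1) by auto
        then have "g \<sigma> = (\<lambda>_. 0)" using g_top by auto
        then show ?thesis using g_cycle[OF \<sigma>(1), of \<beta>] by simp
      qed simp
    qed
    finally have 1: "(\<Sum>\<sigma>\<in>Pow V. x' \<sigma> * g \<sigma> \<beta>) = 0" .
    \<comment> \<open>\<open>F\<close> is supported outside the link, where the boundary of
      \<open>x'\<close> vanishes.\<close>
    have "(\<Sum>\<sigma>\<in>Pow V. x' \<sigma> * cobd (\<lambda>\<tau>. F \<tau> \<beta>) \<sigma>) = (\<Sum>\<tau>\<in>Pow V. bd V x' \<tau> * F \<tau> \<beta>)"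
      by (rule pairing_cobd[OF V])
    also have "\<dots> = 0"
    proof (rule sum.neutral, rule ballI)
      fix \<tau>
      show "bd V x' \<tau> * F \<tau> \<beta> = 0"
        using validD(1,2)[OF F(1), of \<tau> \<beta>] bdx'_zero[of \<tau>] by (cases "F \<tau> \<beta> = 0") auto
    qed
    finally show "(\<Sum>q\<in>Q. x q * w q \<beta>) = 0"
      using 1 unfolding sumQ w_def obstr_def by (simp add: right_diff_distrib sum_subtractf)
  qed
  then obtain e where e: "\<And>p. p \<in> P \<Longrightarrow> e p \<in> W" "\<And>q \<beta>. q \<in> Q \<Longrightarrow> (\<Sum>p\<in>P. a q p * e p \<beta>) = w q \<beta>"
    by blast
  define E where "E \<sigma> = (if \<sigma> \<in> P then e \<sigma> else (\<lambda>_. 0))" for \<sigma>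
  define G where "G \<sigma> = (\<lambda>\<beta>. F \<sigma> \<beta> + E \<sigma> \<beta>)" for \<sigma>
  have E_W: "E \<sigma> \<in> W" for \<sigma> using e(1) W0 by (simp add: E_def)
  have E_zero: "E \<sigma> \<beta> = 0" if "card \<sigma> \<noteq> n" for \<sigma> \<beta> using that by (simp add: E_def P_def)
  have validE: "valid J E"
    unfolding valid_def
  proof (intro allI impI)
    fix \<sigma> \<beta> assume "E \<sigma> \<beta> \<noteq> 0"
    moreover from this have "\<sigma> \<in> P" by (auto simp: E_def split: if_splits)
    ultimately show "\<sigma> \<subseteq> J \<and> \<sigma> \<union> (V - J) \<notin> X \<and> \<beta> \<in> M \<and> \<beta> \<subseteq> J \<and> card \<beta> = card \<sigma>"
      using E_W[of \<sigma>] by (auto simp: W_def P_def induced_complex_def dest: chain_onD)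
  qed
  have validG: "valid J G"
    using F(1) validE unfolding valid_def G_def by (metis add.right_neutral)
  have obstrG: "obstr G \<sigma> \<beta> = obstr F \<sigma> \<beta> + cobd (\<lambda>\<tau>. E \<tau> \<beta>) \<sigma>" for \<sigma> \<beta>
    by (simp add: obstr_def G_def cobd_add)
  have "bd V (G \<sigma>) \<beta> = obstr G \<sigma> \<beta>" if \<sigma>: "\<sigma> \<subseteq> J" for \<sigma> \<beta>
  proof -
    have fin\<sigma>: "finite \<sigma>" using \<sigma> finJ finite_subset by blast
    have card_rem: "card (\<sigma> - {v}) = card \<sigma> - 1" "card \<sigma> > 0" if "v \<in> \<sigma>" for v
      using that fin\<sigma> by (auto simp: card_Diff_singleton card_gt_0_iff)
    \<comment> \<open>For small sets the old equations persist, because the corrections are cycles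
      and sit at size \<open>n\<close> only. On the link both sides vanish, on \<open>Q\<close> the
      linear system applies, and at larger sizes no independent sets are left.\<close>
    consider "card \<sigma> \<le> n" | "\<sigma> \<union> (V - J) \<in> X" | "\<sigma> \<in> Q" | "card \<sigma> > Suc n"
      using \<sigma> by (force simp: Q_def)
    then show ?thesis
    proof cases
      case 1
      have "cobd (\<lambda>\<tau>. E \<tau> \<beta>) \<sigma> = 0"
      proof (rule cobd_eq_0)
        fix v assume "v \<in> \<sigma>"
        then show "E (\<sigma> - {v}) \<beta> = 0" using card_rem 1 by (intro E_zero) fastforce
      qed
      moreover have "bd V (E \<sigma>) = (\<lambda>_. 0)" using E_W[of \<sigma>] by (simp add: W_def)
      ultimately show ?thesis
        unfolding obstrG G_def bd_add using F(3)[OF \<sigma> 1] by simp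
    next
      case 2
      then have "G \<sigma> = (\<lambda>_. 0)" using valid_zero(1)[OF validG] by auto
      then show ?thesis using obstr_zero[OF validG 2] by simp
    next
      case 3
      then have "card \<sigma> = Suc n" by (simp add: Q_def)
      then have "G \<sigma> = (\<lambda>_. 0)"
        using F(2)[of \<sigma>] E_zero[of \<sigma>] by (force simp: G_def)
      moreover have "cobd (\<lambda>\<tau>. E \<tau> \<beta>) \<sigma> = w \<sigma> \<beta>"
      proof -
        have "(\<Sum>p\<in>P. a \<sigma> p * e p \<beta>) = (\<Sum>v\<in>\<sigma>. \<Sum>p\<in>P. vsign \<sigma> v * (if \<sigma> - {v} = p then 1 else 0) * e p \<beta>)"
          unfolding a_def cobd_def sum_distrib_right by (rule sum.swap)
        also have "\<dots> = (\<Sum>v\<in>\<sigma>. vsign \<sigma> v * E (\<sigma> - {v}) \<beta>)"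
        proof (rule sum.cong[OF refl])
          fix v
          have "(\<Sum>p\<in>P. vsign \<sigma> v * (if \<sigma> - {v} = p then 1 else 0) * e p \<beta>) =
            (\<Sum>p\<in>P. if \<sigma> - {v} = p then vsign \<sigma> v * e p \<beta> else 0)"
            by (intro sum.cong) auto
          then show "(\<Sum>p\<in>P. vsign \<sigma> v * (if \<sigma> - {v} = p then 1 else 0) * e p \<beta>) = vsign \<sigma> v * E (\<sigma> - {v}) \<beta>"
            using PQ(1) by (simp add: E_def)
        qed
        finally show ?thesis using e(2)[OF 3, of \<beta>] by (simp add: cobd_def)
      qed
      ultimately show ?thesis by (simp add: obstrG w_def)
    next
      case 4
      then have "G \<sigma> = (\<lambda>_. 0)"
        using F(2)[of \<sigma>] E_zero[of \<sigma>] by (force simp: G_def)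
      moreover have "cobd (\<lambda>\<tau>. G \<tau> \<beta>) \<sigma> = 0"
      proof (rule cobd_eq_0, rule ccontr)
        fix v assume v: "v \<in> \<sigma>" "G (\<sigma> - {v}) \<beta> \<noteq> 0"
        note * = validD[OF validG v(2)]
        have "card \<beta> > n" using *(5) card_rem(1)[OF v(1)] 4 by linarith
        then show False using too_big *(3,4) by blast
      qed
      ultimately show ?thesis using g_top[OF 4] by (simp add: obstr_def)
    qed
  qed
  then show ?thesis using validG by blast
qed

end

section \<open>The chains for all \<open>J\<close> and their alternating trace\<close>

lemma fill_all:
  assumes "V \<notin> X"
  shows "\<exists>f. f {} {} {} = 1 \<and> (\<forall>J\<subseteq>V. valid J (f J) \<and>
    (\<forall>\<sigma>\<subseteq>J. \<forall>\<beta>. bd V (f J \<sigma>) \<beta> =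
       (\<Sum>v\<in>\<sigma>. vsign \<sigma> v * (f J (\<sigma> - {v}) \<beta> - f (J - {v}) (\<sigma> - {v}) \<beta>))))"
proof -
  define good where "good f J \<longleftrightarrow> valid J (f J) \<and>
    (\<forall>\<sigma>\<subseteq>J. \<forall>\<beta>. bd V (f J \<sigma>) \<beta> =
       (\<Sum>v\<in>\<sigma>. vsign \<sigma> v * (f J (\<sigma> - {v}) \<beta> - f (J - {v}) (\<sigma> - {v}) \<beta>)))"
    for f :: "'a set \<Rightarrow> 'a set \<Rightarrow> 'a set \<Rightarrow> rat" and J
  have "\<exists>f. f {} {} {} = 1 \<and> (\<forall>J\<subseteq>V. card J \<le> n \<longrightarrow> good f J)" for n
  proof (induction n)
    case 0
    \<comment> \<open>The only nonzero value at \<open>J = {}\<close> is the empty face; it is valid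
      there because the set to be tested against \<open>X\<close> is \<open>V\<close>
      itself.\<close>
    define f :: "'a set \<Rightarrow> 'a set \<Rightarrow> 'a set \<Rightarrow> rat"
      where "f J \<sigma> \<beta> = (if \<sigma> = {} \<and> \<beta> = {} then 1 else 0)" for J \<sigma> \<beta>
    have "good f {}"
      unfolding good_def valid_def using assms empty_indep by (auto simp: f_def bd_def)
    moreover have "J = {}" if "J \<subseteq> V" "card J \<le> 0" for J
      using that V finite_subset by fastforce
    ultimately have "\<forall>J\<subseteq>V. card J \<le> 0 \<longrightarrow> good f J" by metis
    moreover have "f {} {} {} = 1" by (simp add: f_def)
    ultimately show ?case by blast
  next
    case (Suc n)
    then obtain f where f: "f {} {} {} = 1" "\<And>J. \<lbrakk>J \<subseteq> V; card J \<le> n\<rbrakk> \<Longrightarrow> good f J" by blast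
    define R where "R J F \<longleftrightarrow> valid J F \<and> (\<forall>\<sigma>\<subseteq>J. \<forall>\<beta>. bd V (F \<sigma>) \<beta> =
       (\<Sum>v\<in>\<sigma>. vsign \<sigma> v * (F (\<sigma> - {v}) \<beta> - f (J - {v}) (\<sigma> - {v}) \<beta>)))" for J F
    have "\<exists>F. R J F"
      if J: "J \<subseteq> V" "card J = Suc n" for J
    proof -
      have finJ: "finite J" using J V finite_subset by blast
      have good': "good f (J - {v})" if "v \<in> J" for v
        using J that finJ by (intro f(2)) (auto simp: card_Diff_singleton)
      have valid': "valid (J - {v}) (f (J - {v}))" if "v \<in> J" for v
        using good'[OF that] by (simp add: good_def)
      define g where "g \<sigma> \<beta> = (if \<sigma> \<subseteq> J then \<Sum>v\<in>\<sigma>. vsign \<sigma> v * f (J - {v}) (\<sigma> - {v}) \<beta> else 0)" for \<sigma> \<beta>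
      have g: "\<sigma> \<subseteq> J \<and> \<sigma> \<union> (V - J) \<notin> X \<and> \<beta> \<in> M \<and> \<beta> \<subseteq> J \<and> Suc (card \<beta>) = card \<sigma>"
        if nz: "g \<sigma> \<beta> \<noteq> 0" for \<sigma> \<beta>
      proof -
        have \<sigma>: "\<sigma> \<subseteq> J" using nz by (auto simp: g_def split: if_splits)
        then obtain v where v: "v \<in> \<sigma>" "f (J - {v}) (\<sigma> - {v}) \<beta> \<noteq> 0"
          using nz unfolding g_def by (metis (no_types, lifting) mult_eq_0_iff sum.neutral)
        note * = validD[OF valid' v(2)]
        \<comment> \<open>The vertex removed from both \<open>\<sigma>\<close> and \<open>J\<close>
          reappears in the complement, so lying outside the link carries over from
          \<open>J - {v}\<close> to \<open>J\<close>.\<close>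
        have "\<sigma> - {v} \<union> (V - (J - {v})) = \<sigma> \<union> (V - J)" using v(1) \<sigma> J by auto
        moreover have "card \<sigma> = Suc (card (\<sigma> - {v}))"
          using card_Suc_Diff1[OF finite_subset[OF \<sigma> finJ] v(1)] by simp
        ultimately show ?thesis using * v(1) \<sigma> by auto
      qed
      have g_cycle: "bd V (g \<sigma>) \<beta> = - cobd (\<lambda>\<tau>. g \<tau> \<beta>) \<sigma>" if \<sigma>: "\<sigma> \<subseteq> J" for \<sigma> \<beta>
      proof -
        have fin\<sigma>: "finite \<sigma>" using \<sigma> finJ finite_subset by blast
        let ?s = "\<lambda>H. \<Sum>v\<in>\<sigma>. vsign \<sigma> v * (\<Sum>u\<in>\<sigma> - {v}. vsign (\<sigma> - {v}) u * H v u)"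
        define H1 where "H1 v u = f (J - {v}) (\<sigma> - {v} - {u}) \<beta>" for v u
        define H2 where "H2 v u = f (J - {v} - {u}) (\<sigma> - {v} - {u}) \<beta>" for v u
        \<comment> \<open>For the facet \<open>\<tau> = \<sigma> - {v}\<close> the set
          \<open>J - (\<sigma> - \<tau>)\<close> is \<open>J - {v}\<close>. Written this way, the
          summand depends on \<open>\<tau>\<close> alone and \<open>bd_cobd\<close> applies.\<close>
        have "g \<sigma> = (\<lambda>\<beta>. cobd (\<lambda>\<tau>. f (J - (\<sigma> - \<tau>)) \<tau> \<beta>) \<sigma>)"
        proof
          fix \<beta>
          have "\<sigma> - (\<sigma> - {v}) = {v}" if "v \<in> \<sigma>" for v using that by auto
          then show "g \<sigma> \<beta> = cobd (\<lambda>\<tau>. f (J - (\<sigma> - \<tau>)) \<tau> \<beta>) \<sigma>"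
            using \<sigma> by (simp add: g_def cobd_def)
        qed
        then have "bd V (g \<sigma>) \<beta> = cobd (\<lambda>\<tau>. bd V (f (J - (\<sigma> - \<tau>)) \<tau>) \<beta>) \<sigma>"
          by (simp add: bd_cobd)
        also have "\<dots> = (\<Sum>v\<in>\<sigma>. vsign \<sigma> v * bd V (f (J - {v}) (\<sigma> - {v})) \<beta>)"
          unfolding cobd_def
        proof (rule sum.cong[OF refl])
          fix v assume "v \<in> \<sigma>"
          then have "\<sigma> - (\<sigma> - {v}) = {v}" by auto
          then show "vsign \<sigma> v * bd V (f (J - (\<sigma> - (\<sigma> - {v}))) (\<sigma> - {v})) \<beta> =
            vsign \<sigma> v * bd V (f (J - {v}) (\<sigma> - {v})) \<beta>" by simp
        qed
        also have "\<dots> = (\<Sum>v\<in>\<sigma>. vsign \<sigma> v * (\<Sum>u\<in>\<sigma> - {v}. vsign (\<sigma> - {v}) u * (H1 v u - H2 v u)))"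
        proof (rule sum.cong[OF refl])
          fix v assume "v \<in> \<sigma>"
          then have "v \<in> J" "\<sigma> - {v} \<subseteq> J - {v}" using \<sigma> by auto
          then show "vsign \<sigma> v * bd V (f (J - {v}) (\<sigma> - {v})) \<beta> =
            vsign \<sigma> v * (\<Sum>u\<in>\<sigma> - {v}. vsign (\<sigma> - {v}) u * (H1 v u - H2 v u))"
            using good'[of v] by (simp add: good_def H1_def H2_def)
        qed
        also have "\<dots> = ?s H1 - ?s H2"
          by (simp add: right_diff_distrib sum_subtractf)
        \<comment> \<open>\<open>H2\<close> is symmetric in the two removed vertices, so the sum
          equals its own negative.\<close>
        also have "?s H2 = 0"
        proof -
          have "?s H2 = - ?s (\<lambda>v u. H2 u v)" by (rule vsign_sum_swap[OF fin\<sigma>])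
          moreover have "H2 u v = H2 v u" for u v
          proof -
            have "J - {v} - {u} = J - {u} - {v}" "\<sigma> - {v} - {u} = \<sigma> - {u} - {v}" by auto
            then show ?thesis by (simp add: H2_def)
          qed
          ultimately show ?thesis by simp
        qed
        \<comment> \<open>In \<open>H1\<close> only the first removed vertex leaves
          \<open>J\<close>; after the exchange it is the second one, and the inner sums become the
          values of \<open>g\<close>.\<close>
        also have "?s H1 = - ?s (\<lambda>v u. H1 u v)" by (rule vsign_sum_swap[OF fin\<sigma>])
        also have "?s (\<lambda>v u. H1 u v) = cobd (\<lambda>\<tau>. g \<tau> \<beta>) \<sigma>"
        proof -
          have "g (\<sigma> - {v}) \<beta> = (\<Sum>u\<in>\<sigma> - {v}. vsign (\<sigma> - {v}) u * H1 u v)" for v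
          proof -
            have "\<sigma> - {v} \<subseteq> J" using \<sigma> by blast
            moreover have "\<sigma> - {v} - {u} = \<sigma> - {u} - {v}" for u by auto
            ultimately show ?thesis by (simp add: g_def H1_def)
          qed
          then show ?thesis by (simp add: cobd_def)
        qed
        finally show ?thesis by simp
      qed
      have "J \<noteq> {}" using J(2) by auto
      have "\<exists>F. valid J F \<and> (\<forall>\<sigma> \<beta>. \<sigma> \<subseteq> J \<longrightarrow> bd V (F \<sigma>) \<beta> = obstr g F \<sigma> \<beta>)"
        by (rule fill[OF J(1) \<open>J \<noteq> {}\<close>]) (fact g, fact g_cycle)
      moreover have "obstr g F \<sigma> \<beta> = cobd (\<lambda>\<tau>. F \<tau> \<beta>) \<sigma> - g \<sigma> \<beta>" for F \<sigma> \<beta>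
        by (rule obstr_def[OF J(1) \<open>J \<noteq> {}\<close>]) (fact g, fact g_cycle)
      ultimately have "\<exists>F. valid J F \<and> (\<forall>\<sigma> \<beta>. \<sigma> \<subseteq> J \<longrightarrow> bd V (F \<sigma>) \<beta> = cobd (\<lambda>\<tau>. F \<tau> \<beta>) \<sigma> - g \<sigma> \<beta>)"
        by simp
      then obtain F where F: "valid J F \<and> (\<forall>\<sigma> \<beta>. \<sigma> \<subseteq> J \<longrightarrow> bd V (F \<sigma>) \<beta> = cobd (\<lambda>\<tau>. F \<tau> \<beta>) \<sigma> - g \<sigma> \<beta>)" ..
      then show ?thesis
        by (intro exI[of _ F]) (simp add: R_def cobd_def g_def right_diff_distrib sum_subtractf)
    qed
    then obtain F where F: "\<And>J. \<lbrakk>J \<subseteq> V; card J = Suc n\<rbrakk> \<Longrightarrow> R J (F J)"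
      by metis
    define f' where "f' J = (if card J = Suc n then F J else f J)" for J
    have "good f' J" if J: "J \<subseteq> V" "card J \<le> Suc n" for J
    proof -
      have finJ: "finite J" using J V finite_subset by blast
      have rem: "f' (J - {v}) = f (J - {v})" if "v \<in> \<sigma>" "\<sigma> \<subseteq> J" for v \<sigma>
      proof -
        have "v \<in> J" using that by blast
        then have "card (J - {v}) \<noteq> Suc n"
          using J(2) finJ by (simp add: card_Diff_singleton)
        then show ?thesis by (simp add: f'_def)
      qed
      show ?thesis
      proof (cases "card J = Suc n")
        case True
        then have "f' J = F J" by (simp add: f'_def)
        then show ?thesis
          using F[OF J(1) True] rem unfolding good_def R_def by simp
      next
        case False
        then have "f' J = f J" "good f J" using J f(2) by (simp_all add: f'_def)
        then show ?thesis
          using rem unfolding good_def by simp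
      qed
    qed
    moreover have "f' {} {} {} = 1"
      using f(1) by (simp add: f'_def)
    ultimately show ?case by blast
  qed
  from this[of "card V"] obtain f where "f {} {} {} = 1" "\<And>J. J \<subseteq> V \<Longrightarrow> good f J"
    using card_mono[OF V] by blast
  then show ?thesis unfolding good_def by blast
qed

text \<open>For \<open>\<rho>\<close> avoiding \<open>v\<close>, compare coefficients at
  \<open>\<rho>\<close> in the equation for \<open>insert v \<rho>\<close>. The terms belonging to
  the vertex \<open>v\<close> are diagonal entries; the remaining ones are \<open>O1\<close> and
  \<open>O2\<close>, whose alternating sums agree.\<close>

lemma trace_invariant:
  assumes f: "\<And>J. J \<subseteq> V \<Longrightarrow> valid J (f J)"
    "\<And>J \<sigma> \<beta>. \<lbrakk>J \<subseteq> V; \<sigma> \<subseteq> J\<rbrakk> \<Longrightarrow> bd V (f J \<sigma>) \<beta> =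
       (\<Sum>v\<in>\<sigma>. vsign \<sigma> v * (f J (\<sigma> - {v}) \<beta> - f (J - {v}) (\<sigma> - {v}) \<beta>))"
    and J: "J \<subseteq> V" "v \<in> J"
  shows "(\<Sum>\<sigma>\<in>Pow J. (- 1) ^ card \<sigma> * f J \<sigma> \<sigma>) = (\<Sum>\<sigma>\<in>Pow (J - {v}). (- 1) ^ card \<sigma> * f (J - {v}) \<sigma> \<sigma>)"
proof -
  define L where "L = J - {v}"
  have L: "J = insert v L" "v \<notin> L" "finite L" "L \<subseteq> V"
    using J V finite_subset by (auto simp: L_def)
  define O1 where "O1 \<rho> x = vsign (insert v \<rho>) v * (vsign (insert x \<rho>) x * f J (insert v \<rho>) (insert x \<rho>))" for \<rho> x
  define O2 where "O2 \<rho> u = vsign (insert v \<rho>) v * (vsign (insert v \<rho>) u * f J (insert v (\<rho> - {u})) \<rho>)" for \<rho> u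
  have step: "f J (insert v \<rho>) (insert v \<rho>) + (\<Sum>x\<in>L - \<rho>. O1 \<rho> x) =
      f J \<rho> \<rho> - f L \<rho> \<rho> + (\<Sum>u\<in>\<rho>. O2 \<rho> u)" if \<rho>: "\<rho> \<subseteq> L" for \<rho>
  proof -
    let ?\<sigma> = "insert v \<rho>"
    have fin: "finite \<rho>" "v \<notin> \<rho>" using \<rho> L finite_subset by auto
    have "bd V (f J ?\<sigma>) \<rho> = (\<Sum>x\<in>insert v (L - \<rho>). vsign (insert x \<rho>) x * f J ?\<sigma> (insert x \<rho>))"
      unfolding bd_def
    proof (rule sum.mono_neutral_right)
      show "\<forall>x\<in>V - \<rho> - insert v (L - \<rho>). vsign (insert x \<rho>) x * f J ?\<sigma> (insert x \<rho>) = 0"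
      proof
        fix x assume "x \<in> V - \<rho> - insert v (L - \<rho>)"
        then have "\<not> insert x \<rho> \<subseteq> J" using L by auto
        then show "vsign (insert x \<rho>) x * f J ?\<sigma> (insert x \<rho>) = 0"
          using validD(4)[OF f(1)[OF J(1)]] by auto
      qed
    qed (use V L fin J in auto)
    then have lhs: "vsign ?\<sigma> v * bd V (f J ?\<sigma>) \<rho> = f J ?\<sigma> ?\<sigma> + (\<Sum>x\<in>L - \<rho>. O1 \<rho> x)"
      using L by (simp add: O1_def distrib_left sum_distrib_left flip: mult.assoc)
    have "bd V (f J ?\<sigma>) \<rho> = (\<Sum>u\<in>?\<sigma>. vsign ?\<sigma> u * (f J (?\<sigma> - {u}) \<rho> - f (J - {u}) (?\<sigma> - {u}) \<rho>))"
      using \<rho> L by (intro f(2) J(1)) auto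
    also have "\<dots> = vsign ?\<sigma> v * (f J \<rho> \<rho> - f L \<rho> \<rho>) +
        (\<Sum>u\<in>\<rho>. vsign ?\<sigma> u * (f J (?\<sigma> - {u}) \<rho> - f (J - {u}) (?\<sigma> - {u}) \<rho>))"
      using fin by (simp add: L_def)
    also have "(\<Sum>u\<in>\<rho>. vsign ?\<sigma> u * (f J (?\<sigma> - {u}) \<rho> - f (J - {u}) (?\<sigma> - {u}) \<rho>)) =
        (\<Sum>u\<in>\<rho>. vsign ?\<sigma> u * f J (insert v (\<rho> - {u})) \<rho>)"
    proof (rule sum.cong[OF refl])
      fix u assume u: "u \<in> \<rho>"
      \<comment> \<open>As \<open>u\<close> lies in \<open>\<rho>\<close>, validity for
        \<open>J - {u}\<close> makes the coefficient at \<open>\<rho>\<close> zero.\<close>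
      then have "\<not> \<rho> \<subseteq> J - {u}" "J - {u} \<subseteq> V" "?\<sigma> - {u} = insert v (\<rho> - {u})" using J fin by auto
      then have "f (J - {u}) (?\<sigma> - {u}) \<rho> = 0"
        using validD(4)[OF f(1)] by blast
      then show "vsign ?\<sigma> u * (f J (?\<sigma> - {u}) \<rho> - f (J - {u}) (?\<sigma> - {u}) \<rho>) =
        vsign ?\<sigma> u * f J (insert v (\<rho> - {u})) \<rho>"
        using \<open>?\<sigma> - {u} = _\<close> by simp
    qed
    finally have "vsign ?\<sigma> v * bd V (f J ?\<sigma>) \<rho> = f J \<rho> \<rho> - f L \<rho> \<rho> + (\<Sum>u\<in>\<rho>. O2 \<rho> u)"
      by (simp add: O2_def distrib_left sum_distrib_left flip: mult.assoc)
    with lhs show ?thesis by simp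
  qed
  \<comment> \<open>Enlarging \<open>\<rho>\<close> by \<open>x\<close> matches the entries of
    \<open>O1\<close> with those of \<open>O2\<close>; the sign from \<open>vsign_exchange\<close>
    cancels the change of parity of \<open>card \<rho>\<close>.\<close>
  have "(\<Sum>\<rho>\<in>Pow L. \<Sum>x\<in>L - \<rho>. (- 1) ^ card \<rho> * O1 \<rho> x) =
      (\<Sum>\<sigma>\<in>Pow L. \<Sum>u\<in>\<sigma>. (- 1) ^ card (\<sigma> - {u}) * O1 (\<sigma> - {u}) u)"
    by (rule sum_Pow_swap[OF L(3)])
  also have "\<dots> = (\<Sum>\<sigma>\<in>Pow L. \<Sum>u\<in>\<sigma>. (- 1) ^ card \<sigma> * O2 \<sigma> u)"
  proof (intro sum.cong refl)
    fix \<sigma> u assume \<sigma>: "\<sigma> \<in> Pow L" "u \<in> \<sigma>"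
    define \<rho> where "\<rho> = \<sigma> - {u}"
    have \<rho>: "\<sigma> = insert u \<rho>" "u \<notin> \<rho>" "finite \<rho>" "v \<notin> \<rho>" "v \<noteq> u"
      using \<sigma> L finite_subset by (auto simp: \<rho>_def)
    have "vsign (insert v \<rho>) v * vsign (insert u \<rho>) u =
        - (vsign (insert v (insert u \<rho>)) v * vsign (insert v (insert u \<rho>)) u :: rat)"
      using vsign_exchange[of \<rho> v u, where 'r = rat] \<rho> by simp
    then show "(- 1) ^ card (\<sigma> - {u}) * O1 (\<sigma> - {u}) u = (- 1) ^ card \<sigma> * O2 \<sigma> u"
      unfolding \<rho>_def[symmetric] O1_def O2_def using \<rho> by (simp flip: mult.assoc)
  qed
  finally have O: "(\<Sum>\<rho>\<in>Pow L. \<Sum>x\<in>L - \<rho>. (- 1) ^ card \<rho> * O1 \<rho> x) =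
    (\<Sum>\<sigma>\<in>Pow L. \<Sum>u\<in>\<sigma>. (- 1) ^ card \<sigma> * O2 \<sigma> u)" .
  have "(\<Sum>\<rho>\<in>Pow L. (- 1) ^ card \<rho> * (f J (insert v \<rho>) (insert v \<rho>) + (\<Sum>x\<in>L - \<rho>. O1 \<rho> x))) =
    (\<Sum>\<rho>\<in>Pow L. (- 1) ^ card \<rho> * (f J \<rho> \<rho> - f L \<rho> \<rho> + (\<Sum>u\<in>\<rho>. O2 \<rho> u)))"
    using step by (intro sum.cong) auto
  then have eq: "(\<Sum>\<rho>\<in>Pow L. (- 1) ^ card \<rho> * f J (insert v \<rho>) (insert v \<rho>)) =
      (\<Sum>\<rho>\<in>Pow L. (- 1) ^ card \<rho> * f J \<rho> \<rho>) - (\<Sum>\<rho>\<in>Pow L. (- 1) ^ card \<rho> * f L \<rho> \<rho>)"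
    using O by (simp add: distrib_left right_diff_distrib sum.distrib sum_subtractf sum_distrib_left)
  have "(\<Sum>\<sigma>\<in>Pow J. (- 1) ^ card \<sigma> * f J \<sigma> \<sigma>) =
    (\<Sum>\<sigma>\<in>Pow L. (- 1) ^ card \<sigma> * f J \<sigma> \<sigma>) + (\<Sum>\<sigma>\<in>insert v ` Pow L. (- 1) ^ card \<sigma> * f J \<sigma> \<sigma>)"
    unfolding L(1) Pow_insert using L by (intro sum.union_disjoint) auto
  also have "(\<Sum>\<sigma>\<in>insert v ` Pow L. (- 1) ^ card \<sigma> * f J \<sigma> \<sigma>) =
      (\<Sum>\<rho>\<in>Pow L. (- 1) ^ card (insert v \<rho>) * f J (insert v \<rho>) (insert v \<rho>))"
    using L by (subst sum.reindex) (auto simp: inj_on_def insert_ident subset_iff)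
  also have "\<dots> = - (\<Sum>\<rho>\<in>Pow L. (- 1) ^ card \<rho> * f J (insert v \<rho>) (insert v \<rho>))"
    unfolding sum_negf[symmetric]
  proof (intro sum.cong refl)
    fix \<rho> assume "\<rho> \<in> Pow L"
    then have "v \<notin> \<rho>" "finite \<rho>" using L finite_subset by auto
    then show "(- 1) ^ card (insert v \<rho>) * f J (insert v \<rho>) (insert v \<rho>) =
      - ((- 1) ^ card \<rho> * f J (insert v \<rho>) (insert v \<rho>))" by simp
  qed
  finally show ?thesis using eq by (simp add: L_def)
qed

lemma not_subcomplex:
  assumes "V \<notin> X"
  shows "\<not> M \<subseteq> X"
proof
  assume MX: "M \<subseteq> X"
  obtain f where f1: "f {} {} {} = 1" and f23: "\<forall>J\<subseteq>V. valid J (f J) \<and>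
    (\<forall>\<sigma>\<subseteq>J. \<forall>\<beta>. bd V (f J \<sigma>) \<beta> =
       (\<Sum>v\<in>\<sigma>. vsign \<sigma> v * (f J (\<sigma> - {v}) \<beta> - f (J - {v}) (\<sigma> - {v}) \<beta>)))"
    using fill_all[OF assms] by (elim exE conjE) (rule that)
  have f2: "valid J (f J)" if "J \<subseteq> V" for J
    using f23 that by blast
  have f3: "bd V (f J \<sigma>) \<beta> = (\<Sum>v\<in>\<sigma>. vsign \<sigma> v * (f J (\<sigma> - {v}) \<beta> - f (J - {v}) (\<sigma> - {v}) \<beta>))"
    if "J \<subseteq> V" "\<sigma> \<subseteq> J" for J \<sigma> \<beta>
    using f23 that by blast
  have "(\<Sum>\<sigma>\<in>Pow J. (- 1) ^ card \<sigma> * f J \<sigma> \<sigma>) = 1" if "finite J" "J \<subseteq> V" for J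
    using that
  proof (induction J rule: finite_induct)
    case (insert v J)
    then show ?case
      using trace_invariant[OF f2 f3, of "insert v J" v] by simp
  qed (simp add: f1)
  then have "(\<Sum>\<sigma>\<in>Pow V. (- 1) ^ card \<sigma> * f V \<sigma> \<sigma>) = 1"
    using V by blast
  \<comment> \<open>For \<open>J = V\<close> a nonzero diagonal entry would belong to a set in
    \<open>M\<close> that is not in \<open>X\<close>.\<close>
  moreover have "f V \<sigma> \<sigma> = 0" for \<sigma>
    using validD(2,3)[OF f2[OF order_refl], of \<sigma> \<sigma>] MX by auto
  ultimately show False by simp
qed

end

section \<open>Faces whose complement has small rank\<close>

lemma exists_face_rank_le_leray:
  assumes V: "finite V" and N: "fin_matroid N" "N \<subseteq> Pow V" and X: "fin_complex X" "X \<subseteq> Pow V"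
    and "V \<notin> X" "N \<subseteq> X"
  shows "\<exists>\<tau>\<in>X. rank_of N (V - \<tau>) \<le> leray_number (complex_link X \<tau>)"
proof (rule ccontr)
  assume neg: "\<not> ?thesis"
  have "acyclic_at V (complex_link X (V - J)) (rank_of N J)" if J: "J \<subseteq> V" for J
  proof (cases "V - J \<in> X")
    case True
    let ?L = "complex_link X (V - J)"
    have "V - (V - J) = J" using J by auto
    then have "leray_number ?L < rank_of N J"
      using neg True by (metis not_le)
    moreover have "?L \<subseteq> Pow V" using X(2) by (auto simp: complex_link_def)
    ultimately have "acyclic_at V (induced_complex ?L UNIV) (rank_of N J)"
      using leray_number_le_iff[OF V _ fin_complex_link[OF X(1) True], of "leray_number ?L"] by blast
    then show ?thesis by (simp add: induced_complex_def)
  next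
    case False
    \<comment> \<open>The link of a non-face has no members, not even the empty face, so only the
      zero chain lives on it.\<close>
    then have empty: "complex_link X (V - J) = {}"
      using fin_complex_downD[OF X(1)] unfolding complex_link_def by blast
    show ?thesis
      unfolding empty acyclic_at_def
    proof (intro allI impI)
      fix c :: "'a set \<Rightarrow> int" assume "chain_on {} (rank_of N J) c"
      then have "c = (\<lambda>_. 0)" by (auto simp: chain_on_def)
      then show "\<exists>b. chain_on {} (Suc (rank_of N J)) b \<and> bd V b = c"
        by (intro exI[of _ "\<lambda>_. 0"]) (simp add: chain_on_def)
    qed
  qed
  then interpret matroid_with_links N V X
    using assms by unfold_locales
  show False using not_subcomplex assms by blast
qed

text \<open>The sets of nullity at most \<open>e\<close> form the elongation of \<open>M\<close>;
  the bound \<open>n\<close> on the size truncates it.\<close>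

lemma fin_matroid_elongation:
  assumes V: "finite V" and M: "fin_matroid M"
  shows "fin_matroid {S. S \<subseteq> V \<and> card S \<le> n \<and> card S \<le> rank_of M S + e}" (is "fin_matroid ?N")
proof -
  interpret matroid M by standard fact
  have fin: "finite S" if "S \<in> ?N" for S using that V finite_subset by auto
  have remove: "S - {x} \<in> ?N" if "S \<in> ?N" for S x
  proof (cases "x \<in> S")
    case True
    then have "card S = Suc (card (S - {x}))" using fin[OF that] by (metis card_Suc_Diff1)
    moreover have "rank_of M S \<le> Suc (rank_of M (S - {x}))"
      using rank_insert_le[of x "S - {x}"] True by (simp add: insert_absorb)
    ultimately show ?thesis using that by auto
  qed (use that in simp)
  have down: "S - D \<in> ?N" if "finite D" "S \<in> ?N" for S D
    using that
  proof (induction D rule: finite_induct)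
    case (insert x D)
    then have "S - D - {x} \<in> ?N" using remove by blast
    moreover have "S - insert x D = S - D - {x}" by auto
    ultimately show ?case by simp
  qed simp
  have "?N \<subseteq> Pow V" by auto
  then have "finite ?N" using V finite_subset by blast
  moreover have "{} \<in> ?N" by simp
  then have "?N \<noteq> {}" by blast
  moreover have "\<forall>\<sigma>\<in>?N. \<forall>\<tau>. \<tau> \<subseteq> \<sigma> \<longrightarrow> \<tau> \<in> ?N"
  proof (intro ballI allI impI)
    fix \<sigma> \<tau> assume "\<sigma> \<in> ?N" "\<tau> \<subseteq> \<sigma>"
    then have "\<sigma> - (\<sigma> - \<tau>) \<in> ?N"
      using fin by (intro down finite_Diff)
    moreover have "\<sigma> - (\<sigma> - \<tau>) = \<tau>" using \<open>\<tau> \<subseteq> \<sigma>\<close> by blast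
    ultimately show "\<tau> \<in> ?N" by (simp only:)
  qed
  moreover have "\<exists>x\<in>B - A. insert x A \<in> ?N" if AB: "A \<in> ?N" "B \<in> ?N" "card A < card B" for A B
  \<comment> \<open>With nullity to spare any element of \<open>B - A\<close> may be added.
    Otherwise \<open>A\<close> has nullity exactly \<open>e\<close>, hence smaller rank than
    \<open>B\<close>, and an element of \<open>B\<close> raising the rank is added.\<close>
  proof (cases "card A < rank_of M A + e")
    case True
    obtain x where x: "x \<in> B - A"
      using AB(3) card_mono[OF fin[OF AB(1)], of B] by fastforce
    moreover have "rank_of M A \<le> rank_of M (insert x A)" by (rule rank_mono) auto
    ultimately show ?thesis
      using AB True fin[OF AB(1)] by (intro bexI[of _ x]) auto
  next
    case False
    then have "rank_of M A < rank_of M B" using AB by auto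
    have "\<exists>x\<in>B. rank_of M (insert x A) \<noteq> rank_of M A"
    proof (rule ccontr)
      assume "\<not> ?thesis"
      then have "rank_of M (A \<union> B) = rank_of M A" by (intro rank_Un_eqI) auto
      then show False
        using \<open>rank_of M A < rank_of M B\<close> rank_mono[of B "A \<union> B"] by simp
    qed
    then obtain x where x: "x \<in> B" "rank_of M (insert x A) \<noteq> rank_of M A" by blast
    then have "x \<notin> A" by (auto simp: insert_absorb)
    moreover have "rank_of M A \<le> rank_of M (insert x A)" by (rule rank_mono) auto
    ultimately show ?thesis
      using AB x fin[OF AB(1)] by (intro bexI[of _ x]) auto
  qed
  ultimately show ?thesis
    using fin unfolding fin_matroid_def fin_complex_def by blast
qed

text \<open>Only \<open>J\<close> itself has \<open>card J\<close> elements, and a nonzero multiple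
  of one nonempty simplex is not a cycle.\<close>

lemma leray_number_less_card:
  assumes J: "finite J" "J \<noteq> {}" and K: "fin_complex K" "K \<subseteq> Pow J"
  shows "leray_number K < card J"
proof -
  obtain j where j: "j \<in> J" using J by blast
  have pos: "card J > 0" using J by (simp add: card_gt_0_iff)
  have "acyclic_at J (induced_complex K W) n" if n: "card J - 1 < n" for W n
    unfolding acyclic_at_def
  proof (intro allI impI)
    fix c :: "'a set \<Rightarrow> int"
    assume c: "chain_on (induced_complex K W) n c" "bd J c = (\<lambda>\<sigma>. 0)"
    have c_top: "\<sigma> = J" if "c \<sigma> \<noteq> 0" for \<sigma>
    proof (rule card_seteq[OF J(1)])
      show "\<sigma> \<subseteq> J" "card J \<le> card \<sigma>"
        using chain_onD[OF c(1) that] K(2) n pos by (auto simp: induced_complex_def)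
    qed
    have "J - (J - {j}) = {j}" using j by auto
    then have "bd J c (J - {j}) = vsign J j * c J"
      using j by (simp add: bd_def insert_absorb)
    then have "c J = 0" using c(2) by simp
    then have "c = (\<lambda>\<sigma>. 0)" using c_top by auto
    then show "\<exists>b. chain_on (induced_complex K W) (Suc n) b \<and> bd J b = c"
      by (intro exI[of _ "\<lambda>_. 0"]) (simp add: chain_on_def)
  qed
  then have "leray_number K \<le> card J - 1"
    using leray_number_le_iff[OF J(1) K(2,1)] by blast
  then show ?thesis using pos by simp
qed

lemma leray_number_link_le:
  assumes "finite V" "X \<subseteq> Pow V" "fin_complex X" "\<tau> \<in> X"
  shows "leray_number (complex_link X \<tau>) \<le> leray_number X"
  using leray_number_link_antimono[OF assms, of "{}"] link_empty[OF assms(3)] by simp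

text \<open>The rank inequality for the nullity matroid \<open>N\<close> is translated back to
  \<open>M\<close>: a basis of \<open>N\<close> restricted to \<open>V - \<tau>\<close> turns out to
  have nullity exactly \<open>e\<close> and to span \<open>V - \<tau>\<close> in
  \<open>M\<close>.\<close>

lemma exists_face_nullity:
  assumes V: "finite V" and M: "fin_matroid M" "M \<subseteq> Pow V" and X: "fin_complex X" "X \<subseteq> Pow V"
    and "V \<notin> X" and d: "leray_number X \<le> d" and D: "D \<in> M" "card D = Suc d"
    and good: "\<And>S. \<lbrakk>S \<subseteq> V; card S = Suc d; Suc d \<le> rank_of M S + e\<rbrakk> \<Longrightarrow> S \<in> X"
  shows "\<exists>\<tau>\<in>X. rank_of M (V - \<tau>) + e \<le> leray_number (complex_link X \<tau>)"
proof -
  define N where "N = {S. S \<subseteq> V \<and> card S \<le> Suc d \<and> card S \<le> rank_of M S + e}"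
  have N: "fin_matroid N" unfolding N_def by (rule fin_matroid_elongation[OF V M(1)])
  interpret M: matroid M by standard fact
  interpret N: matroid N by standard fact
  have DN: "D \<in> N" using D M M.rank_indep[OF D(1)] by (auto simp: N_def)
  have "N \<subseteq> X"
  proof
    fix S assume S: "S \<in> N"
    then have "card S \<le> card D" using D by (simp add: N_def)
    \<comment> \<open>Only sets of exactly \<open>d + 1\<close> elements are known to be faces; with
      \<open>D\<close> every member of \<open>N\<close> can be enlarged to that size.\<close>
    then obtain C where C: "C \<in> N" "S \<subseteq> C" "C \<subseteq> S \<union> D" "card C = card D"
      by (rule matroid_extend[OF N S subset_UNIV DN subset_UNIV])
    then have "C \<in> X" using D by (intro good) (auto simp: N_def)
    then show "S \<in> X" using C(2) by (rule fin_complex_downD[OF X(1)])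
  qed
  moreover have "N \<subseteq> Pow V" by (auto simp: N_def)
  ultimately obtain \<tau> where \<tau>: "\<tau> \<in> X" "rank_of N (V - \<tau>) \<le> leray_number (complex_link X \<tau>)"
    using exists_face_rank_le_leray[OF V N _ X \<open>V \<notin> X\<close>] by blast
  let ?J = "V - \<tau>" and ?\<delta> = "leray_number (complex_link X \<tau>)"
  have finJ: "finite ?J" using V by simp
  have "?\<delta> \<le> d" using leray_number_link_le[OF V X(2,1) \<tau>(1)] d by simp
  obtain S where S: "S \<in> N" "S \<subseteq> ?J" "card S = rank_of N ?J" by (rule N.indep_of_rank)
  have finS: "finite S" using S finJ finite_subset by blast
  have "?J \<noteq> {}"
  proof
    assume "?J = {}"
    then have "\<tau> = V" using \<tau>(1) X(2) by auto
    then show False using \<tau>(1) \<open>V \<notin> X\<close> by simp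
  qed
  \<comment> \<open>Strictness shows that the basis \<open>S\<close> is not all of
    \<open>V - \<tau>\<close>; the element \<open>x0\<close> left over certifies that the nullity of
    \<open>S\<close> is exhausted.\<close>
  then have "?\<delta> < card ?J"
    using fin_complex_link[OF X(1) \<tau>(1)] X(2) finJ
    by (intro leray_number_less_card) (auto simp: complex_link_def)
  then have "S \<noteq> ?J" using S(3) \<tau>(2) by auto
  then obtain x0 where x0: "x0 \<in> ?J" "x0 \<notin> S" using S(2) by blast
  \<comment> \<open>\<open>S\<close> has at most \<open>d\<close> elements, so the size bound does
    not prevent adding \<open>x\<close>; only the nullity can.\<close>
  have step: "rank_of M (insert x S) = rank_of M S \<and> card S = rank_of M S + e" if x: "x \<in> ?J" "x \<notin> S" for x
  proof -
    have "insert x S \<notin> N"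
      using N.card_le_rank[of "insert x S" ?J] x S finS by auto
    moreover have "insert x S \<subseteq> V" "card (insert x S) \<le> Suc d"
      using x S \<tau>(2) \<open>?\<delta> \<le> d\<close> finS by auto
    ultimately have "rank_of M (insert x S) + e < Suc (card S)"
      using x finS by (auto simp: N_def)
    moreover have "rank_of M S \<le> rank_of M (insert x S)" by (rule M.rank_mono) auto
    moreover have "card S \<le> rank_of M S + e" using S by (simp add: N_def)
    ultimately show ?thesis by simp
  qed
  have "rank_of M (S \<union> ?J) = rank_of M S"
  proof (rule M.rank_Un_eqI)
    fix x assume "x \<in> ?J"
    then show "rank_of M (insert x S) = rank_of M S"
      using step[of x] by (cases "x \<in> S") (auto simp: insert_absorb)
  qed
  then have "rank_of M ?J = rank_of M S" using S(2) by (simp add: Un_absorb1)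
  then have "rank_of M ?J + e \<le> ?\<delta>" using step[OF x0] S(3) \<tau>(2) by simp
  then show ?thesis using \<tau>(1) by blast
qed

section \<open>Boundary cycles of a missing simplex\<close>

definition simplex_chain :: "'a set \<Rightarrow> 'a set \<Rightarrow> int" where
  "simplex_chain \<tau> \<sigma> = (if \<sigma> = \<tau> then 1 else 0)"

lemma bd_simplex_chain:
  assumes "finite V" "v \<in> V" "v \<notin> \<beta>"
  shows "bd V (simplex_chain (insert v \<beta>)) \<beta> = vsign (insert v \<beta>) v"
proof -
  have "insert x \<beta> = insert v \<beta> \<longleftrightarrow> x = v" if "x \<in> V - \<beta>" for x using that assms by auto
  then have "bd V (simplex_chain (insert v \<beta>)) \<beta> =
    (\<Sum>x\<in>V - \<beta>. if x = v then vsign (insert v \<beta>) v else 0)"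
    unfolding bd_def by (intro sum.cong) (auto simp: simplex_chain_def)
  then show ?thesis using assms by simp
qed

lemma bd_simplex_chain_nonzeroE:
  assumes "bd V (simplex_chain \<tau>) \<beta> \<noteq> 0"
  obtains v where "v \<in> \<tau>" "v \<in> V" "\<beta> = \<tau> - {v}"
proof -
  from assms obtain x where "x \<in> V - \<beta>" "simplex_chain \<tau> (insert x \<beta>) \<noteq> 0"
    by (rule bd_nonzeroE)
  then have "x \<in> \<tau>" "x \<in> V" "\<beta> = \<tau> - {x}" by (auto simp: simplex_chain_def split: if_splits)
  then show thesis by (rule that)
qed

lemma bd_bd_simplex_chain:
  assumes "finite V" "\<tau> \<subseteq> V"
  shows "bd V (bd V (simplex_chain \<tau>)) = (\<lambda>\<sigma>. 0)"
  by (rule bd_bd[OF assms(1)]) (metis assms(2) simplex_chain_def)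

text \<open>If two cones over the boundary of a missing simplex \<open>S\<close> lie in a \<open>d\<close>-Leray complex, with
  \<open>|S| = d + 1\<close>, then the suspension they form bounds, and a chain it bounds must use all the
  simplices joining the two apexes to the facets of \<open>S\<close>.\<close>

lemma join_boundary_face:
  assumes V: "finite V" and X: "fin_complex X" "X \<subseteq> Pow V" and d: "leray_number X \<le> d"
    and S: "S \<subseteq> V" "S \<notin> X" "card S = Suc d"
    and T: "\<And>v. v \<in> T \<Longrightarrow> v \<in> V - S" "\<And>v \<sigma>. \<lbrakk>v \<in> T; \<sigma> \<subset> S\<rbrakk> \<Longrightarrow> insert v \<sigma> \<in> X"
    and "T' \<subseteq> T" "T' \<noteq> {}" "\<sigma> \<subset> S"
  shows "\<sigma> \<union> T' \<in> X"
  using assms(10-12)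
proof (induction "card T'" arbitrary: T' \<sigma> rule: less_induct)
  case less
  have TV: "T \<subseteq> V" using T(1) by blast
  have finS: "finite S" using S V finite_subset by blast
  have finT': "finite T'" by (rule finite_subset[OF subset_trans[OF less.prems(1) TV] V])
  obtain x where x: "x \<in> T'" using less.prems by blast
  show ?case
  proof (cases "T' = {x}")
    case True
    then show ?thesis using T(2)[of x \<sigma>] less.prems by auto
  next
    case False
    then obtain y where y: "y \<in> T'" "y \<noteq> x" using x by blast
    \<comment> \<open>Dropping \<open>x\<close> or \<open>y\<close> from \<open>T'\<close> gives a
      smaller set, so by induction the link of \<open>R\<close> contains the cones from both
      \<open>x\<close> and \<open>y\<close> over the boundary of \<open>S\<close>.\<close>
    define R where "R = T' - {x, y}"
    have R: "T' = insert x (insert y R)" "x \<notin> R" "y \<notin> R" "R \<inter> S = {}" "x \<notin> S" "y \<notin> S" "x \<in> V" "y \<in> V"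
      using x y less.prems T(1) by (auto simp: R_def)
    have "card (insert x R) < card T'" "card (insert y R) < card T'"
      using R y finT' by auto
    then have IH: "\<sigma> \<union> insert x R \<in> X" "\<sigma> \<union> insert y R \<in> X" if "\<sigma> \<subset> S" for \<sigma>
      using less.hyps[of "insert x R" \<sigma>] less.hyps[of "insert y R" \<sigma>] that less.prems R by auto
    let ?K = "complex_link X R"
    have "{} \<subset> S" using S(3) by auto
    have RX: "R \<in> X" by (rule fin_complex_downD[OF X(1) IH(1)[OF \<open>{} \<subset> S\<close>]]) auto
    have KV: "?K \<subseteq> Pow V" using X(2) by (auto simp: complex_link_def)
    have "leray_number ?K \<le> d"
      using leray_number_link_le[OF V X(2,1) RX] d by simp
    then have acyc: "acyclic_at V (induced_complex ?K (insert x (insert y S))) (Suc d)"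
      using leray_number_le_iff[OF V KV fin_complex_link[OF X(1) RX]] by blast
    \<comment> \<open>The factors normalise both boundaries to coefficient 1 at \<open>S\<close>, so
      that \<open>S\<close>, which is not a face, cancels.\<close>
    define z where "z = (\<lambda>\<beta>. vsign (insert x S) x * bd V (simplex_chain (insert x S)) \<beta> -
      vsign (insert y S) y * bd V (simplex_chain (insert y S)) \<beta>)"
    have "z S = 0"
      using bd_simplex_chain[OF V R(7,5)] bd_simplex_chain[OF V R(8,6)] by (simp add: z_def)
    have part: "insert w (S - {v}) \<in> induced_complex ?K (insert x (insert y S)) \<and> card (insert w (S - {v})) = Suc d"
      if "v \<in> S" "w \<in> {x, y}" for v w
    proof -
      have "S - {v} \<subset> S" using that by blast
      then have "insert w (S - {v}) \<union> R \<in> X" using IH[of "S - {v}"] that(2) by auto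
      moreover have "insert w (S - {v}) \<inter> R = {}" using R that by auto
      moreover have "w \<notin> S" using R that by auto
      moreover have "card (S - {v}) = d" using S(3) finS that(1) by (simp add: card_Diff_singleton)
      ultimately show ?thesis
        using that finS by (auto simp: induced_complex_def mem_complex_link_iff[OF X(1)])
    qed
    have "chain_on (induced_complex ?K (insert x (insert y S))) (Suc d) z"
      unfolding chain_on_def
    proof (intro allI impI)
      fix \<beta> assume nz: "z \<beta> \<noteq> 0"
      then have "\<exists>w\<in>{x, y}. bd V (simplex_chain (insert w S)) \<beta> \<noteq> 0"
        by (auto simp: z_def)
      then obtain w where w: "w \<in> {x, y}" "bd V (simplex_chain (insert w S)) \<beta> \<noteq> 0" by blast
      from w(2) obtain v where v: "v \<in> insert w S" "\<beta> = insert w S - {v}"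
        by (rule bd_simplex_chain_nonzeroE)
      have "v \<noteq> w"
      proof
        assume "v = w"
        then have "\<beta> = S" using v R w by auto
        then show False using nz \<open>z S = 0\<close> by simp
      qed
      then have "v \<in> S" "\<beta> = insert w (S - {v})" using v by auto
      then show "\<beta> \<in> induced_complex ?K (insert x (insert y S)) \<and> card \<beta> = Suc d"
        using part w(1) by blast
    qed
    moreover have "bd V z = (\<lambda>\<sigma>. 0)"
      unfolding z_def bd_diff bd_mult using bd_bd_simplex_chain[OF V] R S by simp
    ultimately obtain b where b: "chain_on (induced_complex ?K (insert x (insert y S))) (Suc (Suc d)) b" "bd V b = z"
      using acyc unfolding acyclic_at_def by blast
    obtain s where s: "s \<in> S" "s \<notin> \<sigma>" using less.prems by blast
    \<comment> \<open>This simplex occurs in \<open>z\<close>, so \<open>b\<close> must use a coface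
      of it. Adding \<open>s\<close> would produce a set containing \<open>S\<close>; hence
      \<open>y\<close> is added, and with \<open>R\<close> this covers
      \<open>\<sigma> \<union> T'\<close>.\<close>
    define \<beta> where "\<beta> = insert x (S - {s})"
    have "z \<beta> \<noteq> 0"
    proof -
      have "s \<notin> \<beta>" "insert s \<beta> = insert x S" "s \<in> V" using s R S by (auto simp: \<beta>_def)
      then have "bd V (simplex_chain (insert x S)) \<beta> \<noteq> 0"
        using bd_simplex_chain[OF V, of s \<beta>] by simp
      moreover have "bd V (simplex_chain (insert y S)) \<beta> = 0"
      proof (rule ccontr)
        assume "bd V (simplex_chain (insert y S)) \<beta> \<noteq> 0"
        then obtain v where "\<beta> = insert y S - {v}" by (rule bd_simplex_chain_nonzeroE)
        then show False using R y by (auto simp: \<beta>_def)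
      qed
      ultimately show ?thesis by (simp add: z_def)
    qed
    then obtain w where w: "w \<in> V - \<beta>" "b (insert w \<beta>) \<noteq> 0"
      using b(2) bd_nonzeroE by metis
    have wK: "insert w \<beta> \<in> ?K" "insert w \<beta> \<subseteq> insert x (insert y S)"
      using chain_onD[OF b(1) w(2)] by (auto simp: induced_complex_def)
    have "w \<noteq> s"
    proof
      assume "w = s"
      then have "insert w \<beta> = insert x S" using s by (auto simp: \<beta>_def)
      then have "insert x S \<in> ?K" using wK(1) by simp
      then have "insert x S \<union> R \<in> X" by (simp add: mem_complex_link_iff[OF X(1)])
      then have "S \<in> X" by (rule fin_complex_downD[OF X(1)]) auto
      then show False using S(2) by simp
    qed
    then have "w = y" using wK(2) w(1) by (auto simp: \<beta>_def)
    then have "insert y \<beta> \<union> R \<in> X" using wK(1) by (simp add: mem_complex_link_iff[OF X(1)])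
    then show ?thesis
      by (rule fin_complex_downD[OF X(1)]) (use less.prems s R in \<open>auto simp: \<beta>_def\<close>)
  qed
qed

text \<open>The boundary of \<open>S\<close> is a cycle in the link of \<open>T\<close>. Within
  \<open>S\<close> only the simplex \<open>S\<close> could bound it, and that is not in the
  link.\<close>

lemma leray_number_link_ge:
  assumes V: "finite V" and X: "fin_complex X" "X \<subseteq> Pow V"
    and S: "S \<subseteq> V" "card S = Suc d" "S \<union> T \<notin> X" "S \<inter> T = {}"
    and T: "\<And>\<sigma>. \<sigma> \<subset> S \<Longrightarrow> \<sigma> \<union> T \<in> X"
  shows "d \<le> leray_number (complex_link X T)"
proof (rule ccontr)
  let ?L = "complex_link X T"
  assume "\<not> d \<le> leray_number ?L"
  have finS: "finite S" using S V finite_subset by blast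
  obtain s where s: "s \<in> S" using S(2) by fastforce
  have "{} \<subset> S" using s by blast
  then have TX: "T \<in> X" using T[of "{}"] by simp
  have LV: "?L \<subseteq> Pow V" using X(2) by (auto simp: complex_link_def)
  have "acyclic_at V (induced_complex ?L S) d"
    using leray_number_le_iff[OF V LV fin_complex_link[OF X(1) TX], of "leray_number ?L"]
      \<open>\<not> d \<le> leray_number ?L\<close> by auto
  moreover have "chain_on (induced_complex ?L S) d (bd V (simplex_chain S))"
    unfolding chain_on_def
  proof (intro allI impI)
    fix \<beta> assume "bd V (simplex_chain S) \<beta> \<noteq> 0"
    then obtain v where v: "v \<in> S" "\<beta> = S - {v}" by (rule bd_simplex_chain_nonzeroE)
    then show "\<beta> \<in> induced_complex ?L S \<and> card \<beta> = d"
      using T[of \<beta>] S finS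
      by (auto simp: induced_complex_def mem_complex_link_iff[OF X(1)] card_Diff_singleton)
  qed
  ultimately obtain b where b: "chain_on (induced_complex ?L S) (Suc d) b" "bd V b = bd V (simplex_chain S)"
    using bd_bd_simplex_chain[OF V S(1)] unfolding acyclic_at_def by blast
  have b0: "b = (\<lambda>\<sigma>. 0)"
  proof (rule ext, rule ccontr)
    fix \<sigma> assume "b \<sigma> \<noteq> 0"
    then have "\<sigma> \<in> ?L" "\<sigma> \<subseteq> S" "card \<sigma> = Suc d"
      using chain_onD[OF b(1)] by (auto simp: induced_complex_def)
    then have "S \<in> ?L" using card_subset_eq[OF finS, of \<sigma>] S(2) by simp
    then show False using S(3) by (simp add: mem_complex_link_iff[OF X(1)])
  qed
  have "bd V (simplex_chain S) = (\<lambda>\<sigma>. 0)"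
    using b(2) unfolding b0 bd_zero by (rule sym)
  moreover have "bd V (simplex_chain S) (S - {s}) \<noteq> 0"
    using bd_simplex_chain[OF V, of s "S - {s}"] s S(1) by (auto simp: insert_absorb)
  ultimately show False by simp
qed

lemma binomial_ge_self:
  assumes "1 \<le> j" "j < n"
  shows "n \<le> n choose j"
  using assms
proof (induction n arbitrary: j)
  case (Suc n)
  obtain i where i: "j = Suc i" using Suc.prems by (cases j) auto
  show ?case
  proof (cases "j = n")
    case True
    then show ?thesis using binomial_symmetric[of n "Suc n"] by simp
  next
    case False
    then have "n \<le> n choose j" using Suc by simp
    moreover have "n choose i > 0" using i Suc.prems by (simp add: zero_less_binomial_iff)
    ultimately show ?thesis unfolding i binomial_Suc_Suc by linarith
  qed
qed simp

section \<open>The sum of link-Leray dimensions\<close>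

locale leray_matroid = matroid M for M :: "'a set set" +
  fixes V :: "'a set" and X :: "'a set set" and d r k p :: nat
  assumes V: "finite V" and MV: "vertex_set M = V" and r: "matroid_rank M = r"
    and X: "fin_complex X" "X \<subseteq> Pow V" and d: "leray_number X \<le> d"
    and dr: "1 \<le> d" "Suc d \<le> r" and k: "1 \<le> k" "k \<le> r"
    and p: "p = (if k = 1 then 1 else d + 1)"
begin

abbreviation \<delta> :: "'a set \<Rightarrow> 'a set \<Rightarrow> int" where
  "\<delta> B I \<equiv> link_leray_dim X (V - matroid_span M (B - I))"

definition has_nonneg_sum :: bool where
  "has_nonneg_sum \<longleftrightarrow> (\<exists>B \<in> matroid_bases M. \<exists>I :: nat \<Rightarrow> 'a set. inj_on I {1..p} \<and>
     (\<forall>i \<in> {1..p}. I i \<subseteq> B \<and> card (I i) = r - k + 1) \<and> (\<Sum>i = 1..p. \<delta> B (I i)) \<ge> 0)"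

lemma M_Pow: "M \<subseteq> Pow V"
  using MV by (auto simp: vertex_set_def)

lemma rank_V: "\<rho> V = r"
proof -
  have "induced_complex M V = M" using M_Pow by (auto simp: induced_complex_def)
  then show ?thesis using r by (simp add: rank_of_def)
qed

lemma basisI: "B \<in> M \<Longrightarrow> card B = r \<Longrightarrow> B \<in> matroid_bases M"
proof -
  assume B: "B \<in> M" "card B = r"
  have "A = B" if "A \<in> M" "B \<subseteq> A" for A
    using card_le_rank[of A V] card_seteq[OF fin[OF that(1)] that(2)] that M_Pow B rank_V by auto
  then show ?thesis using B by (auto simp: matroid_bases_def)
qed

lemma sum_nonneg_basisI:
  assumes B: "B \<in> M" "card B = r" and P: "finite P" "card P = p"
    and I: "\<And>I. I \<in> P \<Longrightarrow> I \<subseteq> B \<and> card I = r - k + 1" and sum: "(\<Sum>I\<in>P. \<delta> B I) \<ge> 0"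
  shows has_nonneg_sum
proof -
  obtain h where h: "bij_betw h {1..p} P"
    using ex_bij_betw_nat_finite_1[OF P(1)] P(2) by auto
  have "(\<Sum>i = 1..p. \<delta> B (h i)) = (\<Sum>I\<in>P. \<delta> B I)"
    by (rule sum.reindex_bij_betw[OF h])
  moreover have "h i \<in> P" if "i \<in> {1..p}" for i using h that bij_betwE by blast
  ultimately show ?thesis
    using sum I basisI[OF B] bij_betw_imp_inj_on[OF h] unfolding has_nonneg_sum_def by metis
qed

text \<open>Links of smaller faces have larger Leray numbers, so it suffices that everything outside
  the span lies in \<open>\<tau>\<close>.\<close>

lemma delta_ge:
  assumes "\<tau> \<in> X" "V - matroid_span M (B - I) \<subseteq> \<tau>"
  shows "\<delta> B I \<ge> int (leray_number (complex_link X \<tau>))"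
  using leray_number_link_antimono[OF V X(2,1) assms] fin_complex_downD[OF X(1) assms]
  by (simp add: link_leray_dim_def)

lemma delta_ge_minus_1: "\<delta> B I \<ge> - 1"
  by (simp add: link_leray_dim_def)

lemma choose_ge_p: "p \<le> r choose (r - k + 1)"
proof (cases "k = 1")
  case True
  then show ?thesis using p k dr by simp
next
  case False
  then have "r \<le> r choose (r - k + 1)" using k by (intro binomial_ge_self) auto
  then show ?thesis using p dr False by simp
qed

lemma sum_nonneg_if_simplex:
  assumes "V \<in> X"
  shows has_nonneg_sum
proof -
  obtain B where B: "B \<in> M" "card B = r"
    using indep_of_rank[of V] rank_V by metis
  let ?H = "{I. I \<subseteq> B \<and> card I = r - k + 1}"
  have "p \<le> card ?H" using n_subsets[OF fin[OF B(1)]] B(2) choose_ge_p by simp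
  then obtain P where P: "P \<subseteq> ?H" "card P = p" "finite P"
    by (rule obtain_subset_with_card_n)
  have "(\<Sum>I\<in>P. \<delta> B I) \<ge> 0"
  proof (rule sum_nonneg)
    fix I
    have "int (leray_number (complex_link X V)) \<le> \<delta> B I" by (rule delta_ge[OF assms]) blast
    then show "0 \<le> \<delta> B I" by linarith
  qed
  then show has_nonneg_sum using P by (intro sum_nonneg_basisI[OF B P(3,2)]) auto
qed

text \<open>Let a basis \<open>A\<close> of \<open>V - \<tau>\<close> lie in a basis
  \<open>B\<close>. If \<open>I\<close> avoids \<open>A\<close>, then \<open>B - I\<close> spans
  \<open>V - \<tau>\<close>, and the term of \<open>I\<close> is at least \<open>D\<close>. Every
  other term is at least -1, so it remains to count the sets \<open>I\<close> avoiding
  \<open>A\<close>.\<close>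

lemma sum_nonneg_if_face:
  assumes \<tau>: "\<tau> \<in> X" and f: "\<rho> (V - \<tau>) + d + 1 \<le> leray_number (complex_link X \<tau>) + k"
  shows has_nonneg_sum
proof -
  define D where "D = leray_number (complex_link X \<tau>)"
  define f where "f = \<rho> (V - \<tau>)"
  have Dd: "D \<le> d" using leray_number_link_le[OF V X(2,1) \<tau>] d by (simp add: D_def)
  have fD: "f + d + 1 \<le> D + k" using assms(2) by (simp add: D_def f_def)
  obtain A where A: "A \<in> M" "A \<subseteq> V - \<tau>" "card A = f"
    unfolding f_def by (rule indep_of_rank)
  have "A \<subseteq> V" using A by blast
  then obtain B where B: "B \<in> M" "A \<subseteq> B" "B \<subseteq> V" "card B = \<rho> V"
    by (rule extend_to_rank[OF A(1)])
  have Br: "card B = r" using B rank_V by simp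
  have finB: "finite B" by (rule fin[OF B(1)])
  define G where "G = {I. I \<subseteq> B - A \<and> card I = r - k + 1}"
  define H where "H = {I. I \<subseteq> B \<and> card I = r - k + 1}"
  have GH: "G \<subseteq> H" "finite H" using finB by (auto simp: G_def H_def)
  then have finG: "finite G" using finite_subset by blast
  have "card (B - A) = r - f"
    using B A Br fin[OF A(1)] by (simp add: card_Diff_subset)
  then have cardG: "card G = (r - f) choose (r - k + 1)"
    using n_subsets[of "B - A" "r - k + 1"] finB by (simp add: G_def)
  have cardH: "card H = r choose (r - k + 1)"
    using n_subsets[OF finB] Br by (simp add: H_def)
  have good: "\<delta> B I \<ge> int D" if "I \<in> G" for I
    unfolding D_def
  proof (rule delta_ge[OF \<tau>], rule subsetI, rule ccontr)
    fix v assume v: "v \<in> V - matroid_span M (B - I)" "v \<notin> \<tau>"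
    have "\<rho> (insert v A) \<le> \<rho> (V - \<tau>)" using v A by (intro rank_mono) auto
    moreover have "\<rho> A \<le> \<rho> (insert v A)" by (rule rank_mono) auto
    ultimately have "\<rho> (insert v A) = \<rho> A" using A rank_indep[OF A(1)] by (simp add: f_def)
    moreover have "A \<subseteq> B - I" using that B by (auto simp: G_def)
    ultimately have "\<rho> (insert v (B - I)) = \<rho> (B - I)" by (rule rank_insert_eq_mono)
    then show False using v MV by (simp add: matroid_span_def)
  qed
  \<comment> \<open>Equivalently, \<open>card G\<close> terms of value \<open>D\<close> outweigh
    \<open>p - card G\<close> terms of value -1. If \<open>k = 1\<close>, then \<open>f = 0\<close>;
    if \<open>f = k - 1\<close>, there is one good set but \<open>D = d\<close>; otherwise there are
    at least \<open>k - f\<close> good sets.\<close>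
  have count: "card G * (D + 1) \<ge> p"
  proof (cases "k = 1")
    case True
    then have "f = 0" using fD Dd by simp
    then show ?thesis using cardG True p k dr by simp
  next
    case False
    show ?thesis
    proof (cases "f = k - 1")
      case True
      then have "r - f = r - k + 1" using k by simp
      then have "card G = 1" using cardG by simp
      moreover have "d \<le> D" using fD True k by simp
      ultimately show ?thesis using p False by simp
    next
      case fk: False
      then have "f + 2 \<le> k" using fD Dd by simp
      then have "r - f \<le> card G" unfolding cardG using k by (intro binomial_ge_self) auto
      moreover have "k - f \<le> r - f" using k by simp
      ultimately have "(k - f) * (D + 1) \<le> card G * (D + 1)"
        by (intro mult_right_mono) auto
      \<comment> \<open>A product of positive integers is at least their sum minus 1, and
        \<open>fD\<close> bounds \<open>k - f + D\<close> below by \<open>d + 1\<close>.\<close>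
      moreover have "(k - f - 1) * 1 + (D + 1) \<le> (k - f - 1) * (D + 1) + (D + 1)"
        by (intro add_mono mult_left_mono) auto
      moreover have "(k - f - 1) * (D + 1) + (D + 1) = (k - f) * (D + 1)"
      proof -
        have "k - f = Suc (k - f - 1)" using \<open>f + 2 \<le> k\<close> by simp
        then show ?thesis by (metis mult_Suc add.commute)
      qed
      ultimately have "(k - f - 1) + (D + 1) \<le> card G * (D + 1)" by linarith
      then show ?thesis using fD \<open>f + 2 \<le> k\<close> p False by simp
    qed
  qed
  show has_nonneg_sum
  proof (cases "p \<le> card G")
    case True
    then obtain P where P: "P \<subseteq> G" "card P = p" "finite P"
      using obtain_subset_with_card_n by metis
    have "(\<Sum>I\<in>P. \<delta> B I) \<ge> 0"
    proof (rule sum_nonneg)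
      fix I assume "I \<in> P"
      then have "int D \<le> \<delta> B I" using good P(1) by blast
      then show "0 \<le> \<delta> B I" by linarith
    qed
    then show has_nonneg_sum
      using P GH by (intro sum_nonneg_basisI[OF B(1) Br P(3,2)]) (auto simp: H_def)
  next
    case False
    then obtain P where P: "G \<subseteq> P" "P \<subseteq> H" "card P = p"
      using exists_subset_between[of G p H] choose_ge_p cardH GH by (metis nat_le_linear)
    have finP: "finite P" using P GH finite_subset by blast
    have "(\<Sum>I\<in>G. int D) + (\<Sum>I\<in>P - G. - 1) \<le> (\<Sum>I\<in>G. \<delta> B I) + (\<Sum>I\<in>P - G. \<delta> B I)"
      using good delta_ge_minus_1 by (intro add_mono sum_mono) auto
    also have "\<dots> = (\<Sum>I\<in>P. \<delta> B I)"
      using sum.subset_diff[OF P(1) finP, of "\<delta> B"] by simp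
    finally have "int (card G) * int D - int (card (P - G)) \<le> (\<Sum>I\<in>P. \<delta> B I)" by simp
    moreover have "card (P - G) + card G = p"
      using P finG False by (simp add: card_Diff_subset)
    then have "card (P - G) \<le> card G * D" using count by simp
    then have "int (card (P - G)) \<le> int (card G) * int D" by (metis of_nat_le_iff of_nat_mult)
    ultimately have "(\<Sum>I\<in>P. \<delta> B I) \<ge> 0" by linarith
    then show has_nonneg_sum
      using P by (intro sum_nonneg_basisI[OF B(1) Br finP P(3)]) (auto simp: H_def)
  qed
qed

text \<open>Each \<open>s\<close> in \<open>S\<close> gives a different set
  \<open>I = B - (C - {s})\<close>. The span of \<open>C - {s}\<close> misses at most
  \<open>insert s (V - C)\<close>, which is a face, so none of these \<open>d + 1\<close> terms is
  negative.\<close>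

lemma sum_nonneg_if_missing_simplex:
  assumes "k \<noteq> 1" and S: "card S = Suc d" "S \<subseteq> C" and C: "C \<in> M" "card C = k"
    and T: "\<And>s. s \<in> S \<Longrightarrow> insert s (V - C) \<in> X"
  shows has_nonneg_sum
proof -
  have "C \<subseteq> V" using C M_Pow by blast
  then obtain B where B: "B \<in> M" "C \<subseteq> B" "B \<subseteq> V" "card B = \<rho> V"
    by (rule extend_to_rank[OF C(1)])
  have Br: "card B = r" using B rank_V by simp
  have finC: "finite C" and finB: "finite B" using B C fin by auto
  define P where "P = (\<lambda>s. B - (C - {s})) ` S"
  have inj: "inj_on (\<lambda>s. B - (C - {s})) S"
  proof (rule inj_onI)
    fix s t assume "s \<in> S" "t \<in> S" "B - (C - {s}) = B - (C - {t})"
    then show "s = t" using S(2) B(2) by blast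
  qed
  have "card P = p" unfolding P_def card_image[OF inj] using S(1) p assms(1) by simp
  moreover have "finite P" using S finC finite_subset by (auto simp: P_def)
  moreover have "I \<subseteq> B \<and> card I = r - k + 1" if "I \<in> P" for I
  proof -
    obtain s where s: "s \<in> S" "I = B - (C - {s})" using \<open>I \<in> P\<close> by (auto simp: P_def)
    have "card (C - {s}) = k - 1" using s(1) S(2) C(2) finC by (simp add: card_Diff_singleton subsetD)
    moreover have "card I = card B - card (C - {s})"
      unfolding s(2) using B(2) finC by (intro card_Diff_subset) auto
    ultimately show ?thesis using s(2) Br k by auto
  qed
  moreover have "(\<Sum>I\<in>P. \<delta> B I) \<ge> 0"
  proof (rule sum_nonneg)
    fix I assume "I \<in> P"
    then obtain s where s: "s \<in> S" "I = B - (C - {s})" by (auto simp: P_def)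
    have "B - I = C - {s}" using s B(2) by blast
    moreover have "C - {s} \<subseteq> matroid_span M (C - {s})"
      using MV \<open>C \<subseteq> V\<close> by (auto simp: matroid_span_def insert_absorb)
    ultimately have "int (leray_number (complex_link X (insert s (V - C)))) \<le> \<delta> B I"
      by (intro delta_ge T s(1)) auto
    then show "0 \<le> \<delta> B I" by linarith
  qed
  ultimately show has_nonneg_sum by (intro sum_nonneg_basisI[OF B(1) Br])
qed

end

theorem theorem2p7:
  fixes d r m k p :: nat
    and V :: "'a set"
    and X M :: "'a set set"
  assumes "d \<ge> 1" and "r \<ge> d + 1"
    and "1 \<le> m" and "m \<le> r"
    and "m \<le> k" and "k \<le> min (m + d) r"
    and "m = 1 \<or> k \<ge> m + d - 1"
    and "finite V" and "card V \<ge> max (m + d) r"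
    and "fin_complex X" and "vertex_set X = V" and "d_leray d X"
    and "fin_matroid M" and "vertex_set M = V" and "matroid_rank M = r"
    and "\<And>(u :: nat \<Rightarrow> 'a) (v :: nat \<Rightarrow> 'a) U.
           \<lbrakk> U = u ` {1..d + 1} \<union> v ` {1..m - 1}; U \<subseteq> V; card U = d + m; rank_of M U \<ge> k \<rbrakk> \<Longrightarrow>
           u ` {1..d + 1} \<in> X \<or>
           (\<exists>j \<in> {1..m - 1}. \<forall>\<sigma>. \<sigma> \<subset> u ` {1..d + 1} \<longrightarrow> \<sigma> \<union> {v j} \<in> X)"
    and "p = (if k = 1 then 1 else d + 1)"
  shows "\<exists>B \<in> matroid_bases M. \<exists>I :: nat \<Rightarrow> 'a set.
           inj_on I {1..p} \<and>
           (\<forall>i \<in> {1..p}. I i \<subseteq> B \<and> card (I i) = r - k + 1) \<and>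
           (\<Sum>i = 1..p. link_leray_dim X (V - matroid_span M (B - I i))) \<ge> 0"
proof -
  have XV: "X \<subseteq> Pow V" using assms(11) by (auto simp: vertex_set_def)
  have d: "leray_number X \<le> d" using assms(12) by (simp add: d_leray_def)
  interpret leray_matroid M V X d r k p
    using assms XV d by unfold_locales auto
  note V = \<open>finite V\<close> and X = \<open>fin_complex X\<close> and M = \<open>fin_matroid M\<close>
  \<comment> \<open>The assumption on labellings is restated for disjoint sets; choosing
    enumerations of \<open>S\<close> and \<open>Q\<close> recovers it.\<close>
  have hyp: "S \<in> X \<or> (\<exists>q\<in>Q. \<forall>\<sigma>. \<sigma> \<subset> S \<longrightarrow> insert q \<sigma> \<in> X)"
    if SQ: "S \<subseteq> V" "Q \<subseteq> V" "S \<inter> Q = {}" "card S = Suc d" "card Q = m - 1" "rank_of M (S \<union> Q) \<ge> k" for S Q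
  proof -
    have fin: "finite S" "finite Q" using SQ V finite_subset by auto
    obtain u where u: "bij_betw u {1..d + 1} S"
      using ex_bij_betw_nat_finite_1[OF fin(1)] SQ(4) by auto
    obtain v where v: "bij_betw v {1..m - 1} Q"
      using ex_bij_betw_nat_finite_1[OF fin(2)] SQ(5) by auto
    have uv: "u ` {1..d + 1} = S" "v ` {1..m - 1} = Q"
      using u v by (simp_all add: bij_betw_def)
    have "card (S \<union> Q) = d + m"
      using card_Un_disjoint[OF fin SQ(3)] SQ(4,5) \<open>1 \<le> m\<close> by simp
    then have "S \<in> X \<or> (\<exists>j \<in> {1..m - 1}. \<forall>\<sigma>. \<sigma> \<subset> S \<longrightarrow> \<sigma> \<union> {v j} \<in> X)"
      using assms(16)[of "S \<union> Q" u v] uv SQ by simp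
    then show ?thesis using uv(2) by auto
  qed
  have has_nonneg_sum
  proof (cases "V \<in> X")
    case True
    then show ?thesis by (rule sum_nonneg_if_simplex)
  next
    case VX: False
    \<comment> \<open>For a set of \<open>d + 1\<close> elements, rank at least \<open>k'\<close>
      means nullity at most \<open>e\<close>.\<close>
    define k' where "k' = k - m + 1"
    define e where "e = d + 1 - k'"
    have k': "k' \<le> d + 1" "1 \<le> k'" "k = k' + m - 1"
      using assms(3,5,6) by (auto simp: k'_def)
    show ?thesis
    proof (cases "\<forall>S. S \<subseteq> V \<longrightarrow> card S = Suc d \<longrightarrow> k' \<le> rank_of M S \<longrightarrow> S \<in> X")
      case True
      obtain D0 where D0: "D0 \<in> M" "card D0 = r"
        using indep_of_rank[of V] rank_V by metis
      then obtain D where D: "D \<subseteq> D0" "card D = Suc d"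
        using obtain_subset_with_card_n[of "Suc d" D0] assms(2) by auto
      have "\<exists>\<tau>\<in>X. rank_of M (V - \<tau>) + e \<le> leray_number (complex_link X \<tau>)"
      proof (rule exists_face_nullity[OF V M M_Pow X XV VX d down[OF D0(1) D(1)] D(2)])
        show "S \<in> X" if "S \<subseteq> V" "card S = Suc d" "Suc d \<le> rank_of M S + e" for S
          using True that k' by (auto simp: e_def)
      qed
      then obtain \<tau> where "\<tau> \<in> X" "rank_of M (V - \<tau>) + e \<le> leray_number (complex_link X \<tau>)" by blast
      then show ?thesis
        using k' assms(3) by (intro sum_nonneg_if_face[of \<tau>]) (auto simp: e_def)
    next
      case False
      then obtain S where S: "S \<subseteq> V" "card S = Suc d" "k' \<le> rank_of M S" "S \<notin> X" by blast
      \<comment> \<open>For \<open>m = 1\<close> the set \<open>Q\<close> is empty and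
        \<open>k' = k\<close>, so the assumption would make \<open>S\<close> a face.\<close>
      have m: "2 \<le> m"
      proof (rule ccontr)
        assume "\<not> 2 \<le> m"
        then have "m = 1" using assms(3) by simp
        then show False using hyp[of S "{}"] S k' by simp
      qed
      then have km: "m + d - 1 \<le> k" "k \<noteq> 1" using assms(1,7) by auto
      have finS: "finite S" using S(1) V finite_subset by blast
      define T where "T = {v \<in> V - S. \<forall>\<sigma>. \<sigma> \<subset> S \<longrightarrow> insert v \<sigma> \<in> X}"
      define W where "W = V - S - T"
      have SW: "S \<union> W = V - T" using S(1) by (auto simp: W_def T_def)
      have faces: "\<sigma> \<union> T' \<in> X" if "T' \<subseteq> T" "T' \<noteq> {}" "\<sigma> \<subset> S" for T' \<sigma>
        by (rule join_boundary_face[OF V X XV d S(1,4,2) _ _ that]) (auto simp: T_def)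
      \<comment> \<open>\<open>S\<close> is not a face and no element of \<open>W\<close> is an apex
        of a cone over its boundary, so both alternatives of the assumption fail.\<close>
      have noQ: "rank_of M (S \<union> Q) < k" if QW: "Q \<subseteq> W" "card Q = m - 1" for Q
      proof (rule ccontr)
        assume "\<not> rank_of M (S \<union> Q) < k"
        moreover have "Q \<subseteq> V" "S \<inter> Q = {}" using QW by (auto simp: W_def)
        ultimately obtain q where "q \<in> Q" "\<forall>\<sigma>. \<sigma> \<subset> S \<longrightarrow> insert q \<sigma> \<in> X"
          using hyp[of S Q] S QW by auto
        then show False using QW by (auto simp: W_def T_def)
      qed
      show ?thesis
      proof (cases "rank_of M (V - T) < k")
        case True
        have "T \<noteq> {}"
        proof
          assume "T = {}"
          then show False using True rank_V k by simp
        qed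
        moreover have "{} \<subset> S" using S(2) by auto
        ultimately have "T \<in> X" using faces[of T "{}"] by simp
        have "d \<le> leray_number (complex_link X T)"
        proof (rule leray_number_link_ge[OF V X XV S(1,2)])
          show "S \<union> T \<notin> X" using S(4) fin_complex_downD[OF X, of "S \<union> T" S] by blast
          show "S \<inter> T = {}" by (auto simp: T_def)
          show "\<sigma> \<union> T \<in> X" if "\<sigma> \<subset> S" for \<sigma> using faces[of T \<sigma>] that \<open>T \<noteq> {}\<close> by simp
        qed
        then show ?thesis using True \<open>T \<in> X\<close> by (intro sum_nonneg_if_face[of T]) auto
      next
        case False
        obtain A where A: "A \<in> M" "A \<subseteq> S" "card A = rank_of M S" by (rule indep_of_rank)
        have "A \<subseteq> S \<union> W" using A by blast
        then obtain C1 where C1: "C1 \<in> M" "A \<subseteq> C1" "C1 \<subseteq> S \<union> W" "card C1 = rank_of M (S \<union> W)"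
          by (rule extend_to_rank[OF A(1)])
        have Ad: "card A \<le> Suc d" using A(2) S(2) card_mono[OF finS] by metis
        have Ak: "card A \<le> k" using Ad km m by linarith
        have "k \<le> card C1" using C1 False SW by simp
        \<comment> \<open>Keeping a basis \<open>A\<close> of \<open>S\<close> inside
          \<open>C\<close> forces \<open>C \<inter> S = A\<close>, so \<open>C - S\<close> has
          exactly \<open>k - card A\<close> elements.\<close>
        then obtain C where C: "A \<subseteq> C" "C \<subseteq> C1" "card C = k"
          using exists_subset_between[OF Ak _ C1(2) fin[OF C1(1)]] by blast
        have CM: "C \<in> M" by (rule down[OF C1(1) C(2)])
        have finC: "finite C" by (rule fin[OF CM])
        have CS: "C \<inter> S = A"
        proof -
          have "C \<inter> S \<in> M" by (rule down[OF CM]) blast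
          then have "card (C \<inter> S) \<le> card A" using card_le_rank[of "C \<inter> S" S] A(3) by simp
          then show ?thesis using card_seteq[of "C \<inter> S" A] finC A C by auto
        qed
        define Q where "Q = C - S"
        have Q: "Q \<subseteq> W" "C = A \<union> Q" using C C1 CS by (auto simp: Q_def)
        have "A \<inter> Q = {}" using A(2) by (auto simp: Q_def)
        moreover have "finite A" "finite Q" using finite_subset[OF C(1) finC] finC by (simp_all add: Q_def)
        ultimately have "card (A \<union> Q) = card A + card Q" by (intro card_Un_disjoint)
        then have cardQ: "card A + card Q = k"
          unfolding Q(2)[symmetric] C(3) by (rule sym)
        have kSQ: "k \<le> rank_of M (S \<union> Q')" if "Q \<subseteq> Q'" for Q'
          using card_le_rank[OF CM, of "S \<union> Q'"] C(3) Q A that by auto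
        have "card Q \<noteq> m - 1" using noQ[OF Q(1)] kSQ[of Q] by auto
        \<comment> \<open>From \<open>card A \<ge> k'\<close> follows
          \<open>card Q \<le> m - 1\<close>, where equality is excluded. Hence
          \<open>card A \<ge> k - m + 2 \<ge> d + 1\<close>, which is also its upper bound, and all
          these inequalities are equalities.\<close>
        then have "card A = Suc d" "k = m + d - 1" and cQ: "card Q = m - 2"
          using cardQ Ad A(3) S(3) k' km m by linarith+
        then have "A = S" using card_seteq[OF finS A(2)] S(2) by simp
        \<comment> \<open>One more element of \<open>W\<close> would bring \<open>Q\<close> to the
          excluded size \<open>m - 1\<close> without lowering the rank below
          \<open>k\<close>.\<close>
        have "W = Q"
        proof (rule ccontr)
          assume "W \<noteq> Q"
          then obtain w where w: "w \<in> W" "w \<notin> Q" using Q(1) by blast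
          have "finite Q" using finC by (simp add: Q_def)
          then have "card (insert w Q) = m - 1" using w cQ m by simp
          then show False using noQ[of "insert w Q"] w Q(1) kSQ[of "insert w Q"] by auto
        qed
        then have CVT: "C = V - T" using Q(2) \<open>A = S\<close> SW by simp
        then have VC: "V - C = T" by (auto simp: T_def)
        \<comment> \<open>Otherwise \<open>V = C\<close> would have only
          \<open>k = m + d - 1\<close> elements, fewer than the required
          \<open>m + d\<close>.\<close>
        have "T \<noteq> {}"
        proof
          assume "T = {}"
          then have "card V = k" using CVT C(3) by simp
          moreover have "m + d \<le> card V" using assms(9) by simp
          ultimately show False using \<open>k = m + d - 1\<close> m by linarith
        qed
        show ?thesis
        proof (rule sum_nonneg_if_missing_simplex[OF km(2) S(2) _ CM C(3)])
          show "S \<subseteq> C" using Q(2) \<open>A = S\<close> by blast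
          fix s assume "s \<in> S"
          moreover have "S \<noteq> {s}" using S(2) assms(1) by auto
          ultimately have "{s} \<subset> S" by blast
          then show "insert s (V - C) \<in> X" using faces[of T "{s}"] \<open>T \<noteq> {}\<close> VC by simp
        qed
      qed
    qed
  qed
  then show ?thesis unfolding has_nonneg_sum_def .
qed

end
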